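(* Let $\alpha>0$ and let $a=\{a_k\}_{k\ge 1}\subset D$ be a sequence satisfying the Newman–Carleson condition $(N\text{-}C)$ and the Stoltz condition $(S)$. Then: a) If $f\in m_\alpha$, then $\{f'(a_k)(1-|a_k|^2)\}_{k\ge 1}\in l^1$. b) For each sequence $x=\{x_k\}_{k\ge 1}\in l^1$ there is a function $f\in m_\alpha$ such that $f'(a_k)(1-|a_k|^2)=x_k$ for all $k=1,2,\ldots$.
   Context: $D$ is the open unit disk in $\mathbb{C}$ and $T$ is the unit circle. $M$ is the Banach space of all complex-valued Borel measures on $T$ with the variation norm. For $\alpha>0$, $F_\alpha$ is the family of all functions $g$ on $D$ for which there exists $\mu\in M$ such that $$g(z)=\int_T \frac{1}{(1-\overline{\zeta}z)^{\alpha}}\,d\mu(\zeta),\qquad z\in D,$$ where the power is the principal branch (equal to $1$ at $z=0$). A function $f$ holomorphic in $D$ is called a multiplier of $F_\alpha$ if $g\in F_\alpha$ implies $fg\in F_\alpha$; $m_\alpha$ denotes the set of all multipliers of $F_\alpha$. A sequence $a=\{a_k\}_{k\ge1}\subset D$ satisfies the Newman–Carleson condition $(N\text{-}C)$ if $$\delta(a)=\inf_{n\ge 1}\ \prod_{k\ne n}\left|\frac{a_k-a_n}{1-\overline{a}_k a_n}\right|>0.$$ It satisfies the Stoltz condition $(S)$ if $$\sup_{k\ge 1}\frac{|1-a_k|}{1-|a_k|}<\infty.$$ $l^1$ is the set of complex sequences $x=\{x_k\}_{k\ge1}$ with $\sum_{k\ge 1}|x_k|<\infty$. *)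

theory Defs
  imports "HOL-Analysis.Analysis"
begin

(* Convergence of the series is automatically absolute, since the hypothesis also covers
   every rearrangement of A.  Values of \<mu> outside sets M are irrelevant. *)
definition complex_measure_on :: "'a measure \<Rightarrow> ('a set \<Rightarrow> complex) \<Rightarrow> bool" where
  "complex_measure_on M \<mu> \<longleftrightarrow>
    (\<forall>A :: nat \<Rightarrow> 'a set. range A \<subseteq> sets M \<longrightarrow> disjoint_family A \<longrightarrow>
      (\<lambda>n. \<mu> (A n)) sums \<mu> (\<Union>n. A n))"

(* Positive variation of a finite signed measure \<nu> (the positive part of its Jordan
   decomposition); the negative variation is the positive variation of - \<nu>.
   ennreal truncates negative values to 0, which does not affect the supremum
   because B = {} contributes \<nu> {} = 0. *)
definition positive_variation :: "'a measure \<Rightarrow> ('a set \<Rightarrow> real) \<Rightarrow> 'a measure" where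
  "positive_variation M \<nu> =
    measure_of (space M) (sets M) (\<lambda>A. SUP B\<in>{B \<in> sets M. B \<subseteq> A}. ennreal (\<nu> B))"

definition signed_integral ::
    "'a measure \<Rightarrow> ('a set \<Rightarrow> real) \<Rightarrow> ('a \<Rightarrow> complex) \<Rightarrow> complex" where
  "signed_integral M \<nu> f =
    integral\<^sup>L (positive_variation M \<nu>) f - integral\<^sup>L (positive_variation M (\<lambda>A. - \<nu> A)) f"

definition complex_measure_integral ::
    "'a measure \<Rightarrow> ('a set \<Rightarrow> complex) \<Rightarrow> ('a \<Rightarrow> complex) \<Rightarrow> complex" where
  "complex_measure_integral M \<mu> f =
    signed_integral M (\<lambda>A. Re (\<mu> A)) f + \<i> * signed_integral M (\<lambda>A. Im (\<mu> A)) f"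

abbreviation unit_disk :: "complex set" where
  "unit_disk \<equiv> ball 0 1"

abbreviation circle_borel :: "complex measure" where
  "circle_borel \<equiv> restrict_space borel (sphere 0 1)"

(* Functions on the disk are represented by total functions whose values outside the
   disk are unconstrained.  For z in the disk and \<zeta> on the circle, 1 - cnj \<zeta> * z lies in
   the right half-plane, where powr is the principal branch. *)
definition F_family :: "real \<Rightarrow> (complex \<Rightarrow> complex) set" where
  "F_family \<alpha> =
    {g. \<exists>\<mu>. complex_measure_on circle_borel \<mu> \<and>
      (\<forall>z\<in>unit_disk. g z =
        complex_measure_integral circle_borel \<mu>
          (\<lambda>\<zeta>. 1 / (1 - cnj \<zeta> * z) powr complex_of_real \<alpha>))}"

definition multipliers :: "real \<Rightarrow> (complex \<Rightarrow> complex) set" where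
  "multipliers \<alpha> =
    {f. f holomorphic_on unit_disk \<and> (\<forall>g\<in>F_family \<alpha>. (\<lambda>z. f z * g z) \<in> F_family \<alpha>)}"

(* The product is taken as the limit of the partial products, which are decreasing for a
   sequence in the disk.  prodinf is unsuitable: it is unspecified for
   products that diverge to 0. *)
definition separation_product :: "(nat \<Rightarrow> complex) \<Rightarrow> nat \<Rightarrow> real" where
  "separation_product a n =
    lim (\<lambda>N. \<Prod>k\<in>{..<N} - {n}. cmod ((a k - a n) / (1 - cnj (a k) * a n)))"

definition newman_carleson :: "(nat \<Rightarrow> complex) \<Rightarrow> bool" where
  "newman_carleson a \<longleftrightarrow> (INF n. separation_product a n) > 0"

definition stoltz :: "(nat \<Rightarrow> complex) \<Rightarrow> bool" where
  "stoltz a \<longleftrightarrow> bdd_above (range (\<lambda>k. cmod (1 - a k) / (1 - cmod (a k))))"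

definition l1 :: "(nat \<Rightarrow> complex) set" where
  "l1 = {x. summable (\<lambda>k. cmod (x k))}"

end

(*
  Every function 1/(1 - cnj eta z)^alpha with eta in the disk is an average of the kernels on the
  circle against the Poisson kernel.  Combining this with the Feynman formula
    1/(A B^alpha) = alpha * int_0^1 (1-s)^(alpha-1) / (s A + (1-s) B)^(alpha+1) ds,
  for A = 1 - cnj w z and B = 1 - cnj zeta z, integrated by parts in s, shows that the Blaschke
  factors b_w(z) = (z - w)/(1 - cnj w z) are multipliers of F_alpha with norms
  bounded uniformly in w.

  a) If f is a multiplier, then f(z) (1-z)^(-alpha) is the transform of a measure mu, so f'(a_k) is an
  integral of an explicit function against mu.  In a Stoltz angle the Newman-Carleson condition leaves
  boundedly many points in each dyadic range of 1 - |a_k|, so that the sum over k of the integrands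
  is bounded uniformly on the circle.

  b) Near a_k one uses the product of b_k, of the squares of the boundedly many b_j with 1 - |a_j|
  comparable to 1 - |a_k|, and of a power of (1-z)(1-|a_k|^2)/(1 - cnj a_k z)^2, which is small
  at the remaining points.  These functions have bounded multiplier norms and solve the
  interpolation problem up to an error of half the norm of the data, which is removed by iteration.
*)
theory Submission
  imports Defs "HOL-Complex_Analysis.Complex_Analysis"
begin

section \<open>Jordan decomposition of signed measures\<close>

text \<open>The bound obtained for a product of Blaschke factors grows geometrically with their
  number, so the Blaschke product over all other points cannot serve to isolate \<open>a k\<close>.
  Hence the split in b): a number of factors independent of \<open>k\<close> deals with the points
  of comparable depth, and a factor decaying with the depth ratio deals with the infinitely many
  others. The integration by parts has a similar reason. The Feynman formula produces kernels of
  exponent \<alpha> + 1, that is, derivatives of kernels of exponent \<alpha> at a point y of the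
  segment from w to \<zeta>, and the density for such a derivative has mass 1 / (1 - |y|^2). On the
  part of the segment near the circle these masses grow like 1 / (1 - r), whose integral diverges.
  Integrating by parts inserts the missing factor 1 - r and leaves a point mass at \<zeta>; the
  price is a division by the difference of w and \<zeta>, for which the numerator 1 - |w|^2
  compensates.\<close>

definition signed_measure_on :: "'a measure \<Rightarrow> ('a set \<Rightarrow> real) \<Rightarrow> bool" where
  "signed_measure_on M \<nu> \<longleftrightarrow>
    (\<forall>A :: nat \<Rightarrow> 'a set. range A \<subseteq> sets M \<longrightarrow> disjoint_family A \<longrightarrow>
      (\<lambda>n. \<nu> (A n)) sums \<nu> (\<Union>n. A n))"

lemma signed_measure_onD:
  "signed_measure_on M \<nu> \<Longrightarrow> range A \<subseteq> sets M \<Longrightarrow> disjoint_family A \<Longrightarrow>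
    (\<lambda>n::nat. \<nu> (A n)) sums \<nu> (\<Union>n. A n)"
  by (auto simp: signed_measure_on_def)

lemma signed_measure_on_uminus:
  assumes "signed_measure_on M \<nu>" shows "signed_measure_on M (\<lambda>A. - \<nu> A)"
  using assms unfolding signed_measure_on_def by (auto intro!: sums_minus)

lemma signed_measure_empty:
  assumes "signed_measure_on M \<nu>" shows "\<nu> {} = 0"
proof -
  have "(\<lambda>n::nat. \<nu> {}) sums \<nu> (\<Union>n::nat. {})"
    using signed_measure_onD[OF assms, of "\<lambda>_. {}"] by (auto simp: disjoint_family_on_def)
  then have "summable (\<lambda>n::nat. \<nu> {})" by (rule sums_summable)
  then show ?thesis by (simp add: summable_const_iff)
qed

lemma signed_measure_Un:
  assumes \<nu>: "signed_measure_on M \<nu>" and "A \<in> sets M" "B \<in> sets M" "A \<inter> B = {}"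
  shows "\<nu> (A \<union> B) = \<nu> A + \<nu> B"
proof -
  have "(\<lambda>n. \<nu> (binaryset A B n)) sums \<nu> (\<Union>n. binaryset A B n)"
    using assms by (intro signed_measure_onD[OF \<nu>])
      (auto simp: binaryset_def disjoint_family_on_def)
  then have "(\<lambda>n. \<nu> (binaryset A B n)) sums \<nu> (A \<union> B)" by (simp add: UN_binaryset_eq)
  moreover have "(\<lambda>n. \<nu> (binaryset A B n)) sums (\<nu> A + \<nu> B)"
    by (rule binaryset_sums) (rule signed_measure_empty[OF \<nu>])
  ultimately show ?thesis by (rule sums_unique2)
qed

lemma signed_measure_Diff:
  assumes \<nu>: "signed_measure_on M \<nu>" and "A \<in> sets M" "B \<in> sets M" "B \<subseteq> A"
  shows "\<nu> (A - B) = \<nu> A - \<nu> B"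
proof -
  have "B \<union> (A - B) = A" using assms by auto
  then show ?thesis using signed_measure_Un[OF \<nu>, of B "A - B"] assms by auto
qed

text \<open>If the values on subsets were unbounded, one could split off infinitely many disjoint
  pieces of absolute value at least 1, contradicting convergence of the series.\<close>
lemma signed_measure_bounded:
  assumes \<nu>: "signed_measure_on M \<nu>"
  shows "\<exists>C. \<forall>A\<in>sets M. \<bar>\<nu> A\<bar> \<le> C"
proof (rule ccontr)
  assume neg: "\<not> ?thesis"
  define unb where "unb A \<longleftrightarrow> (\<forall>C. \<exists>B\<in>sets M. B \<subseteq> A \<and> \<bar>\<nu> B\<bar> > C)" for A
  have split: "unb B \<or> unb (A - B)" if A: "unb A" "A \<in> sets M" "B \<in> sets M" for A B
  proof (rule ccontr)
    assume "\<not> (unb B \<or> unb (A - B))"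
    then obtain C1 C2 where C1: "\<And>X. X \<in> sets M \<Longrightarrow> X \<subseteq> B \<Longrightarrow> \<bar>\<nu> X\<bar> \<le> C1"
      and C2: "\<And>X. X \<in> sets M \<Longrightarrow> X \<subseteq> A - B \<Longrightarrow> \<bar>\<nu> X\<bar> \<le> C2"
      unfolding unb_def by (meson not_less)
    obtain X where X: "X \<in> sets M" "X \<subseteq> A" "\<bar>\<nu> X\<bar> > C1 + C2" using A by (auto simp: unb_def)
    have "\<nu> X = \<nu> (X \<inter> B) + \<nu> (X - B)"
      using signed_measure_Un[OF \<nu>, of "X \<inter> B" "X - B"] X A by (simp add: Int_Diff_Un Int_Diff_disjoint)
    moreover have "\<bar>\<nu> (X \<inter> B)\<bar> \<le> C1" "\<bar>\<nu> (X - B)\<bar> \<le> C2" using X A by (auto intro!: C1 C2)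
    ultimately show False using X(3) by linarith
  qed
  have step: "\<exists>A'. (unb A' \<and> A' \<in> sets M) \<and> (A' \<subseteq> A \<and> 1 \<le> \<bar>\<nu> (A - A')\<bar>)"
    if A: "unb A \<and> A \<in> sets M" for A
  proof -
    \<comment> \<open>The excess over \<open>\<bar>\<nu> A\<bar>\<close> makes both
      \<open>\<bar>\<nu> B\<bar>\<close> and \<open>\<bar>\<nu> (A - B)\<bar>\<close> at least 1, so
      whichever half is still unbounded can be kept while the other one is split off.\<close>
    obtain B where B: "B \<in> sets M" "B \<subseteq> A" "\<bar>\<nu> B\<bar> > 1 + \<bar>\<nu> A\<bar>"
      using A unfolding unb_def by blast
    have d: "\<nu> (A - B) = \<nu> A - \<nu> B" using signed_measure_Diff[OF \<nu>] A B by auto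
    have dd: "A - (A - B) = B" using B by auto
    from split[of A B] A B consider "unb B" | "unb (A - B)" by auto
    then show ?thesis
    proof cases
      case 1 then show ?thesis using B d by (intro exI[of _ B]) auto
    next
      case 2 then show ?thesis using B d A by (intro exI[of _ "A - B"]) (auto simp: dd)
    qed
  qed
  have "unb (space M)"
    unfolding unb_def using neg sets.sets_into_space by (metis linorder_not_le)
  then have "\<exists>A. unb A \<and> A \<in> sets M" by auto
  from dependent_nat_choice[of "\<lambda>_ A. unb A \<and> A \<in> sets M"
      "\<lambda>_ A A'. A' \<subseteq> A \<and> 1 \<le> \<bar>\<nu> (A - A')\<bar>", OF this step]
  obtain A where A: "\<And>n. unb (A n) \<and> A n \<in> sets M"
    and A': "\<And>n. A (Suc n) \<subseteq> A n \<and> 1 \<le> \<bar>\<nu> (A n - A (Suc n))\<bar>" by auto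
  have "decseq A" using A' by (auto intro: decseq_SucI)
  have "disjoint_family (\<lambda>n. A n - A (Suc n))"
    unfolding disjoint_family_on_def
  proof (intro ballI impI)
    fix m n :: nat assume "m \<noteq> n"
    have *: "(A i - A (Suc i)) \<inter> (A j - A (Suc j)) = {}" if "i < j" for i j
      using decseqD[OF \<open>decseq A\<close>, of "Suc i" j] that by auto
    show "(A m - A (Suc m)) \<inter> (A n - A (Suc n)) = {}"
      using *[of m n] *[of n m] \<open>m \<noteq> n\<close> by (cases "m < n") auto
  qed
  then have "(\<lambda>n. \<nu> (A n - A (Suc n))) sums \<nu> (\<Union>n. A n - A (Suc n))"
    using A by (intro signed_measure_onD[OF \<nu>]) auto
  then have "(\<lambda>n. \<nu> (A n - A (Suc n))) \<longlonglongrightarrow> 0" using sums_summable summable_LIMSEQ_zero by blast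
  then have "\<forall>\<^sub>F n in sequentially. \<bar>\<nu> (A n - A (Suc n))\<bar> < 1"
    using order_tendstoD(2)[OF tendsto_rabs_zero] by fastforce
  then show False using A' by (auto simp: eventually_sequentially not_less[symmetric])
qed

lemma space_positive_variation [simp]: "space (positive_variation M \<nu>) = space M"
  and sets_positive_variation [simp]: "sets (positive_variation M \<nu>) = sets M"
  unfolding positive_variation_def
  by (auto simp: space_measure_of_conv sets_measure_of_conv sets.space_closed sets.sigma_sets_eq)

text \<open>\<open>measure_of\<close> falls back to the zero measure unless the given set function
  is countably additive, so additivity of the supremum has to be proved. One inequality cuts a
  subset of the union along the pieces \<open>A n\<close>, the other joins subsets of disjoint
  sets.\<close>

lemma emeasure_positive_variation:
  assumes \<nu>: "signed_measure_on M \<nu>" and A: "A \<in> sets M"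
  shows "emeasure (positive_variation M \<nu>) A = (SUP B\<in>{B \<in> sets M. B \<subseteq> A}. ennreal (\<nu> B))"
proof (rule emeasure_measure_of[OF positive_variation_def])
  define p where "p A = (SUP B\<in>{B \<in> sets M. B \<subseteq> A}. ennreal (\<nu> B))" for A
  have p0: "p {} = 0"
    by (auto simp: p_def signed_measure_empty[OF \<nu>] conj_commute cong: conj_cong)
  have pI: "ennreal (\<nu> B) \<le> p A" if "B \<in> sets M" "B \<subseteq> A" for A B
    using that by (auto simp: p_def intro!: SUP_upper)
  have pmono: "p A \<le> p B" if "A \<subseteq> B" for A B
    using that by (auto simp: p_def intro!: SUP_subset_mono)
  have psuper: "p A + p B \<le> p (A \<union> B)" if AB: "A \<in> sets M" "B \<in> sets M" "A \<inter> B = {}" for A B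
  proof -
    have ne: "{C \<in> sets M. C \<subseteq> D} \<noteq> {}" for D by auto
    have "ennreal (\<nu> X) + ennreal (\<nu> Y) \<le> p (A \<union> B)"
      if "X \<in> sets M" "X \<subseteq> A" "Y \<in> sets M" "Y \<subseteq> B" for X Y
    proof -
      have "\<nu> (X \<union> Y) = \<nu> X + \<nu> Y" using that AB by (intro signed_measure_Un[OF \<nu>]) auto
      moreover have "ennreal (\<nu> (X \<union> Y)) \<le> p (A \<union> B)" "ennreal (\<nu> X) \<le> p (A \<union> B)"
        "ennreal (\<nu> Y) \<le> p (A \<union> B)" using that by (auto intro!: pI)
      \<comment> \<open>If one of the two values is negative, \<open>ennreal\<close> truncates it to
        0 and the bound for the other set alone suffices.\<close>
      ultimately show ?thesis unfolding ennreal_plus_if by (auto simp: ennreal_neg)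
    qed
    then have "(SUP X\<in>{C\<in>sets M. C \<subseteq> A}. ennreal (\<nu> X) + p B) \<le> p (A \<union> B)"
      unfolding p_def[of B]
      by (auto simp: ennreal_SUP_add_right[OF ne] intro!: SUP_least)
    then show ?thesis unfolding p_def[of A] by (simp add: ennreal_SUP_add_left[OF ne])
  qed
  have psub: "p (\<Union>n. A n) \<le> (\<Sum>n. p (A n))"
    if A: "range A \<subseteq> sets M" "disjoint_family A" for A :: "nat \<Rightarrow> _"
    unfolding p_def[of "\<Union>n. A n"]
  proof (rule SUP_least, clarify)
    fix B assume B: "B \<in> sets M" "B \<subseteq> (\<Union>n. A n)"
    have "(\<lambda>n. \<nu> (B \<inter> A n)) sums \<nu> (\<Union>n. B \<inter> A n)"
      using A B by (intro signed_measure_onD[OF \<nu>]) (auto simp: disjoint_family_on_def)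
    moreover have "(\<Union>n. B \<inter> A n) = B" using B by auto
    ultimately have "(\<lambda>N. \<Sum>n<N. \<nu> (B \<inter> A n)) \<longlonglongrightarrow> \<nu> B" by (simp add: sums_def)
    then have "(\<lambda>N. ennreal (\<Sum>n<N. \<nu> (B \<inter> A n))) \<longlonglongrightarrow> ennreal (\<nu> B)" by (rule tendsto_ennrealI)
    then show "ennreal (\<nu> B) \<le> (\<Sum>n. p (A n))"
    proof (rule LIMSEQ_le_const2, intro exI allI impI)
      fix N
      have "ennreal (\<Sum>n<N. \<nu> (B \<inter> A n)) \<le> (\<Sum>n<N. ennreal (\<nu> (B \<inter> A n)))"
      proof (induction N)
        case (Suc N)
        have "ennreal (a + b) \<le> ennreal a + ennreal b" for a b
          unfolding ennreal_plus_if by (auto intro!: ennreal_leI)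
        with Suc show ?case by (simp del: ennreal_plus) (meson add_right_mono order_trans)
      qed simp
      also have "\<dots> \<le> (\<Sum>n<N. p (A n))" using A B by (intro sum_mono pI) auto
      also have "\<dots> \<le> (\<Sum>n. p (A n))" by (rule sum_le_suminf) auto
      finally show "ennreal (\<Sum>n<N. \<nu> (B \<inter> A n)) \<le> (\<Sum>n. p (A n))" .
    qed
  qed
  have psup: "(\<Sum>n. p (A n)) \<le> p (\<Union>n. A n)"
    if A: "range A \<subseteq> sets M" "disjoint_family A" for A :: "nat \<Rightarrow> _"
  proof (rule suminf_le_const)
    fix N
    have "(\<Sum>n<N. p (A n)) \<le> p (\<Union>n<N. A n)"
    proof (induction N)
      case (Suc N)
      have "(\<Union>n<N. A n) \<inter> A N = {}"
        using A(2) by (auto simp: disjoint_family_on_def) (metis IntI UNIV_I empty_iff less_irrefl)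
      then have "p (\<Union>n<N. A n) + p (A N) \<le> p ((\<Union>n<N. A n) \<union> A N)"
        using A(1) by (intro psuper) auto
      with add_right_mono[OF Suc, of "p (A N)"]
      have "(\<Sum>n<N. p (A n)) + p (A N) \<le> p ((\<Union>n<N. A n) \<union> A N)" by (rule order_trans)
      then show ?case by (simp add: lessThan_Suc Un_commute add.commute)
    qed (simp add: p0)
    also have "\<dots> \<le> p (\<Union>n. A n)" by (rule pmono) auto
    finally show "(\<Sum>n<N. p (A n)) \<le> p (\<Union>n. A n)" .
  qed auto
  show "countably_additive (sets (positive_variation M \<nu>)) (\<lambda>A. SUP B\<in>{B \<in> sets M. B \<subseteq> A}. ennreal (\<nu> B))"
    unfolding countably_additive_def p_def[symmetric]
    using psub psup by (auto intro!: antisym)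
  show "positive (sets (positive_variation M \<nu>)) (\<lambda>A. SUP B\<in>{B \<in> sets M. B \<subseteq> A}. ennreal (\<nu> B))"
    unfolding positive_def p_def[symmetric] by (rule p0)
qed (use A in \<open>auto simp: sets.space_closed\<close>)

lemma emeasure_positive_variation_le:
  assumes "signed_measure_on M \<nu>" and "A \<in> sets M"
    and "\<And>B. B \<in> sets M \<Longrightarrow> B \<subseteq> A \<Longrightarrow> \<nu> B \<le> C"
  shows "emeasure (positive_variation M \<nu>) A \<le> ennreal C"
  using assms by (auto simp: emeasure_positive_variation intro!: SUP_least ennreal_leI)

lemma finite_measure_positive_variation:
  assumes \<nu>: "signed_measure_on M \<nu>"
  shows "finite_measure (positive_variation M \<nu>)"
proof
  obtain C where "\<And>A. A \<in> sets M \<Longrightarrow> \<bar>\<nu> A\<bar> \<le> C" using signed_measure_bounded[OF \<nu>] by auto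
  then have "emeasure (positive_variation M \<nu>) (space M) \<le> ennreal C"
    by (intro emeasure_positive_variation_le[OF \<nu>]) (auto dest: abs_le_D1)
  then show "emeasure (positive_variation M \<nu>) (space (positive_variation M \<nu>)) \<noteq> \<infinity>"
    by (auto simp: top_unique)
qed

lemma measure_positive_variation_le:
  assumes \<nu>: "signed_measure_on M \<nu>" and A: "A \<in> sets M"
    and C: "\<And>B. B \<in> sets M \<Longrightarrow> B \<subseteq> A \<Longrightarrow> \<nu> B \<le> C"
  shows "measure (positive_variation M \<nu>) A \<le> C"
proof -
  have "0 \<le> C" using C[of "{}"] signed_measure_empty[OF \<nu>] by auto
  then show ?thesis
    using emeasure_positive_variation_le[OF assms] unfolding measure_def
    by (metis enn2real_ennreal enn2real_mono ennreal_less_top)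
qed

lemma le_measure_positive_variation:
  assumes \<nu>: "signed_measure_on M \<nu>" and A: "A \<in> sets M" "B \<in> sets M" "B \<subseteq> A"
  shows "\<nu> B \<le> measure (positive_variation M \<nu>) A"
proof -
  interpret finite_measure "positive_variation M \<nu>" by (rule finite_measure_positive_variation[OF \<nu>])
  have "ennreal (\<nu> B) \<le> emeasure (positive_variation M \<nu>) A"
    using A by (auto simp: emeasure_positive_variation[OF \<nu>] intro!: SUP_upper)
  then show ?thesis by (simp add: emeasure_eq_measure)
qed

text \<open>Passing to complements relates the two variations:
  \<open>\<nu> B = \<nu> A - \<nu> (A - B)\<close> bounds the positive variation by
  \<open>\<nu> A\<close> plus the negative one, and the same argument for \<open>- \<nu>\<close>
  gives the reverse inequality.\<close>

lemma signed_measure_Jordan: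
  assumes \<nu>: "signed_measure_on M \<nu>" and A: "A \<in> sets M"
  shows "\<nu> A = measure (positive_variation M \<nu>) A - measure (positive_variation M (\<lambda>A. - \<nu> A)) A"
proof -
  note \<nu>' = signed_measure_on_uminus[OF \<nu>]
  have "measure (positive_variation M \<nu>) A \<le> \<nu> A + measure (positive_variation M (\<lambda>A. - \<nu> A)) A"
  proof (rule measure_positive_variation_le[OF \<nu> A])
    fix B assume B: "B \<in> sets M" "B \<subseteq> A"
    have "- \<nu> (A - B) \<le> measure (positive_variation M (\<lambda>A. - \<nu> A)) A"
      using A B by (intro le_measure_positive_variation[OF \<nu>']) auto
    with signed_measure_Diff[OF \<nu> A B]
    show "\<nu> B \<le> \<nu> A + measure (positive_variation M (\<lambda>A. - \<nu> A)) A" by simp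
  qed
  moreover have "measure (positive_variation M (\<lambda>A. - \<nu> A)) A \<le> measure (positive_variation M \<nu>) A - \<nu> A"
  proof (rule measure_positive_variation_le[OF \<nu>' A])
    fix B assume B: "B \<in> sets M" "B \<subseteq> A"
    have "\<nu> (A - B) \<le> measure (positive_variation M \<nu>) A"
      using A B by (intro le_measure_positive_variation[OF \<nu>]) auto
    with signed_measure_Diff[OF \<nu> A B]
    show "- \<nu> B \<le> measure (positive_variation M \<nu>) A - \<nu> A" by simp
  qed
  ultimately show ?thesis by simp
qed

section \<open>Integration against complex measures\<close>

text \<open>Approximate \<open>f\<close> by simple functions, on which the integral only involves the measures of the level sets.\<close>
lemma sum_integral_eq_0:
  fixes P :: "'i \<Rightarrow> 'a measure" and c :: "'i \<Rightarrow> complex" and f :: "'a \<Rightarrow> complex"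
  assumes "finite I"
    and fin: "\<And>i. i \<in> I \<Longrightarrow> finite_measure (P i)"
    and sets: "\<And>i. i \<in> I \<Longrightarrow> sets (P i) = sets M"
    and zero: "\<And>A. A \<in> sets M \<Longrightarrow> (\<Sum>i\<in>I. c i * of_real (measure (P i) A)) = 0"
    and f: "f \<in> borel_measurable M" and B: "\<And>x. x \<in> space M \<Longrightarrow> cmod (f x) \<le> B"
  shows "(\<Sum>i\<in>I. c i * integral\<^sup>L (P i) f) = 0"
proof -
  obtain s where s: "\<And>n. simple_function M (s n)"
    and s_lim: "\<And>x. x \<in> space M \<Longrightarrow> (\<lambda>n. s n x) \<longlonglongrightarrow> f x"
    and s_bd: "\<And>n x. x \<in> space M \<Longrightarrow> dist (s n x) 0 \<le> 2 * dist (f x) 0"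
    using borel_measurable_implies_sequence_metric[OF f, of 0] by blast
  have sp: "space (P i) = space M" if "i \<in> I" for i using sets[OF that] by (rule sets_eq_imp_space_eq)
  have sM: "s n \<in> borel_measurable M" for n using s by (rule borel_measurable_simple_function)
  have bd: "cmod (s n x) \<le> 2 * B" if "x \<in> space M" for n x
    using s_bd[OF that, of n] B[OF that] by simp
  have simple: "integral\<^sup>L (P i) (s n)
      = (\<Sum>y\<in>s n ` space M. of_real (measure (P i) {x \<in> space M. s n x = y}) * y)"
    if i: "i \<in> I" for i n
  proof -
    interpret finite_measure "P i" by (rule fin[OF i])
    have "simple_function (P i) (s n)"
      using s[of n] sp[OF i] sets[OF i] by (simp add: simple_function_def)
    moreover have "integrable (P i) (s n)"
      using bd sp[OF i] sM[of n]
      by (intro integrable_const_bound[where B="2*B"])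
        (auto simp: measurable_cong_sets[OF sets[OF i] refl])
    ultimately have "Bochner_Integration.simple_bochner_integrable (P i) (s n)"
      using simple_bochner_integrableI_bounded[of "P i" "s n"] by (auto simp: integrable_iff_bounded)
    from simple_bochner_integrable_eq_integral[OF this, symmetric] show ?thesis
      by (simp add: simple_bochner_integral_def sp[OF i] scaleR_conv_of_real)
  qed
  have "(\<Sum>i\<in>I. c i * integral\<^sup>L (P i) (s n)) = 0" for n
  proof -
    have "(\<Sum>i\<in>I. c i * integral\<^sup>L (P i) (s n))
      = (\<Sum>i\<in>I. \<Sum>y\<in>s n ` space M. c i * of_real (measure (P i) {x \<in> space M. s n x = y}) * y)"
      by (intro sum.cong refl) (simp add: simple sum_distrib_left mult.assoc)
    also have "\<dots> = (\<Sum>y\<in>s n ` space M. (\<Sum>i\<in>I. c i * of_real (measure (P i) {x \<in> space M. s n x = y})) * y)"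
      by (subst sum.swap) (simp add: sum_distrib_right)
    also have "\<dots> = 0"
      using sM[of n] by (intro sum.neutral ballI) (subst zero, auto)
    finally show ?thesis .
  qed
  moreover have "(\<lambda>n. \<Sum>i\<in>I. c i * integral\<^sup>L (P i) (s n)) \<longlonglongrightarrow> (\<Sum>i\<in>I. c i * integral\<^sup>L (P i) f)"
  proof (intro tendsto_sum tendsto_mult tendsto_const)
    fix i assume i: "i \<in> I"
    interpret finite_measure "P i" by (rule fin[OF i])
    have m: "measurable (P i) borel = measurable M borel"
      using sets[OF i] by (rule measurable_cong_sets) simp
    show "(\<lambda>n. integral\<^sup>L (P i) (s n)) \<longlonglongrightarrow> integral\<^sup>L (P i) f"
      by (rule integral_dominated_convergence[where w="\<lambda>_. 2 * B"])
        (use s_lim bd sp[OF i] f sM m in auto)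
  qed
  ultimately show ?thesis by (simp add: LIMSEQ_const_iff)
qed

lemma complex_measure_on_Re_Im:
  assumes "complex_measure_on M \<mu>"
  shows "signed_measure_on M (\<lambda>A. Re (\<mu> A))" "signed_measure_on M (\<lambda>A. Im (\<mu> A))"
  using assms unfolding signed_measure_on_def complex_measure_on_def
  by (auto intro: sums_Re sums_Im)

text \<open>The factor \<open>(- \<i>) ^ j\<close> rotates the direction \<open>\<i> ^ j\<close>
  onto the positive real axis. The four positive measures from the real and imaginary parts thus get
  a single index, and the complex measure is the sum of \<open>\<i> ^ j\<close> times part
  \<open>j\<close>.\<close>

definition Jordan_part :: "'a measure \<Rightarrow> ('a set \<Rightarrow> complex) \<Rightarrow> nat \<Rightarrow> 'a measure" where
  "Jordan_part M \<mu> j = positive_variation M (\<lambda>A. Re ((- \<i>) ^ j * \<mu> A))"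

lemma lessThan_4: "{..<4} = {0, 1, 2, 3 :: nat}"
  by auto

lemma sum_lessThan_4: "(\<Sum>j<4. f j) = f 0 + f 1 + f 2 + f (3::nat)" for f :: "nat \<Rightarrow> 'b::comm_monoid_add"
  by (simp add: lessThan_4 add.assoc)

lemma complex_measure_integral_Jordan:
  "complex_measure_integral M \<mu> f = (\<Sum>j<4. \<i> ^ j * integral\<^sup>L (Jordan_part M \<mu> j) f)"
  by (simp add: sum_lessThan_4 complex_measure_integral_def signed_integral_def Jordan_part_def
      power2_eq_square power3_eq_cube algebra_simps)

lemma complex_measure_on_scale:
  assumes "complex_measure_on M \<mu>" shows "complex_measure_on M (\<lambda>A. c * \<mu> A)"
  using assms unfolding complex_measure_on_def by (auto intro: sums_mult)

lemma complex_measure_on_sum: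
  assumes "\<And>i. i \<in> I \<Longrightarrow> complex_measure_on M (\<mu> i)"
  shows "complex_measure_on M (\<lambda>A. \<Sum>i\<in>I. \<mu> i A)"
  using assms unfolding complex_measure_on_def by (auto intro!: sums_sum)

lemma sets_Jordan_part [simp]: "sets (Jordan_part M \<mu> j) = sets M"
  and space_Jordan_part [simp]: "space (Jordan_part M \<mu> j) = space M"
  by (simp_all add: Jordan_part_def)

lemma finite_measure_Jordan_part:
  assumes "complex_measure_on M \<mu>"
  shows "finite_measure (Jordan_part M \<mu> j)"
  unfolding Jordan_part_def
  by (intro finite_measure_positive_variation complex_measure_on_Re_Im complex_measure_on_scale assms)

lemma measure_Jordan_part_le:
  assumes \<mu>: "complex_measure_on M \<mu>" and C: "\<And>A. A \<in> sets M \<Longrightarrow> cmod (\<mu> A) \<le> C"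
  shows "measure (Jordan_part M \<mu> j) (space M) \<le> C"
  unfolding Jordan_part_def
proof (rule measure_positive_variation_le)
  show "signed_measure_on M (\<lambda>A. Re ((- \<i>) ^ j * \<mu> A))"
    by (intro complex_measure_on_Re_Im complex_measure_on_scale \<mu>)
  fix B assume "B \<in> sets M"
  have "Re ((- \<i>) ^ j * \<mu> B) \<le> cmod ((- \<i>) ^ j * \<mu> B)" by (rule complex_Re_le_cmod)
  also have "\<dots> = cmod (\<mu> B)" by (simp add: norm_mult norm_power)
  also have "\<dots> \<le> C" by (rule C) fact
  finally show "Re ((- \<i>) ^ j * \<mu> B) \<le> C" .
qed simp

lemma complex_measure_Jordan:
  assumes \<mu>: "complex_measure_on M \<mu>" and A: "A \<in> sets M"
  shows "\<mu> A = (\<Sum>j<4. \<i> ^ j * of_real (measure (Jordan_part M \<mu> j) A))"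
  using signed_measure_Jordan[OF complex_measure_on_Re_Im(1)[OF \<mu>] A]
    signed_measure_Jordan[OF complex_measure_on_Re_Im(2)[OF \<mu>] A]
  by (simp add: sum_lessThan_4 Jordan_part_def complex_eq_iff power2_eq_square power3_eq_cube)

lemma complex_measure_on_finite_measures:
  fixes P :: "'i \<Rightarrow> 'a measure" and c :: "'i \<Rightarrow> complex"
  assumes fin: "\<And>i. i \<in> I \<Longrightarrow> finite_measure (P i)"
    and sets: "\<And>i. i \<in> I \<Longrightarrow> sets (P i) = sets M"
  shows "complex_measure_on M (\<lambda>A. \<Sum>i\<in>I. c i * of_real (measure (P i) A))"
  using fin sets unfolding complex_measure_on_def
  by (auto intro!: sums_sum sums_mult sums_of_real finite_measure.finite_measure_UNION)

text \<open>The integral depends only on the set function, not on the Jordan decomposition by which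
  it is defined: subtracting the Jordan parts from any other representation gives a combination
  vanishing on all sets, to which \<open>sum_integral_eq_0\<close> applies over the disjoint sum of
  the two index sets.\<close>

lemma complex_measure_integral_finite_measures:
  fixes P :: "'i \<Rightarrow> 'a measure" and c :: "'i \<Rightarrow> complex" and f :: "'a \<Rightarrow> complex"
  assumes "finite I"
    and fin: "\<And>i. i \<in> I \<Longrightarrow> finite_measure (P i)"
    and sets: "\<And>i. i \<in> I \<Longrightarrow> sets (P i) = sets M"
    and \<mu>: "complex_measure_on M \<mu>"
    and eq: "\<And>A. A \<in> sets M \<Longrightarrow> \<mu> A = (\<Sum>i\<in>I. c i * of_real (measure (P i) A))"
    and f: "f \<in> borel_measurable M" "\<And>x. x \<in> space M \<Longrightarrow> cmod (f x) \<le> B"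
  shows "complex_measure_integral M \<mu> f = (\<Sum>i\<in>I. c i * integral\<^sup>L (P i) f)"
proof -
  let ?I = "I <+> {..<4::nat}"
  define Q where "Q = case_sum P (Jordan_part M \<mu>)"
  define d where "d = case_sum c (\<lambda>j. - (\<i> ^ j))"
  have "(\<Sum>k\<in>?I. d k * integral\<^sup>L (Q k) f) = 0"
  proof (rule sum_integral_eq_0[OF _ _ _ _ f])
    show "finite ?I" using assms by auto
    show "finite_measure (Q k)" "sets (Q k) = sets M" if "k \<in> ?I" for k
      using that fin sets finite_measure_Jordan_part[OF \<mu>] by (auto simp: Q_def)
    fix A assume A: "A \<in> sets M"
    show "(\<Sum>i\<in>?I. d i * of_real (measure (Q i) A)) = 0"
      using complex_measure_Jordan[OF \<mu> A] eq[OF A] \<open>finite I\<close>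
      by (simp add: sum.Plus Q_def d_def sum_negf)
  qed auto
  then show ?thesis
    using \<open>finite I\<close> by (simp add: sum.Plus Q_def d_def sum_negf complex_measure_integral_Jordan)
qed

lemma complex_measure_integral_sum:
  fixes \<mu> :: "'i \<Rightarrow> 'a set \<Rightarrow> complex"
  assumes "finite I" and \<mu>: "\<And>i. i \<in> I \<Longrightarrow> complex_measure_on M (\<mu> i)"
    and \<nu>: "complex_measure_on M \<nu>" "\<And>A. A \<in> sets M \<Longrightarrow> \<nu> A = (\<Sum>i\<in>I. c i * \<mu> i A)"
    and f: "f \<in> borel_measurable M" "\<And>x. x \<in> space M \<Longrightarrow> cmod (f x) \<le> B"
  shows "complex_measure_integral M \<nu> f = (\<Sum>i\<in>I. c i * complex_measure_integral M (\<mu> i) f)"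
proof -
  have "complex_measure_integral M \<nu> f =
    (\<Sum>(i, j)\<in>I \<times> {..<4}. (c i * \<i> ^ j) * integral\<^sup>L (Jordan_part M (\<mu> i) j) f)"
    unfolding split_def
  proof (rule complex_measure_integral_finite_measures[OF _ _ _ \<nu>(1) _ f])
    show "finite (I \<times> {..<4::nat})" using \<open>finite I\<close> by auto
    show "finite_measure (Jordan_part M (\<mu> (fst p)) (snd p))" if "p \<in> I \<times> {..<4}" for p
      using that by (auto intro!: finite_measure_Jordan_part \<mu>)
    fix A assume A: "A \<in> sets M"
    show "\<nu> A = (\<Sum>p\<in>I \<times> {..<4}. (c (fst p) * \<i> ^ snd p) * of_real (measure (Jordan_part M (\<mu> (fst p)) (snd p)) A))"
      using complex_measure_Jordan[OF \<mu> A]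
      by (subst \<nu>(2)[OF A]) (simp add: sum.cartesian_product' sum_distrib_left mult.assoc)
  qed auto
  then show ?thesis
    by (simp add: complex_measure_integral_Jordan sum.cartesian_product' sum_distrib_left mult.assoc)
qed

lemma norm_integral_finite_measure_le:
  fixes f :: "'a \<Rightarrow> complex"
  assumes "finite_measure P" "f \<in> borel_measurable P" "\<And>x. x \<in> space P \<Longrightarrow> cmod (f x) \<le> B"
  shows "cmod (integral\<^sup>L P f) \<le> measure P (space P) * B"
proof -
  interpret finite_measure P by fact
  have "integrable P f" using assms by (intro integrable_const_bound[where B=B]) auto
  then have "cmod (integral\<^sup>L P f) \<le> (\<integral>x. B \<partial>P)"
    by (intro order_trans[OF integral_norm_bound] integral_mono) (use assms in auto)
  then show ?thesis by simp
qed

lemma norm_complex_measure_integral_le: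
  assumes \<mu>: "complex_measure_on M \<mu>" and C: "\<And>A. A \<in> sets M \<Longrightarrow> cmod (\<mu> A) \<le> C"
    and f: "f \<in> borel_measurable M" "\<And>x. x \<in> space M \<Longrightarrow> cmod (f x) \<le> B" and "B \<ge> 0"
  shows "cmod (complex_measure_integral M \<mu> f) \<le> 4 * C * B"
proof -
  have "cmod (complex_measure_integral M \<mu> f) \<le> (\<Sum>j<4::nat. C * B)"
    unfolding complex_measure_integral_Jordan
  proof (rule sum_norm_le)
    fix j :: nat
    have "cmod (integral\<^sup>L (Jordan_part M \<mu> j) f) \<le> measure (Jordan_part M \<mu> j) (space M) * B"
      using norm_integral_finite_measure_le[OF finite_measure_Jordan_part[OF \<mu>, of j], of f B] f
      by (simp add: measurable_cong_sets[OF sets_Jordan_part refl])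
    also have "\<dots> \<le> C * B"
      by (intro mult_right_mono measure_Jordan_part_le \<mu> C \<open>B \<ge> 0\<close>)
    finally show "cmod (\<i> ^ j * integral\<^sup>L (Jordan_part M \<mu> j) f) \<le> C * B"
      by (simp add: norm_mult norm_power)
  qed
  then show ?thesis by simp
qed

lemma complex_measure_bounded:
  assumes "complex_measure_on M \<mu>"
  shows "\<exists>C. \<forall>A\<in>sets M. cmod (\<mu> A) \<le> C"
proof -
  obtain C D where "\<forall>A\<in>sets M. \<bar>Re (\<mu> A)\<bar> \<le> C" "\<forall>A\<in>sets M. \<bar>Im (\<mu> A)\<bar> \<le> D"
    using signed_measure_bounded[OF complex_measure_on_Re_Im(1)[OF assms]]
      signed_measure_bounded[OF complex_measure_on_Re_Im(2)[OF assms]] by auto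
  then have "cmod (\<mu> A) \<le> C + D" if "A \<in> sets M" for A
    using cmod_le[of "\<mu> A"] that by fastforce
  then show ?thesis by blast
qed

text \<open>Countable additivity of the sum is an exchange of two limits. The bounds
  \<open>C n\<close> are the same for all finite unions, so the series converges uniformly in the
  number of pieces and the limits may be swapped.\<close>

lemma complex_measure_on_suminf:
  fixes \<mu> :: "nat \<Rightarrow> 'a set \<Rightarrow> complex"
  assumes \<mu>: "\<And>n. complex_measure_on M (\<mu> n)"
    and C: "\<And>n A. A \<in> sets M \<Longrightarrow> cmod (\<mu> n A) \<le> C n" and "summable C"
  shows "complex_measure_on M (\<lambda>A. \<Sum>n. \<mu> n A)"
  unfolding complex_measure_on_def
proof (intro allI impI)
  fix A :: "nat \<Rightarrow> 'a set" assume A: "range A \<subseteq> sets M" "disjoint_family A"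
  let ?U = "\<lambda>N. \<Union>k<N. A k"
  have U: "?U N \<in> sets M" for N using A by auto
  have UA: "(\<Union>k. A k) \<in> sets M" using A by auto
  have part: "(\<Sum>k<N. \<mu> n (A k)) = \<mu> n (?U N)" for n N
  proof -
    define A' where "A' k = (if k < N then A k else {})" for k
    have "\<mu> n {} = 0"
      using signed_measure_empty[OF complex_measure_on_Re_Im(1)[OF \<mu>]]
        signed_measure_empty[OF complex_measure_on_Re_Im(2)[OF \<mu>]] by (simp add: complex_eq_iff)
    then have "(\<lambda>k. \<mu> n (A' k)) sums (\<Sum>k<N. \<mu> n (A' k))"
      by (intro sums_finite) (auto simp: A'_def)
    moreover have "(\<lambda>k. \<mu> n (A' k)) sums \<mu> n (\<Union>k. A' k)"
    proof -
      have "range A' \<subseteq> sets M" "disjoint_family A'"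
        using A by (auto simp: A'_def disjoint_family_on_def)
      then show ?thesis using \<mu>[of n] unfolding complex_measure_on_def by blast
    qed
    moreover have "(\<Union>k. A' k) = ?U N" by (auto simp: A'_def split: if_splits)
    ultimately show ?thesis by (simp add: sums_iff A'_def)
  qed
  \<comment> \<open>The uniformity is in \<open>N\<close>, the number of pieces of the union, with
    \<open>m\<close> counting the measures summed.\<close>
  have "uniform_limit UNIV (\<lambda>m N. \<Sum>n<m. \<mu> n (?U N)) (\<lambda>N. \<Sum>n. \<mu> n (?U N)) sequentially"
    by (rule Weierstrass_m_test[OF _ \<open>summable C\<close>]) (use C[OF U] in auto)
  then have "(\<lambda>N. \<Sum>n. \<mu> n (?U N)) \<longlonglongrightarrow> (\<Sum>n. \<mu> n (\<Union>k. A k))"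
  proof (rule swap_uniform_limit'[rotated 2])
    show "\<forall>\<^sub>F m in sequentially. ((\<lambda>N. \<Sum>n<m. \<mu> n (?U N)) \<longlongrightarrow> (\<Sum>n<m. \<mu> n (\<Union>k. A k))) sequentially"
    proof (intro always_eventually allI tendsto_sum)
      fix n
      have "(\<lambda>k. \<mu> n (A k)) sums \<mu> n (\<Union>k. A k)"
        using \<mu>[of n] A by (auto simp: complex_measure_on_def)
      then show "(\<lambda>N. \<mu> n (?U N)) \<longlonglongrightarrow> \<mu> n (\<Union>k. A k)" by (simp add: sums_def part)
    qed
    have "summable (\<lambda>n. \<mu> n (\<Union>k. A k))"
      by (rule summable_comparison_test'[OF \<open>summable C\<close>]) (use C[OF UA] in auto)
    then show "(\<lambda>m. \<Sum>n<m. \<mu> n (\<Union>k. A k)) \<longlonglongrightarrow> (\<Sum>n. \<mu> n (\<Union>k. A k))"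
      by (rule summable_LIMSEQ)
  qed auto
  moreover have "(\<Sum>k<N. \<Sum>n. \<mu> n (A k)) = (\<Sum>n. \<mu> n (?U N))" for N
  proof -
    have "summable (\<lambda>n. \<mu> n (A k))" for k
      by (rule summable_comparison_test'[OF \<open>summable C\<close>]) (use C A in auto)
    then have "(\<Sum>k<N. \<Sum>n. \<mu> n (A k)) = (\<Sum>n. \<Sum>k<N. \<mu> n (A k))"
      by (intro suminf_sum[symmetric])
    then show ?thesis by (simp add: part)
  qed
  ultimately show "(\<lambda>k. \<Sum>n. \<mu> n (A k)) sums (\<Sum>n. \<mu> n (\<Union>k. A k))"
    by (simp add: sums_def)
qed

text \<open>The tail of the series is itself a complex measure, bounded on all sets by the tail of
  \<open>C\<close>. Its integral is the error of the partial sum and therefore tends to 0.\<close>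

lemma complex_measure_integral_suminf:
  fixes \<mu> :: "nat \<Rightarrow> 'a set \<Rightarrow> complex"
  assumes \<mu>: "\<And>n. complex_measure_on M (\<mu> n)"
    and C: "\<And>n A. A \<in> sets M \<Longrightarrow> cmod (\<mu> n A) \<le> C n" and "summable C"
    and f: "f \<in> borel_measurable M" "\<And>x. x \<in> space M \<Longrightarrow> cmod (f x) \<le> B"
  shows "(\<lambda>n. complex_measure_integral M (\<mu> n) f) sums complex_measure_integral M (\<lambda>A. \<Sum>n. \<mu> n A) f"
proof -
  define \<nu> where "\<nu> A = (\<Sum>n. \<mu> n A)" for A
  have \<nu>: "complex_measure_on M \<nu>" unfolding \<nu>_def by (rule complex_measure_on_suminf[OF \<mu> C \<open>summable C\<close>])
  define B' where "B' = max B 0"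
  have B': "B' \<ge> 0" "\<And>x. x \<in> space M \<Longrightarrow> cmod (f x) \<le> B'" using f by (force simp: B'_def)+
  have "cmod (complex_measure_integral M \<nu> f - (\<Sum>n<N. complex_measure_integral M (\<mu> n) f))
      \<le> 4 * (\<Sum>n. C (n + N)) * B'" for N
  proof -
    define \<rho> where "\<rho> A = (\<Sum>n. \<mu> (n + N) A)" for A
    have \<rho>: "complex_measure_on M \<rho>" unfolding \<rho>_def
      by (rule complex_measure_on_suminf[where C="\<lambda>n. C (n + N)"])
        (use \<mu> C \<open>summable C\<close> in \<open>auto simp: summable_iff_shift\<close>)
    have sm: "summable (\<lambda>n. \<mu> n A)" if "A \<in> sets M" for A
      by (rule summable_comparison_test'[OF \<open>summable C\<close>]) (use C that in auto)
    \<comment> \<open>\<open>None\<close> indexes the tail and \<open>Some n\<close> the first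
      \<open>N\<close> measures, so that finite additivity of the integral covers the
      splitting.\<close>
    have "complex_measure_integral M \<nu> f = (\<Sum>i\<in>insert None (Some ` {..<N}).
      1 * complex_measure_integral M (case i of None \<Rightarrow> \<rho> | Some n \<Rightarrow> \<mu> n) f)"
    proof (rule complex_measure_integral_sum[OF _ _ \<nu> _ f])
      fix A assume "A \<in> sets M"
      then show "\<nu> A = (\<Sum>i\<in>insert None (Some ` {..<N}). 1 * (case i of None \<Rightarrow> \<rho> | Some n \<Rightarrow> \<mu> n) A)"
        using suminf_split_initial_segment[OF sm, of A N]
        by (subst sum.insert) (auto simp: \<nu>_def \<rho>_def sum.reindex)
    qed (use \<mu> \<rho> in \<open>auto split: option.splits\<close>)
    then have "complex_measure_integral M \<nu> f =
      complex_measure_integral M \<rho> f + (\<Sum>n<N. complex_measure_integral M (\<mu> n) f)"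
      by (subst (asm) sum.insert) (auto simp: sum.reindex)
    moreover have "cmod (complex_measure_integral M \<rho> f) \<le> 4 * (\<Sum>n. C (n + N)) * B'"
    proof (rule norm_complex_measure_integral_le[OF \<rho> _ f(1) B'(2,1)])
      fix A assume A: "A \<in> sets M"
      have s: "summable (\<lambda>n. cmod (\<mu> (n + N) A))"
        by (rule summable_comparison_test'[of "\<lambda>n. C (n + N)"])
          (use \<open>summable C\<close> C A in \<open>auto simp: summable_iff_shift\<close>)
      show "cmod (\<rho> A) \<le> (\<Sum>n. C (n + N))"
        unfolding \<rho>_def
        by (rule order_trans[OF summable_norm[OF s]], rule suminf_le)
          (use \<open>summable C\<close> C A s in \<open>auto simp: summable_iff_shift\<close>)
    qed
    ultimately show ?thesis by simp
  qed
  then have le: "\<forall>\<^sub>F N in sequentially. cmod (complex_measure_integral M \<nu> f - (\<Sum>n<N. complex_measure_integral M (\<mu> n) f))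
      \<le> 4 * (\<Sum>n. C (n + N)) * B'" by (rule always_eventually[OF allI])
  have "(\<lambda>N. 4 * (\<Sum>n. C (n + N)) * B') \<longlonglongrightarrow> 4 * 0 * B'"
    by (intro tendsto_intros suminf_exist_split2 \<open>summable C\<close>)
  then have "(\<lambda>N. 4 * (\<Sum>n. C (n + N)) * B') \<longlonglongrightarrow> 0" by simp
  from Lim_null_comparison[OF le this]
  have "(\<lambda>N. complex_measure_integral M \<nu> f - (\<Sum>n<N. complex_measure_integral M (\<mu> n) f)) \<longlonglongrightarrow> 0" .
  then have "(\<lambda>N. complex_measure_integral M \<nu> f - (complex_measure_integral M \<nu> f - (\<Sum>n<N. complex_measure_integral M (\<mu> n) f)))
      \<longlonglongrightarrow> complex_measure_integral M \<nu> f - 0"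
    by (intro tendsto_diff tendsto_const)
  moreover have "(\<lambda>A. \<Sum>n. \<mu> n A) = \<nu>" by (simp add: fun_eq_iff \<nu>_def)
  ultimately show ?thesis by (simp add: sums_def)
qed

text \<open>The source of new representing measures: the image under \<open>e\<close> of the complex
  density \<open>h\<close>. Splitting \<open>h\<close> into four nonnegative densities gives the
  integral formula; testing that formula on indicators gives the bound by the \<open>L^1\<close>
  norm of \<open>h\<close> without a factor 4.\<close>

lemma complex_measure_pushforward:
  fixes h :: "'b \<Rightarrow> complex"
  assumes e: "e \<in> measurable N M" and h: "integrable N h"
  shows "\<exists>\<mu>. complex_measure_on M \<mu> \<and> (\<forall>A\<in>sets M. cmod (\<mu> A) \<le> (\<integral>x. cmod (h x) \<partial>N)) \<and>
    (\<forall>f B. f \<in> borel_measurable M \<longrightarrow> (\<forall>x\<in>space M. cmod (f x) \<le> B) \<longrightarrow>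
      complex_measure_integral M \<mu> f = (\<integral>x. f (e x) * h x \<partial>N))"
proof -
  have hM [measurable]: "h \<in> borel_measurable N" using h by auto
  note e [measurable]
  define q :: "nat \<Rightarrow> 'b \<Rightarrow> real" where "q j x = max 0 (Re ((- \<i>) ^ j * h x))" for j x
  have q0: "q j x \<ge> 0" for j x by (simp add: q_def)
  have qM [measurable]: "q j \<in> borel_measurable N" for j unfolding q_def by measurable
  have qh: "h x = (\<Sum>j<4. \<i> ^ j * of_real (q j x))" for x
    by (simp add: sum_lessThan_4 q_def complex_eq_iff power2_eq_square power3_eq_cube max_def)
  have qle: "q j x \<le> cmod (h x)" for j x
  proof -
    have "Re ((- \<i>) ^ j * h x) \<le> cmod ((- \<i>) ^ j * h x)" by (rule complex_Re_le_cmod)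
    also have "\<dots> = cmod (h x)" by (simp add: norm_mult norm_power)
    finally show ?thesis by (simp add: q_def)
  qed
  have qi: "integrable N (q j)" for j
    by (rule Bochner_Integration.integrable_bound[OF h]) (use qle q0 in auto)
  define P where "P j = distr (density N (\<lambda>x. ennreal (q j x))) M e" for j
  have eD: "e \<in> measurable (density N (\<lambda>x. ennreal (q j x))) M" for j by simp
  have Pfin: "finite_measure (P j)" for j
  proof -
    have "finite_measure (density N (\<lambda>x. ennreal (q j x)))"
    proof (rule finite_measureI)
      have "emeasure (density N (\<lambda>x. ennreal (q j x))) (space N) = (\<integral>\<^sup>+x. ennreal (q j x) \<partial>N)"
        by (subst emeasure_density) (auto intro!: nn_integral_cong)
      also have "\<dots> < \<infinity>" using qi[of j] q0 by (simp add: integrable_iff_bounded)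
      finally show "emeasure (density N (\<lambda>x. ennreal (q j x))) (space (density N (\<lambda>x. ennreal (q j x)))) \<noteq> \<infinity>"
        by simp
    qed
    then show ?thesis unfolding P_def by (rule finite_measure.finite_measure_distr[OF _ eD])
  qed
  have Psets: "sets (P j) = sets M" "space (P j) = space M" for j by (auto simp: P_def)
  have Pint: "integral\<^sup>L (P j) f = (\<integral>x. of_real (q j x) * f (e x) \<partial>N)"
    if "f \<in> borel_measurable M" for j and f :: "_ \<Rightarrow> complex"
    using that unfolding P_def
    by (simp add: integral_distr[OF eD that] integral_density q0 scaleR_conv_of_real)
  have key: "(\<Sum>j<4. \<i> ^ j * integral\<^sup>L (P j) f) = (\<integral>x. f (e x) * h x \<partial>N)"
    if f: "f \<in> borel_measurable M" "\<And>x. x \<in> space M \<Longrightarrow> cmod (f x) \<le> B" for f :: "_ \<Rightarrow> complex" and B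
  proof -
    note f(1) [measurable]
    have i: "integrable N (\<lambda>x. of_real (q j x) * f (e x))" for j
    proof (rule Bochner_Integration.integrable_bound)
      show "integrable N (\<lambda>x. q j x * B)" using qi by simp
      show "AE x in N. norm (complex_of_real (q j x) * f (e x)) \<le> norm (q j x * B)"
      proof (rule AE_I2)
        fix x assume "x \<in> space N"
        then have "cmod (f (e x)) \<le> \<bar>B\<bar>" using f(2)[of "e x"] measurable_space[OF e] by fastforce
        then show "norm (complex_of_real (q j x) * f (e x)) \<le> norm (q j x * B)"
          by (simp add: norm_mult abs_mult mult_left_mono)
      qed
    qed simp
    have "(\<Sum>j<4. \<i> ^ j * integral\<^sup>L (P j) f) = (\<integral>x. (\<Sum>j<4. \<i> ^ j * (of_real (q j x) * f (e x))) \<partial>N)"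
      using i by (simp add: Pint[OF f(1)])
    also have "\<dots> = (\<integral>x. f (e x) * h x \<partial>N)"
      by (intro Bochner_Integration.integral_cong refl, subst qh) (simp add: sum_distrib_left algebra_simps)
    finally show ?thesis .
  qed
  define \<mu> where "\<mu> A = (\<Sum>j<4. \<i> ^ j * of_real (measure (P j) A))" for A
  have \<mu>: "complex_measure_on M \<mu>" unfolding \<mu>_def
    by (rule complex_measure_on_finite_measures) (auto simp: Pfin Psets)
  have "cmod (\<mu> A) \<le> (\<integral>x. cmod (h x) \<partial>N)" if A: "A \<in> sets M" for A
  proof -
    have "measure (P j) A = integral\<^sup>L (P j) (indicator A)" for j using A by (simp add: Psets)
    then have m: "of_real (measure (P j) A) = integral\<^sup>L (P j) (\<lambda>x. complex_of_real (indicator A x))" for j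
      by simp
    have "\<mu> A = (\<integral>x. complex_of_real (indicator A (e x)) * h x \<partial>N)"
      unfolding \<mu>_def m using A by (intro key[where B=1]) (auto simp: indicator_def)
    also have "cmod \<dots> \<le> (\<integral>x. cmod (complex_of_real (indicator A (e x)) * h x) \<partial>N)"
      by (rule integral_norm_bound)
    also have "\<dots> \<le> (\<integral>x. cmod (h x) \<partial>N)"
    proof (rule Bochner_Integration.integral_mono')
      show "integrable N (\<lambda>x. cmod (h x))" using h by simp
    qed (auto simp: norm_mult indicator_def)
    finally show ?thesis .
  qed
  moreover have "complex_measure_integral M \<mu> f = (\<integral>x. f (e x) * h x \<partial>N)"
    if f: "f \<in> borel_measurable M" "\<forall>x\<in>space M. cmod (f x) \<le> B" for f B
    using complex_measure_integral_finite_measures[of "{..<4}" P M \<mu> "\<lambda>j. \<i> ^ j" f B] f key[of f B]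
    by (auto simp: Pfin Psets \<mu> \<mu>_def)
  ultimately show ?thesis using \<mu> by (intro exI[of _ \<mu>]) auto
qed

section \<open>Fractional Cauchy transforms and their multipliers\<close>

definition cauchy_kernel :: "real \<Rightarrow> complex \<Rightarrow> complex \<Rightarrow> complex" where
  "cauchy_kernel \<alpha> z \<zeta> = 1 / (1 - cnj \<zeta> * z) powr complex_of_real \<alpha>"

text \<open>The bound \<open>C\<close> is on the supremum of \<open>\<mu>\<close> over Borel sets, which is equivalent to the variation norm.\<close>
definition F_bounded :: "real \<Rightarrow> real \<Rightarrow> (complex \<Rightarrow> complex) \<Rightarrow> bool" where
  "F_bounded \<alpha> C g \<longleftrightarrow> (\<exists>\<mu>. complex_measure_on circle_borel \<mu> \<and>
    (\<forall>A\<in>sets circle_borel. cmod (\<mu> A) \<le> C) \<and>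
    (\<forall>z\<in>unit_disk. g z = complex_measure_integral circle_borel \<mu> (cauchy_kernel \<alpha> z)))"

lemma F_family_iff: "g \<in> F_family \<alpha> \<longleftrightarrow> (\<exists>C. F_bounded \<alpha> C g)"
  unfolding F_family_def F_bounded_def cauchy_kernel_def[abs_def]
  using complex_measure_bounded by (auto) blast

lemma space_circle [simp]: "space circle_borel = sphere 0 1"
  by (simp add: space_restrict_space)

lemma Re_one_minus_pos:
  assumes "cmod y \<le> 1" "cmod z < 1" shows "Re (1 - y * z) > 0"
proof -
  have "cmod (y * z) < 1" using assms by (simp add: norm_mult) (meson le_less_trans mult_left_le_one_le norm_ge_zero)
  then show ?thesis using complex_Re_le_cmod[of "y * z"] by simp
qed

lemma one_minus_nonpos:
  assumes "cmod y \<le> 1" "cmod z < 1" shows "1 - y * z \<notin> \<real>\<^sub>\<le>\<^sub>0" "1 - y * z \<noteq> 0"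
proof -
  show "1 - y * z \<notin> \<real>\<^sub>\<le>\<^sub>0" using Re_one_minus_pos[OF assms] by (auto simp: complex_nonpos_Reals_iff)
  then show "1 - y * z \<noteq> 0" by auto
qed

lemma norm_one_minus_ge:
  assumes "cmod y \<le> 1" "cmod z < 1" shows "cmod (1 - y * z) \<ge> 1 - cmod z"
proof -
  have "cmod (y * z) \<le> cmod z" using assms by (simp add: norm_mult mult_left_le_one_le)
  then show ?thesis using norm_triangle_ineq2[of 1 "y * z"] by simp
qed

lemma norm_powr_of_real: "cmod (w powr of_real a) = cmod w powr a"
  by (simp add: norm_powr_real_powr')

lemma cauchy_kernel_continuous:
  assumes "cmod z < 1" shows "continuous_on (cball 0 1) (cauchy_kernel \<alpha> z)"
proof -
  have re: "Re (1 - cnj \<zeta> * z) > 0" if "\<zeta> \<in> cball 0 1" for \<zeta>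
    using Re_one_minus_pos[OF _ assms, of "cnj \<zeta>"] that by simp
  have nz: "1 - cnj \<zeta> * z \<noteq> 0" if "\<zeta> \<in> cball 0 1" for \<zeta>
    using one_minus_nonpos[OF _ assms, of "cnj \<zeta>"] that by simp
  have sub: "cball 0 1 \<subseteq> {\<zeta>. 0 \<le> Re (1 - cnj \<zeta> * z) \<or> Im (1 - cnj \<zeta> * z) \<noteq> 0}"
    using re less_imp_le by blast
  show ?thesis unfolding cauchy_kernel_def
    by (intro continuous_on_divide continuous_on_const continuous_on_powr_complex[OF sub] continuous_intros ballI)
      (simp_all add: powr_eq_0_iff nz del: right_minus_eq eq_iff_diff_eq_0)
qed

lemma cauchy_kernel_measurable:
  assumes "z \<in> unit_disk" shows "cauchy_kernel \<alpha> z \<in> borel_measurable circle_borel"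
  by (intro borel_measurable_continuous_on_restrict continuous_on_subset[OF cauchy_kernel_continuous])
    (use assms in auto)

lemma norm_cauchy_kernel_le:
  assumes "\<alpha> > 0" "cmod z < 1" "cmod \<zeta> \<le> 1"
  shows "cmod (cauchy_kernel \<alpha> z \<zeta>) \<le> (1 - cmod z) powr (- \<alpha>)"
proof -
  have "cmod (cauchy_kernel \<alpha> z \<zeta>) = cmod (1 - cnj \<zeta> * z) powr (- \<alpha>)"
    by (simp add: cauchy_kernel_def norm_divide norm_powr_of_real powr_minus_divide)
  also have "\<dots> \<le> (1 - cmod z) powr (- \<alpha>)"
    using assms norm_one_minus_ge[of "cnj \<zeta>" z] by (intro powr_mono2') auto
  finally show ?thesis .
qed

lemma norm_cauchy_kernel_le_circle:
  assumes "\<alpha> > 0" "z \<in> unit_disk" "\<zeta> \<in> space circle_borel"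
  shows "cmod (cauchy_kernel \<alpha> z \<zeta>) \<le> (1 - cmod z) powr (- \<alpha>)"
  using assms by (intro norm_cauchy_kernel_le) auto

lemma F_bounded_mono: "F_bounded \<alpha> C g \<Longrightarrow> C \<le> D \<Longrightarrow> F_bounded \<alpha> D g"
  unfolding F_bounded_def by (meson order_trans)

lemma F_bounded_cong: "F_bounded \<alpha> C g \<Longrightarrow> (\<And>z. z \<in> unit_disk \<Longrightarrow> g z = h z) \<Longrightarrow> F_bounded \<alpha> C h"
  unfolding F_bounded_def by auto

lemma F_bounded_nonneg: "F_bounded \<alpha> C g \<Longrightarrow> C \<ge> 0"
  unfolding F_bounded_def by (metis norm_ge_zero order_trans sets.top)

lemma F_bounded_sum:
  assumes "\<alpha> > 0" "finite I" "\<And>i. i \<in> I \<Longrightarrow> F_bounded \<alpha> (C i) (g i)"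
  shows "F_bounded \<alpha> (\<Sum>i\<in>I. cmod (c i) * C i) (\<lambda>z. \<Sum>i\<in>I. c i * g i z)"
proof -
  obtain \<mu> where \<mu>: "\<And>i. i \<in> I \<Longrightarrow> complex_measure_on circle_borel (\<mu> i)"
    and C: "\<And>i A. i \<in> I \<Longrightarrow> A \<in> sets circle_borel \<Longrightarrow> cmod (\<mu> i A) \<le> C i"
    and g: "\<And>i z. i \<in> I \<Longrightarrow> z \<in> unit_disk \<Longrightarrow> g i z = complex_measure_integral circle_borel (\<mu> i) (cauchy_kernel \<alpha> z)"
    using assms(3) unfolding F_bounded_def by metis
  define \<nu> where "\<nu> A = (\<Sum>i\<in>I. c i * \<mu> i A)" for A
  have \<nu>: "complex_measure_on circle_borel \<nu>"
    unfolding \<nu>_def by (intro complex_measure_on_sum complex_measure_on_scale \<mu>)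
  show ?thesis unfolding F_bounded_def
  proof (intro exI[of _ \<nu>] conjI ballI)
    fix A assume "A \<in> sets circle_borel"
    then show "cmod (\<nu> A) \<le> (\<Sum>i\<in>I. cmod (c i) * C i)"
      unfolding \<nu>_def using C by (intro sum_norm_le) (simp add: norm_mult mult_left_mono)
  next
    fix z :: complex assume z: "z \<in> unit_disk"
    show "(\<Sum>i\<in>I. c i * g i z) = complex_measure_integral circle_borel \<nu> (cauchy_kernel \<alpha> z)"
      using complex_measure_integral_sum[OF \<open>finite I\<close> \<mu> \<nu> \<nu>_def cauchy_kernel_measurable[OF z, of \<alpha>]
            norm_cauchy_kernel_le_circle[OF \<open>\<alpha> > 0\<close> z]] by (simp add: g[OF _ z])
  qed (rule \<nu>)
qed

lemma F_bounded_scale: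
  assumes "\<alpha> > 0" "F_bounded \<alpha> C g" shows "F_bounded \<alpha> (cmod c * C) (\<lambda>z. c * g z)"
  using F_bounded_sum[of \<alpha> "{()}" "\<lambda>_. C" "\<lambda>_. g" "\<lambda>_. c"] assms by simp

lemma F_bounded_add:
  assumes "\<alpha> > 0" "F_bounded \<alpha> C g" "F_bounded \<alpha> D h"
  shows "F_bounded \<alpha> (C + D) (\<lambda>z. g z + h z)"
  using F_bounded_sum[of \<alpha> UNIV "\<lambda>b. if b then C else D" "\<lambda>b. if b then g else h" "\<lambda>_. 1"] assms
  by (simp add: UNIV_bool add.commute split: if_splits)

lemma F_bounded_suminf:
  assumes "\<alpha> > 0" "\<And>n. F_bounded \<alpha> (C n) (g n)" "summable C"
  shows "F_bounded \<alpha> (suminf C) (\<lambda>z. \<Sum>n. g n z)"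
proof -
  obtain \<mu> where \<mu>: "\<And>n. complex_measure_on circle_borel (\<mu> n)"
    and C: "\<And>n A. A \<in> sets circle_borel \<Longrightarrow> cmod (\<mu> n A) \<le> C n"
    and g: "\<And>n z. z \<in> unit_disk \<Longrightarrow> g n z = complex_measure_integral circle_borel (\<mu> n) (cauchy_kernel \<alpha> z)"
    using assms(2) unfolding F_bounded_def by metis
  show ?thesis unfolding F_bounded_def
  proof (intro exI[of _ "\<lambda>A. \<Sum>n. \<mu> n A"] conjI ballI)
    show "complex_measure_on circle_borel (\<lambda>A. \<Sum>n. \<mu> n A)"
      by (rule complex_measure_on_suminf[OF \<mu> C \<open>summable C\<close>])
    fix A assume A: "A \<in> sets circle_borel"
    have s: "summable (\<lambda>n. cmod (\<mu> n A))"
      by (rule summable_comparison_test'[OF \<open>summable C\<close>]) (use C A in auto)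
    show "cmod (\<Sum>n. \<mu> n A) \<le> suminf C"
      by (rule order_trans[OF summable_norm[OF s]], rule suminf_le) (use \<open>summable C\<close> C A s in auto)
  next
    fix z :: complex assume z: "z \<in> unit_disk"
    show "(\<Sum>n. g n z) = complex_measure_integral circle_borel (\<lambda>A. \<Sum>n. \<mu> n A) (cauchy_kernel \<alpha> z)"
      using complex_measure_integral_suminf[OF \<mu> C \<open>summable C\<close> cauchy_kernel_measurable[OF z]
          norm_cauchy_kernel_le_circle[OF \<open>\<alpha> > 0\<close> z]]
      by (simp add: g[OF z] sums_iff)
  qed
qed

lemma F_bounded_pushforward:
  fixes h :: "'b \<Rightarrow> complex"
  assumes "\<alpha> > 0" "e \<in> measurable N circle_borel" "integrable N h"
    and "\<And>z. z \<in> unit_disk \<Longrightarrow> g z = (\<integral>x. cauchy_kernel \<alpha> z (e x) * h x \<partial>N)"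
    and "(\<integral>x. cmod (h x) \<partial>N) \<le> C"
  shows "F_bounded \<alpha> C g"
proof -
  obtain \<mu> where \<mu>: "complex_measure_on circle_borel \<mu>"
    "\<And>A. A \<in> sets circle_borel \<Longrightarrow> cmod (\<mu> A) \<le> (\<integral>x. cmod (h x) \<partial>N)"
    "\<And>f B. f \<in> borel_measurable circle_borel \<Longrightarrow> (\<forall>x\<in>space circle_borel. cmod (f x) \<le> B) \<Longrightarrow>
      complex_measure_integral circle_borel \<mu> f = (\<integral>x. f (e x) * h x \<partial>N)"
    using complex_measure_pushforward[OF assms(2,3)] by blast
  show ?thesis unfolding F_bounded_def
  proof (intro exI[of _ \<mu>] conjI ballI)
    fix z :: complex assume z: "z \<in> unit_disk"
    show "g z = complex_measure_integral circle_borel \<mu> (cauchy_kernel \<alpha> z)"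
      using \<mu>(3)[OF cauchy_kernel_measurable[OF z, of \<alpha>], of "(1 - cmod z) powr (- \<alpha>)"]
        norm_cauchy_kernel_le_circle[OF \<open>\<alpha> > 0\<close> z] assms(4)[OF z] by auto
  qed (use \<mu> assms(5) in force)+
qed

text \<open>The quantitative form of the multiplier property, with one constant for all transforms.
  Products and infinite series of multipliers are controlled through this constant; holomorphy is
  tracked separately.\<close>

definition bounded_multiplier :: "real \<Rightarrow> real \<Rightarrow> (complex \<Rightarrow> complex) \<Rightarrow> bool" where
  "bounded_multiplier \<alpha> C f \<longleftrightarrow> C \<ge> 0 \<and> (\<forall>D g. F_bounded \<alpha> D g \<longrightarrow> F_bounded \<alpha> (C * D) (\<lambda>z. f z * g z))"

lemma bounded_multiplierD: "bounded_multiplier \<alpha> C f \<Longrightarrow> F_bounded \<alpha> D g \<Longrightarrow> F_bounded \<alpha> (C * D) (\<lambda>z. f z * g z)"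
  by (simp add: bounded_multiplier_def)

lemma bounded_multiplier_mono: "bounded_multiplier \<alpha> C f \<Longrightarrow> C \<le> D \<Longrightarrow> bounded_multiplier \<alpha> D f"
  unfolding bounded_multiplier_def
  by (meson F_bounded_mono F_bounded_nonneg mult_right_mono order_trans)

lemma bounded_multiplier_cong:
  assumes "bounded_multiplier \<alpha> C f" "\<And>z. z \<in> unit_disk \<Longrightarrow> f z = h z"
  shows "bounded_multiplier \<alpha> C h"
  unfolding bounded_multiplier_def
proof (intro conjI allI impI)
  show "0 \<le> C" using assms(1) by (simp add: bounded_multiplier_def)
  fix D g assume "F_bounded \<alpha> D g"
  from bounded_multiplierD[OF assms(1) this] show "F_bounded \<alpha> (C * D) (\<lambda>z. h z * g z)"
    by (rule F_bounded_cong) (simp add: assms(2))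
qed

lemma bounded_multiplier_const: "\<alpha> > 0 \<Longrightarrow> bounded_multiplier \<alpha> (cmod c) (\<lambda>_. c)"
  unfolding bounded_multiplier_def using F_bounded_scale by auto

lemma bounded_multiplier_add:
  assumes "\<alpha> > 0" "bounded_multiplier \<alpha> C f" "bounded_multiplier \<alpha> D h"
  shows "bounded_multiplier \<alpha> (C + D) (\<lambda>z. f z + h z)"
  using assms F_bounded_add[OF \<open>\<alpha> > 0\<close>] unfolding bounded_multiplier_def
  by (simp add: distrib_right)

lemma bounded_multiplier_mult:
  assumes "bounded_multiplier \<alpha> C f" "bounded_multiplier \<alpha> D h"
  shows "bounded_multiplier \<alpha> (C * D) (\<lambda>z. f z * h z)"
  using assms unfolding bounded_multiplier_def by (simp add: mult.assoc)

lemma bounded_multiplier_power: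
  assumes "\<alpha> > 0" "bounded_multiplier \<alpha> C f" shows "bounded_multiplier \<alpha> (C ^ n) (\<lambda>z. f z ^ n)"
proof (induction n)
  case 0 show ?case using bounded_multiplier_const[OF \<open>\<alpha> > 0\<close>, of 1] by simp
next
  case (Suc n) then show ?case using bounded_multiplier_mult[OF assms(2) Suc] by simp
qed

lemma bounded_multiplier_prod:
  assumes "\<alpha> > 0" "finite I" "\<And>i. i \<in> I \<Longrightarrow> bounded_multiplier \<alpha> C (f i)"
  shows "bounded_multiplier \<alpha> (C ^ card I) (\<lambda>z. \<Prod>i\<in>I. f i z)"
  using assms(2,3)
proof (induction I)
  case empty show ?case using bounded_multiplier_const[OF \<open>\<alpha> > 0\<close>, of 1] by simp
next
  case (insert i I) then show ?case using bounded_multiplier_mult[of \<alpha> C "f i"] by simp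
qed

text \<open>It is enough to treat transforms of positive measures, since every complex measure is a
  combination of its four Jordan parts with unimodular coefficients. This is where the factor 4
  arises.\<close>

lemma bounded_multiplierI_measure:
  assumes "\<alpha> > 0" "C \<ge> 0"
    and P: "\<And>P. finite_measure P \<Longrightarrow> sets P = sets circle_borel \<Longrightarrow>
      F_bounded \<alpha> (C * measure P (space P)) (\<lambda>z. f z * integral\<^sup>L P (cauchy_kernel \<alpha> z))"
  shows "bounded_multiplier \<alpha> (4 * C) f"
  unfolding bounded_multiplier_def
proof (intro conjI allI impI)
  show "0 \<le> 4 * C" using assms by simp
  fix D g assume "F_bounded \<alpha> D g"
  then obtain \<mu> where \<mu>: "complex_measure_on circle_borel \<mu>"
    and D: "\<And>A. A \<in> sets circle_borel \<Longrightarrow> cmod (\<mu> A) \<le> D"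
    and g: "\<And>z. z \<in> unit_disk \<Longrightarrow> g z = complex_measure_integral circle_borel \<mu> (cauchy_kernel \<alpha> z)"
    unfolding F_bounded_def by blast
  have "F_bounded \<alpha> (C * D) (\<lambda>z. f z * integral\<^sup>L (Jordan_part circle_borel \<mu> j) (cauchy_kernel \<alpha> z))" for j
    by (rule F_bounded_mono[OF P[OF finite_measure_Jordan_part[OF \<mu>] sets_Jordan_part]])
      (use measure_Jordan_part_le[OF \<mu> D, of j] \<open>C \<ge> 0\<close> in \<open>auto intro!: mult_left_mono\<close>)
  then have "F_bounded \<alpha> (\<Sum>j<4. cmod (\<i> ^ j) * (C * D))
    (\<lambda>z. \<Sum>j<4. \<i> ^ j * (f z * integral\<^sup>L (Jordan_part circle_borel \<mu> j) (cauchy_kernel \<alpha> z)))"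
    by (intro F_bounded_sum \<open>\<alpha> > 0\<close>) auto
  then have "F_bounded \<alpha> (4 * C * D)
    (\<lambda>z. \<Sum>j<4. \<i> ^ j * (f z * integral\<^sup>L (Jordan_part circle_borel \<mu> j) (cauchy_kernel \<alpha> z)))"
    by (simp add: norm_power mult.assoc)
  then show "F_bounded \<alpha> (4 * C * D) (\<lambda>z. f z * g z)"
    by (rule F_bounded_cong) (simp add: g complex_measure_integral_Jordan sum_distrib_left mult_ac)
qed

text \<open>Tonelli with a bound on the inner integrals gives absolute integrability, after which
  Fubini applies. The bounding function takes extended values, so no measurability of an inner
  real-valued integral has to be discussed.\<close>

lemma integrable_iterated:
  fixes G :: "'b \<times> 'c \<Rightarrow> complex"
  assumes "sigma_finite_measure M1" "sigma_finite_measure M2"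
    and G: "G \<in> borel_measurable (M1 \<Otimes>\<^sub>M M2)"
    and b: "\<And>x. x \<in> space M1 \<Longrightarrow> (\<integral>\<^sup>+y. ennreal (cmod (G (x, y))) \<partial>M2) \<le> b x"
    and B: "(\<integral>\<^sup>+x. b x \<partial>M1) \<le> ennreal B"
  shows "integrable (M1 \<Otimes>\<^sub>M M2) G"
    "integral\<^sup>L (M1 \<Otimes>\<^sub>M M2) G = (\<integral>x. \<integral>y. G (x, y) \<partial>M2 \<partial>M1)"
    "(\<integral>\<^sup>+p. ennreal (cmod (G p)) \<partial>(M1 \<Otimes>\<^sub>M M2)) \<le> ennreal B"
    "integrable M1 (\<lambda>x. \<integral>y. G (x, y) \<partial>M2)"
proof -
  interpret M1: sigma_finite_measure M1 by fact
  interpret M2: sigma_finite_measure M2 by fact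
  interpret pair_sigma_finite M1 M2 ..
  have "(\<integral>\<^sup>+p. ennreal (cmod (G p)) \<partial>(M1 \<Otimes>\<^sub>M M2)) = (\<integral>\<^sup>+x. \<integral>\<^sup>+y. ennreal (cmod (G (x, y))) \<partial>M2 \<partial>M1)"
    using G by (subst M2.nn_integral_fst) auto
  also have "\<dots> \<le> (\<integral>\<^sup>+x. b x \<partial>M1)" by (intro nn_integral_mono b)
  finally show *: "(\<integral>\<^sup>+p. ennreal (cmod (G p)) \<partial>(M1 \<Otimes>\<^sub>M M2)) \<le> ennreal B" using B by (rule order_trans)
  show i: "integrable (M1 \<Otimes>\<^sub>M M2) G"
    using G * by (intro integrableI_bounded) (auto intro: le_less_trans)
  show "integrable M1 (\<lambda>x. \<integral>y. G (x, y) \<partial>M2)" by (rule integrable_fst'[OF i])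
  from integral_fst'[OF i]
  show "integral\<^sup>L (M1 \<Otimes>\<^sub>M M2) G = (\<integral>x. \<integral>y. G (x, y) \<partial>M2 \<partial>M1)" by simp
qed

lemma integral_norm_le_of_nn_integral:
  assumes "(\<integral>\<^sup>+x. ennreal (norm (h x)) \<partial>M) \<le> ennreal C" "C \<ge> 0"
  shows "(\<integral>x. norm (h x) \<partial>M) \<le> C"
  using assms by (metis Bochner_Integration.integral_eq_nn_integral enn2real_mono enn2real_ennreal
      ennreal_less_top borel_measurable_integrable not_integrable_integral_eq norm_ge_zero AE_I2)

section \<open>Poisson and Cauchy integrals on the unit circle\<close>

text \<open>Serves both as parameter of the circle and as parameter of the segment from
  \<open>w\<close> to \<zeta>. The open interval excludes \<open>r = 0\<close>, where
  \<open>r powr (\<alpha> - 1)\<close> may blow up, and \<open>r = 1\<close>, where the segment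
  reaches the circle.\<close>

abbreviation unit_lborel :: "real measure" where
  "unit_lborel \<equiv> restrict_space lborel {0<..<1}"

lemma sigma_finite_unit_lborel: "sigma_finite_measure unit_lborel"
  by (intro sigma_finite_measure_restrict_space sigma_finite_lborel) simp

text \<open>Links the Lebesgue integral to the gauge integral delivered by the fundamental theorem
  of calculus, for integrands that may be unbounded at an endpoint and whose integrability is known
  from elsewhere.\<close>

lemma unit_lborel_integral:
  fixes f :: "real \<Rightarrow> complex"
  assumes int: "integrable unit_lborel f" and I: "(f has_integral I) {0..1}"
  shows "integral\<^sup>L unit_lborel f = I"
proof -
  have s: "set_integrable lborel {0<..<1} f"
    using int unfolding set_integrable_def by (subst (asm) integrable_restrict_space) auto
  have "(f has_integral I) {0<..<1}" using I by (simp add: has_integral_Icc_iff_Ioo)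
  then have "integral {0<..<1} f = I" by (rule integral_unique)
  with set_borel_integral_eq_integral(2)[OF s] show ?thesis
    by (subst integral_restrict_space) (auto simp: set_lebesgue_integral_def)
qed

lemma unit_lborel_continuous:
  fixes f :: "real \<Rightarrow> complex"
  assumes "continuous_on {0..1} f"
  shows "integrable unit_lborel f" "integral\<^sup>L unit_lborel f = integral {0..1} f"
proof -
  have "set_integrable lborel {0..1} f"
    unfolding set_integrable_def using assms by (intro borel_integrable_compact) auto
  then have "set_integrable lborel {0<..<1} f" by (rule set_integrable_subset) auto
  then show *: "integrable unit_lborel f"
    unfolding set_integrable_def by (subst integrable_restrict_space) auto
  show "integral\<^sup>L unit_lborel f = integral {0..1} f"
    by (intro unit_lborel_integral * integrable_integral integrable_continuous_interval assms)
qed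

lemma nn_integral_unit_lborel:
  fixes f :: "real \<Rightarrow> real"
  assumes I: "(f has_integral I) {0..1}" and nonneg: "\<And>x. x \<in> {0<..<1} \<Longrightarrow> f x \<ge> 0"
  shows "(\<integral>\<^sup>+x. ennreal (f x) \<partial>unit_lborel) = ennreal I"
proof -
  have "(f has_integral I) {0<..<1}" using I by (simp add: has_integral_Icc_iff_Ioo)
  from nn_integral_has_integral_lebesgue[OF nonneg this]
  have "(\<integral>\<^sup>+x. ennreal (indicator {0<..<1} x * f x) \<partial>lborel) = ennreal I" by simp
  also have "(\<integral>\<^sup>+x. ennreal (indicator {0<..<1} x * f x) \<partial>lborel)
      = (\<integral>\<^sup>+x. ennreal (f x) * indicator {0<..<1} x \<partial>lborel)"
    by (intro nn_integral_cong) (simp add: indicator_def)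
  finally show ?thesis by (subst nn_integral_restrict_space) simp_all
qed

definition unit_exp :: "real \<Rightarrow> complex" where "unit_exp t = exp (2 * of_real pi * \<i> * of_real t)"

lemma norm_unit_exp [simp]: "cmod (unit_exp t) = 1"
  by (simp add: unit_exp_def)

lemma unit_exp_circlepath: "unit_exp = circlepath 0 1"
  by (simp add: unit_exp_def circlepath fun_eq_iff)

lemma continuous_unit_exp [continuous_intros]: "continuous_on A unit_exp"
  unfolding unit_exp_def by (intro continuous_intros)

lemma unit_exp_measurable [measurable]: "unit_exp \<in> borel_measurable borel"
  by (intro borel_measurable_continuous_onI continuous_unit_exp)

lemma contour_integral_circlepath_unit_exp:
  assumes "continuous_on (sphere 0 1) f"
  shows "contour_integral (circlepath 0 1) f
    = 2 * of_real pi * \<i> * (\<integral>t. f (unit_exp t) * unit_exp t \<partial>unit_lborel)"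
proof -
  have c: "continuous_on {0..1} (\<lambda>t. f (unit_exp t))"
    by (rule continuous_on_compose2[OF assms]) (auto intro: continuous_intros)
  have "contour_integral (circlepath 0 1) f
    = integral {0..1} (\<lambda>t. f (circlepath 0 1 t) * vector_derivative (circlepath 0 1) (at t))"
    by (simp add: contour_integral_integral)
  also have "\<dots> = integral {0..1} (\<lambda>t. (2 * of_real pi * \<i>) * (f (unit_exp t) * unit_exp t))"
  proof (intro integral_cong)
    fix t :: real
    have "vector_derivative (circlepath 0 1) (at t) = 2 * of_real pi * \<i> * unit_exp t"
      by (simp add: vector_derivative_circlepath unit_exp_def)
    then show "f (circlepath 0 1 t) * vector_derivative (circlepath 0 1) (at t)
      = 2 * of_real pi * \<i> * (f (unit_exp t) * unit_exp t)"
      by (simp only:) (simp add: unit_exp_circlepath)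
  qed
  also have "\<dots> = 2 * of_real pi * \<i> * integral {0..1} (\<lambda>t. f (unit_exp t) * unit_exp t)"
    by simp
  also have "integral {0..1} (\<lambda>t. f (unit_exp t) * unit_exp t) = (\<integral>t. f (unit_exp t) * unit_exp t \<partial>unit_lborel)"
    by (rule unit_lborel_continuous(2)[symmetric]) (intro continuous_intros c)
  finally show ?thesis .
qed

definition poisson :: "complex \<Rightarrow> complex \<Rightarrow> real" where
  "poisson y x = (1 - (cmod y)\<^sup>2) / (cmod (x - y))\<^sup>2"

lemma poisson_nonneg: "cmod y < 1 \<Longrightarrow> poisson y x \<ge> 0"
  unfolding poisson_def by (intro divide_nonneg_nonneg) (auto simp: power_le_one)

text \<open>On the circle \<open>cnj x\<close> is \<open>1 / x\<close>, which turns the Poisson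
  kernel into the Cauchy kernel times a factor that is holomorphic in \<open>x\<close> and equals 1
  at \<open>x = y\<close>.\<close>

lemma poisson_eq:
  assumes "cmod x = 1" "cmod y < 1"
  shows "of_real (poisson y x) = x / (x - y) * ((1 - of_real ((cmod y)\<^sup>2)) / (1 - cnj y * x))"
proof -
  have x: "x * cnj x = 1" "x \<noteq> 0" using assms by (auto simp: complex_norm_square[symmetric])
  have xy: "x \<noteq> y" using assms by auto
  have "of_real ((cmod (x - y))\<^sup>2) = (x - y) * cnj (x - y)" by (simp only: complex_norm_square)
  also have "\<dots> * x = (x - y) * (1 - cnj y * x)" using x(1) by (simp add: algebra_simps)
  finally have *: "of_real ((cmod (x - y))\<^sup>2) = (x - y) * (1 - cnj y * x) / x"
    using x(2) by (simp add: field_simps)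
  show ?thesis unfolding poisson_def of_real_divide * using xy x(2) by simp
qed

text \<open>Cauchy's formula for \<open>F x * (1 - |y|^2) / (1 - cnj y * x)\<close>.\<close>
lemma poisson_integral:
  assumes F: "F holomorphic_on cball 0 1" and y: "cmod y < 1"
  shows "(\<integral>t. of_real (poisson y (unit_exp t)) * F (unit_exp t) \<partial>unit_lborel) = F y"
proof -
  define G where "G x = F x * ((1 - of_real ((cmod y)\<^sup>2)) / (1 - cnj y * x))" for x
  have nz: "1 - cnj y * x \<noteq> 0" if "x \<in> cball 0 1" for x
    using one_minus_nonpos(2)[of x "cnj y"] that y by (simp add: mult.commute)
  have holG: "G holomorphic_on cball 0 1"
    unfolding G_def by (intro holomorphic_intros F nz)
  have "continuous_on (sphere 0 1) (\<lambda>u. G u / (u - y))"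
    using y by (intro continuous_intros continuous_on_subset[OF holomorphic_on_imp_continuous_on[OF holG]]) auto
  note C = contour_integral_circlepath_unit_exp[OF this]
  have "contour_integral (circlepath 0 1) (\<lambda>u. G u / (u - y)) = 2 * of_real pi * \<i> * G y"
    by (rule contour_integral_unique[OF Cauchy_integral_circlepath_simple[OF holG]]) (use y in auto)
  with C have "G y = (\<integral>t. G (unit_exp t) / (unit_exp t - y) * unit_exp t \<partial>unit_lborel)" by simp
  also have "\<dots> = (\<integral>t. of_real (poisson y (unit_exp t)) * F (unit_exp t) \<partial>unit_lborel)"
    by (simp add: poisson_eq y G_def mult_ac)
  also have "G y = F y"
  proof -
    have "cmod y ^ 2 < 1" using y by (simp add: power_less_one_iff)
    then have "complex_of_real ((cmod y)\<^sup>2) \<noteq> 1" by (metis less_irrefl of_real_1 of_real_eq_iff)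
    moreover have e: "complex_of_real ((cmod y)\<^sup>2) = cnj y * y"
      by (simp only: complex_norm_square mult.commute)
    ultimately show ?thesis unfolding G_def e by simp
  qed
  finally show ?thesis ..
qed

lemma cauchy_deriv_integral:
  assumes F: "F holomorphic_on cball 0 1" and y: "cmod y < 1"
    and D: "(F has_field_derivative D) (at y)"
  shows "(\<integral>t. unit_exp t / (unit_exp t - y)\<^sup>2 * F (unit_exp t) \<partial>unit_lborel) = D"
proof -
  have contF: "continuous_on (cball 0 1) F" by (rule holomorphic_on_imp_continuous_on[OF F])
  have "continuous_on (sphere 0 1) (\<lambda>u. F u / (u - y)\<^sup>2)"
    using y by (intro continuous_intros continuous_on_subset[OF contF]) auto
  note C = contour_integral_circlepath_unit_exp[OF this]
  have "(F has_field_derivative (1 / (2 * of_real pi * \<i>) * contour_integral (circlepath 0 1) (\<lambda>u. F u / (u - y)\<^sup>2))) (at y)"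
    using Cauchy_derivative_integral_circlepath(2)[OF contF holomorphic_on_subset[OF F]] y by auto
  with D have "D = 1 / (2 * of_real pi * \<i>) * contour_integral (circlepath 0 1) (\<lambda>u. F u / (u - y)\<^sup>2)"
    by (rule DERIV_unique)
  also have "\<dots> = (\<integral>t. F (unit_exp t) / (unit_exp t - y)\<^sup>2 * unit_exp t \<partial>unit_lborel)"
    by (simp add: C)
  finally show ?thesis by (simp add: mult_ac)
qed

lemma nn_integral_poisson:
  assumes y: "cmod y < 1"
  shows "(\<integral>\<^sup>+t. ennreal (poisson y (unit_exp t)) \<partial>unit_lborel) = 1"
proof -
  have "continuous_on {0..1} (\<lambda>t. complex_of_real (poisson y (unit_exp t)))"
    unfolding poisson_def using y by (intro continuous_intros) auto
  note c = unit_lborel_continuous[OF this]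
  have i: "integrable unit_lborel (\<lambda>t. poisson y (unit_exp t))"
    using c(1) by (simp add: complex_of_real_integrable_eq)
  have "complex_of_real (\<integral>t. poisson y (unit_exp t) \<partial>unit_lborel) = 1"
    using poisson_integral[of "\<lambda>_. 1" y] y by simp
  then have "(\<integral>t. poisson y (unit_exp t) \<partial>unit_lborel) = 1" by (metis of_real_1 of_real_eq_iff)
  then show ?thesis
    using nn_integral_eq_integral[OF i] poisson_nonneg[OF y] by simp
qed

text \<open>The modulus of the kernel in Cauchy's formula for the derivative is again a Poisson
  kernel up to a constant, so its total mass is \<open>1 / (1 - (cmod y)\<^sup>2)\<close>.\<close>

lemma norm_cauchy_deriv_kernel:
  assumes "cmod y < 1"
  shows "cmod (unit_exp t / (unit_exp t - y)\<^sup>2) = poisson y (unit_exp t) / (1 - (cmod y)\<^sup>2)"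
proof -
  have "cmod y ^ 2 < 1" using assms by (simp add: power_less_one_iff)
  then show ?thesis unfolding poisson_def by (simp add: norm_divide norm_power)
qed

section \<open>Uniform bounds for Blaschke factors as multipliers\<close>

text \<open>The conjugates appear because the kernel is holomorphic in \<open>cnj \<zeta>\<close>.
  With \<open>y\<close> this point, \<open>1 - y * z\<close> is the convex combination of
  \<open>1 - cnj \<zeta> * z\<close> and \<open>1 - cnj w * z\<close> with weights \<open>r\<close>
  and \<open>1 - r\<close>, the denominator in the Feynman formula for
  \<open>s = 1 - r\<close>.\<close>

definition segment_point :: "complex \<Rightarrow> complex \<Rightarrow> real \<Rightarrow> complex" where
  "segment_point w \<zeta> r = of_real r * cnj \<zeta> + of_real (1 - r) * cnj w"

text \<open>Density of the absolutely continuous part of a representing measure of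
  \<open>(1 - |w|^2) z / (1 - cnj w * z) * cauchy_kernel \<alpha> z \<zeta>\<close>, still depending on the
  parameter \<open>r\<close> of the segment from \<open>w\<close> to \<open>\<zeta>\<close>.\<close>
definition moebius_density :: "real \<Rightarrow> complex \<Rightarrow> complex \<Rightarrow> real \<Rightarrow> real \<Rightarrow> complex" where
  "moebius_density \<alpha> w \<zeta> r t = of_real ((1 - (cmod w)\<^sup>2) * r powr (\<alpha> - 1)) *
    (of_real \<alpha> * of_real (poisson (segment_point w \<zeta> r) (unit_exp t)) / (cnj w - cnj \<zeta>) +
     of_real (1 - r) * (unit_exp t / (unit_exp t - segment_point w \<zeta> r)\<^sup>2))"

context
  fixes \<alpha> :: real and w \<zeta> :: complex
  assumes \<alpha>: "\<alpha> > 0" and w: "cmod w < 1" and \<zeta>: "cmod \<zeta> = 1"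
begin

text \<open>Convexity of the modulus. The two factors on the left are exactly those that the density
  supplies against the mass \<open>1 / (1 - |y|^2)\<close> of the derivative kernel.\<close>

lemma segment_point_bound:
  assumes "0 \<le> r" "r \<le> 1"
  shows "(1 - r) * (1 - cmod w) \<le> 1 - cmod (segment_point w \<zeta> r)"
proof -
  have "cmod (segment_point w \<zeta> r) \<le> cmod (of_real r * cnj \<zeta>) + cmod (of_real (1 - r) * cnj w)"
    unfolding segment_point_def by (rule norm_triangle_ineq)
  also have "\<dots> = r + (1 - r) * cmod w" using assms by (simp only: norm_mult norm_of_real) (simp add: \<zeta>)
  finally show ?thesis by (simp add: algebra_simps)
qed

lemma segment_point_less:
  assumes "0 \<le> r" "r < 1" shows "cmod (segment_point w \<zeta> r) < 1"
proof -
  have "(1 - r) * (1 - cmod w) > 0" using assms w by simp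
  then show ?thesis using segment_point_bound[of r] assms by simp
qed

lemma segment_point_le:
  assumes "0 \<le> r" "r \<le> 1" shows "cmod (segment_point w \<zeta> r) \<le> 1"
proof -
  have "(1 - r) * (1 - cmod w) \<ge> 0" using assms w by simp
  then show ?thesis using segment_point_bound[of r] assms by simp
qed

lemma norm_diff_ge: "1 - cmod w \<le> cmod (cnj w - cnj \<zeta>)"
proof -
  have "cmod \<zeta> \<le> cmod (\<zeta> - w) + cmod w" using norm_triangle_sub[of \<zeta> w] by simp
  also have "cmod (\<zeta> - w) = cmod (cnj w - cnj \<zeta>)" by (metis complex_cnj_diff complex_mod_cnj norm_minus_commute)
  finally show ?thesis using \<zeta> by simp
qed

lemma w_neq: "cnj w \<noteq> cnj \<zeta>" using w \<zeta> by auto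

lemma one_minus_norm_sq: "0 < 1 - (cmod w)\<^sup>2" "1 - (cmod w)\<^sup>2 \<le> 2 * (1 - cmod w)"
proof -
  have "1 - (cmod w)\<^sup>2 = (1 + cmod w) * (1 - cmod w)" by (simp add: power2_eq_square algebra_simps)
  also have "\<dots> \<le> 2 * (1 - cmod w)" using w by (intro mult_right_mono) auto
  finally show "1 - (cmod w)\<^sup>2 \<le> 2 * (1 - cmod w)" .
  show "0 < 1 - (cmod w)\<^sup>2" using w by (simp add: power_less_one_iff)
qed

lemma norm_coefficient_le: "cmod (of_real (1 - (cmod w)\<^sup>2) / (cnj w - cnj \<zeta>)) \<le> 2"
proof -
  have "(1 - (cmod w)\<^sup>2) \<le> 2 * cmod (cnj w - cnj \<zeta>)"
    using order_trans[OF one_minus_norm_sq(2) mult_left_mono[OF norm_diff_ge, of 2]] by simp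
  then show ?thesis using one_minus_norm_sq(1) w_neq
    by (simp only: norm_divide norm_of_real) (simp add: divide_le_eq)
qed

text \<open>Both summands are Poisson kernels up to constants that are uniform in \<open>w\<close>
  and \<zeta>: \<open>1 - |w|^2\<close> is at most twice the distance from \<open>w\<close> to the
  circle, hence at most twice \<open>|w - \<zeta>|\<close>, and times \<open>1 - r\<close> it is at
  most \<open>2 * (1 - |y|^2)\<close> by \<open>segment_point_bound\<close>.\<close>

lemma norm_moebius_density_le:
  assumes r: "0 < r" "r < 1"
  shows "cmod (moebius_density \<alpha> w \<zeta> r t)
    \<le> 2 * (\<alpha> + 1) * r powr (\<alpha> - 1) * poisson (segment_point w \<zeta> r) (unit_exp t)"
proof -
  let ?y = "segment_point w \<zeta> r" and ?d = "1 - (cmod w)\<^sup>2"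
  have y: "cmod ?y < 1" using r by (intro segment_point_less) auto
  have P: "poisson ?y (unit_exp t) \<ge> 0" by (rule poisson_nonneg[OF y])
  have "(cmod ?y)\<^sup>2 \<le> cmod ?y" using y by (simp add: power2_eq_square mult_left_le)
  then have ysq: "(1 - r) * (1 - cmod w) \<le> 1 - (cmod ?y)\<^sup>2"
    using segment_point_bound[of r] r by auto
  have pos: "(1 - r) * (1 - cmod w) > 0" using r w by auto
  have a: "?d / cmod (cnj w - cnj \<zeta>) \<le> 2"
    using norm_coefficient_le one_minus_norm_sq(1) by (simp only: norm_divide norm_of_real abs_of_pos)
  have "?d * (1 - r) \<le> 2 * ((1 - r) * (1 - cmod w))"
    using mult_right_mono[OF one_minus_norm_sq(2), of "1 - r"] r by (simp add: algebra_simps)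
  also have "\<dots> \<le> 2 * (1 - (cmod ?y)\<^sup>2)" using ysq by simp
  finally have b: "?d * ((1 - r) / (1 - (cmod ?y)\<^sup>2)) \<le> 2"
    using pos ysq by (simp add: divide_le_eq)
  have "cmod (moebius_density \<alpha> w \<zeta> r t) \<le> (?d * r powr (\<alpha> - 1)) *
    (\<alpha> * poisson ?y (unit_exp t) / cmod (cnj w - cnj \<zeta>) +
     (1 - r) * (poisson ?y (unit_exp t) / (1 - (cmod ?y)\<^sup>2)))"
    unfolding moebius_density_def norm_mult[of "of_real _"]
  proof (intro mult_mono)
    show "cmod (of_real \<alpha> * of_real (poisson ?y (unit_exp t)) / (cnj w - cnj \<zeta>) +
        of_real (1 - r) * (unit_exp t / (unit_exp t - ?y)\<^sup>2))
      \<le> \<alpha> * poisson ?y (unit_exp t) / cmod (cnj w - cnj \<zeta>) +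
        (1 - r) * (poisson ?y (unit_exp t) / (1 - (cmod ?y)\<^sup>2))"
      by (rule order_trans[OF norm_triangle_ineq], unfold norm_mult norm_cauchy_deriv_kernel[OF y])
        (use \<alpha> P r in \<open>simp add: norm_divide norm_mult del: of_real_diff\<close>)
  qed (use one_minus_norm_sq(1) in \<open>auto simp: norm_mult abs_mult simp del: of_real_diff\<close>)
  also have "\<dots> = (\<alpha> * (?d / cmod (cnj w - cnj \<zeta>)) + ?d * ((1 - r) / (1 - (cmod ?y)\<^sup>2)))
      * (r powr (\<alpha> - 1) * poisson ?y (unit_exp t))"
  proof -
    have "(D * R) * (\<alpha> * P / N + s * (P / Y)) = (\<alpha> * (D / N) + D * (s / Y)) * (R * P)" for D R P N s Y :: real
      by (simp add: algebra_simps)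
    then show ?thesis by blast
  qed
  also have "\<dots> \<le> (\<alpha> * 2 + 2) * (r powr (\<alpha> - 1) * poisson ?y (unit_exp t))"
    using \<alpha> P a b by (intro mult_right_mono add_mono mult_left_mono) auto
  finally show ?thesis by (simp add: algebra_simps)
qed

lemma nn_integral_moebius_density_le:
  assumes r: "0 < r" "r < 1"
  shows "(\<integral>\<^sup>+t. ennreal (cmod (moebius_density \<alpha> w \<zeta> r t)) \<partial>unit_lborel) \<le> ennreal (2 * (\<alpha> + 1) * r powr (\<alpha> - 1))"
proof -
  have y: "cmod (segment_point w \<zeta> r) < 1" using r by (intro segment_point_less) auto
  have "(\<integral>\<^sup>+t. ennreal (cmod (moebius_density \<alpha> w \<zeta> r t)) \<partial>unit_lborel)
    \<le> (\<integral>\<^sup>+t. ennreal (2 * (\<alpha> + 1) * r powr (\<alpha> - 1)) * ennreal (poisson (segment_point w \<zeta> r) (unit_exp t)) \<partial>unit_lborel)"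
    using norm_moebius_density_le[OF r] \<alpha> poisson_nonneg[OF y]
    by (intro nn_integral_mono) (auto simp: ennreal_mult[symmetric] intro!: ennreal_leI)
  also have "\<dots> = ennreal (2 * (\<alpha> + 1) * r powr (\<alpha> - 1)) *
     (\<integral>\<^sup>+t. ennreal (poisson (segment_point w \<zeta> r) (unit_exp t)) \<partial>unit_lborel)"
    unfolding poisson_def
    by (intro nn_integral_cmult measurable_restrict_space1) simp
  finally show ?thesis by (simp add: nn_integral_poisson[OF y])
qed

lemma nn_integral_powr: "(\<integral>\<^sup>+r. ennreal (c * r powr (\<alpha> - 1)) \<partial>unit_lborel) = ennreal (c / \<alpha>)" if "c \<ge> 0"
proof -
  have "((\<lambda>r. c * r powr (\<alpha> - 1)) has_integral c * (1 powr (\<alpha> - 1 + 1) / (\<alpha> - 1 + 1))) {0..1}"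
    by (intro has_integral_mult_right has_integral_powr_from_0) (use \<alpha> in auto)
  from nn_integral_unit_lborel[OF this] show ?thesis using that by simp
qed

text \<open>As a function of \<open>cnj (unit_exp t)\<close> conjugated back, the kernel is boundary
  data of the holomorphic function \<open>F x = (1 - x * z) powr (- \<alpha>)\<close>. The Poisson
  term reproduces \<open>F y\<close>, the other term \<open>deriv F y\<close>, and the two combine
  because \<open>(1 - y * z) + (1 - r) * (cnj w - cnj \<zeta>) * z\<close> equals
  \<open>1 - cnj \<zeta> * z\<close>, independently of \<open>r\<close>.\<close>

lemma integral_moebius_density_kernel:
  assumes r: "0 < r" "r < 1" and z: "cmod z < 1"
  shows "(\<integral>t. cauchy_kernel \<alpha> z (cnj (unit_exp t)) * moebius_density \<alpha> w \<zeta> r t \<partial>unit_lborel)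
    = of_real (1 - (cmod w)\<^sup>2) / (cnj w - cnj \<zeta>) * ((1 - cnj \<zeta> * z) / (1 - cnj w * z)) *
      (of_real (\<alpha> * r powr (\<alpha> - 1)) * (1 - cnj w * z) / (1 - segment_point w \<zeta> r * z) powr (of_real \<alpha> + 1))"
proof -
  define y where "y = segment_point w \<zeta> r"
  have y: "cmod y < 1" unfolding y_def using r by (intro segment_point_less) auto
  define F where "F x = 1 / (1 - x * z) powr of_real \<alpha>" for x
  have nz: "1 - x * z \<notin> \<real>\<^sub>\<le>\<^sub>0" "1 - x * z \<noteq> 0" if "cmod x \<le> 1" for x
    using one_minus_nonpos[OF that z] by auto
  have holF: "F holomorphic_on cball 0 1"
    unfolding F_def using nz by (intro holomorphic_intros) (auto simp: powr_eq_0_iff)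
  have A: "1 - y * z \<noteq> 0" using nz y by auto
  have p1: "(1 - y * z) powr (of_real \<alpha> + 1) = (1 - y * z) powr of_real \<alpha> * (1 - y * z)"
    using A by (simp add: powr_add)
  have F_minus: "F x = (1 - x * z) powr (- of_real \<alpha>)" for x by (simp add: F_def powr_minus_divide)
  have "((\<lambda>x. (1 - x * z) powr (- of_real \<alpha>)) has_field_derivative
      (- z) * (- of_real \<alpha>) * (1 - y * z) powr (- of_real \<alpha> - 1)) (at y)"
    using nz(1)[of y] y
    by (auto intro!: derivative_eq_intros simp: mult_ac)
  moreover have "(1 - y * z) powr (- of_real \<alpha> - 1) = 1 / (1 - y * z) powr (of_real \<alpha> + 1)"
    by (simp add: powr_minus_divide[symmetric])
  ultimately have D: "(F has_field_derivative of_real \<alpha> * z / (1 - y * z) powr (of_real \<alpha> + 1)) (at y)"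
    unfolding F_minus[abs_def] by (simp add: mult_ac)
  note I1 = poisson_integral[OF holF y] and I2 = cauchy_deriv_integral[OF holF y D]
  have contF: "continuous_on {0..1} (\<lambda>t. F (unit_exp t))"
    by (rule continuous_on_compose2[OF holomorphic_on_imp_continuous_on[OF holF]])
      (auto intro: continuous_intros)
  have ne: "unit_exp t \<noteq> y" for t using y norm_unit_exp[of t] by auto
  have i1: "integrable unit_lborel (\<lambda>t. of_real (poisson y (unit_exp t)) * F (unit_exp t))"
    unfolding poisson_def using ne by (intro unit_lborel_continuous continuous_intros contF) auto
  have i2: "integrable unit_lborel (\<lambda>t. unit_exp t / (unit_exp t - y)\<^sup>2 * F (unit_exp t))"
    using ne by (intro unit_lborel_continuous continuous_intros contF) auto
  define d where "d = complex_of_real (1 - (cmod w)\<^sup>2)"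
  define \<rho> where "\<rho> = complex_of_real (r powr (\<alpha> - 1))"
  define c where "c = cnj w - cnj \<zeta>"
  have c: "c \<noteq> 0" using w_neq by (simp add: c_def)
  have alg: "k * (d * \<rho> * (of_real \<alpha> * p / c + s * q)) = d * \<rho> * (of_real \<alpha> / c * (p * k) + s * (q * k))"
    for k p q s by (simp add: algebra_simps)
  have dens: "moebius_density \<alpha> w \<zeta> r t = d * \<rho> * (of_real \<alpha> * of_real (poisson y (unit_exp t)) / c
      + of_real (1 - r) * (unit_exp t / (unit_exp t - y)\<^sup>2))" for t
    by (simp only: moebius_density_def d_def \<rho>_def c_def y_def of_real_mult)
  have "(\<integral>t. cauchy_kernel \<alpha> z (cnj (unit_exp t)) * moebius_density \<alpha> w \<zeta> r t \<partial>unit_lborel)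
    = (\<integral>t. d * \<rho> * (of_real \<alpha> / c * (of_real (poisson y (unit_exp t)) * F (unit_exp t))
        + of_real (1 - r) * (unit_exp t / (unit_exp t - y)\<^sup>2 * F (unit_exp t))) \<partial>unit_lborel)"
    by (intro Bochner_Integration.integral_cong refl)
      (simp only: cauchy_kernel_def complex_cnj_cnj F_def[symmetric] dens alg)
  also have "\<dots> = d * \<rho> * (of_real \<alpha> / c * F y + of_real (1 - r) * (of_real \<alpha> * z / (1 - y * z) powr (of_real \<alpha> + 1)))"
    by (subst integral_mult_right_zero, subst Bochner_Integration.integral_add)
      (intro integrable_mult_right i1 i2, intro integrable_mult_right i1 i2,
        simp only: integral_mult_right_zero I1 I2)
  also have "\<dots> = d * \<rho> * of_real \<alpha> / (1 - y * z) powr (of_real \<alpha> + 1) * ((1 - y * z) / c + of_real (1 - r) * z)"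
  proof -
    have pw: "(1 - y * z) powr of_real \<alpha> \<noteq> 0" using A by (simp add: powr_eq_0_iff)
    have "d * \<rho> * (of_real \<alpha> / c * (1 / P) + s * (of_real \<alpha> * z / (P * E))) = d * \<rho> * of_real \<alpha> / (P * E) * (E / c + s * z)"
      if "P \<noteq> 0" "E \<noteq> 0" for P E s using that c by (simp add: field_simps)
    from this[OF pw A] show ?thesis unfolding F_def p1 by blast
  qed
  also have "(1 - y * z) / c + of_real (1 - r) * z = (1 - cnj \<zeta> * z) / c"
    using c by (simp add: y_def segment_point_def c_def field_simps)
  also have "d * \<rho> * of_real \<alpha> / (1 - y * z) powr (of_real \<alpha> + 1) * ((1 - cnj \<zeta> * z) / c)
    = d / c * ((1 - cnj \<zeta> * z) / (1 - cnj w * z)) * (of_real (\<alpha> * r powr (\<alpha> - 1)) * (1 - cnj w * z) / (1 - y * z) powr (of_real \<alpha> + 1))"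
  proof -
    have "d * \<rho> * a / W * (B / c) = d / c * (B / A') * (a * \<rho> * A' / W)" if "A' \<noteq> 0" for a A' B W
      using that by (simp add: mult_ac)
    from this[OF nz(2)[of "cnj w"]] w show ?thesis by (simp only: \<rho>_def of_real_mult complex_mod_cnj less_imp_le)
  qed
  finally show ?thesis unfolding d_def c_def y_def .
qed

text \<open>This is the Feynman formula. An antiderivative is
  \<open>r powr \<alpha> * (1 - y * z) powr (- \<alpha>)\<close> with \<open>y\<close> the segment
  point: in its derivative the bracket \<open>(1 - y * z) + r * (cnj \<zeta> - cnj w) * z\<close> is
  the constant \<open>1 - cnj w * z\<close>. It vanishes at 0 because \<alpha> is positive, and
  equals the kernel at 1.\<close>

lemma segment_antiderivative:
  assumes z: "cmod z < 1"
  shows "((\<lambda>r. of_real (\<alpha> * r powr (\<alpha> - 1)) * (1 - cnj w * z) / (1 - segment_point w \<zeta> r * z) powr (of_real \<alpha> + 1))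
    has_integral cauchy_kernel \<alpha> z \<zeta>) {0..1}"
proof -
  define V where "V r = of_real (r powr \<alpha>) * (1 - segment_point w \<zeta> r * z) powr (- of_real \<alpha>)" for r
  have nz: "1 - segment_point w \<zeta> r * z \<notin> \<real>\<^sub>\<le>\<^sub>0" "1 - segment_point w \<zeta> r * z \<noteq> 0"
     "Re (1 - segment_point w \<zeta> r * z) > 0" if "0 \<le> r" "r \<le> 1" for r
    using one_minus_nonpos[OF segment_point_le z] Re_one_minus_pos[OF segment_point_le z] that by auto
  have "((\<lambda>r. of_real (\<alpha> * r powr (\<alpha> - 1)) * (1 - cnj w * z) / (1 - segment_point w \<zeta> r * z) powr (of_real \<alpha> + 1))
    has_integral V 1 - V 0) {0..1}"
  \<comment> \<open>For \<open>\<alpha> < 1\<close> the antiderivative is not differentiable at 0,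
    so only its continuity is used at the endpoints.\<close>
  proof (rule fundamental_theorem_of_calculus_interior)
    have "continuous_on {0..1} (\<lambda>r. complex_of_real (r powr \<alpha>))"
      using \<alpha> by (intro continuous_intros continuous_on_powr') auto
    moreover have "continuous_on {0..1} (\<lambda>r. (1 - segment_point w \<zeta> r * z) powr (- of_real \<alpha>))"
    proof (rule continuous_on_powr_complex)
      show "{0..1} \<subseteq> {r. 0 \<le> Re (1 - segment_point w \<zeta> r * z) \<or> Im (1 - segment_point w \<zeta> r * z) \<noteq> 0}"
        using nz(3) by (auto simp del: minus_complex.simps intro: less_imp_le)
      show "continuous_on {0..1} (\<lambda>r. 1 - segment_point w \<zeta> r * z)"
        unfolding segment_point_def by (intro continuous_intros)
    qed (use nz in auto)
    ultimately show "continuous_on {0..1} V" unfolding V_def by (rule continuous_on_mult)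
    fix r :: real assume r: "r \<in> {0<..<1}"
    define Q where "Q = 1 - segment_point w \<zeta> r * z"
    have Q: "Q \<notin> \<real>\<^sub>\<le>\<^sub>0" "Q \<noteq> 0" using nz[of r] r by (auto simp: Q_def)
    have d1: "((\<lambda>r. complex_of_real (r powr \<alpha>)) has_vector_derivative of_real (\<alpha> * r powr (\<alpha> - 1))) (at r)"
      using has_real_derivative_powr[of r \<alpha>] r
      by (intro has_vector_derivative_of_real) (auto simp: has_real_derivative_iff_has_vector_derivative)
    have d2: "((\<lambda>r. 1 - segment_point w \<zeta> r * z) has_vector_derivative - ((cnj \<zeta> - cnj w) * z)) (at r)"
      unfolding segment_point_def by (auto intro!: derivative_eq_intros simp: algebra_simps)
    have d3: "((\<lambda>q. q powr (- of_real \<alpha>)) has_field_derivative (- of_real \<alpha>) * Q powr (- of_real \<alpha> - 1)) (at Q)"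
      using Q by (auto intro!: derivative_eq_intros)
    have d4: "((\<lambda>r. (1 - segment_point w \<zeta> r * z) powr (- of_real \<alpha>)) has_vector_derivative
        (- ((cnj \<zeta> - cnj w) * z)) * ((- of_real \<alpha>) * Q powr (- of_real \<alpha> - 1))) (at r)"
      using field_vector_diff_chain_at[OF d2 d3[unfolded Q_def]] by (simp only: o_def Q_def)
    have dV: "(V has_vector_derivative of_real (r powr \<alpha>) * ((- ((cnj \<zeta> - cnj w) * z)) * ((- of_real \<alpha>) * Q powr (- of_real \<alpha> - 1)))
       + of_real (\<alpha> * r powr (\<alpha> - 1)) * Q powr (- of_real \<alpha>)) (at r)"
      unfolding V_def Q_def by (rule has_vector_derivative_mult[OF d1 d4[unfolded Q_def]])
    have q1: "Q powr (- of_real \<alpha>) = Q / Q powr (of_real \<alpha> + 1)"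
      using Q(2) by (simp add: powr_add powr_minus_divide)
    have q2: "Q powr (- of_real \<alpha> - 1) = 1 / Q powr (of_real \<alpha> + 1)"
      by (simp add: powr_minus_divide[symmetric])
    have r1: "r powr \<alpha> = r * r powr (\<alpha> - 1)" using r by (simp add: powr_diff)
    have Qeq: "Q + of_real r * ((cnj \<zeta> - cnj w) * z) = 1 - cnj w * z"
      by (simp add: Q_def segment_point_def algebra_simps)
    have "of_real (r powr \<alpha>) * ((- ((cnj \<zeta> - cnj w) * z)) * ((- of_real \<alpha>) * Q powr (- of_real \<alpha> - 1)))
       + of_real (\<alpha> * r powr (\<alpha> - 1)) * Q powr (- of_real \<alpha>)
       = of_real (\<alpha> * r powr (\<alpha> - 1)) * (Q + of_real r * ((cnj \<zeta> - cnj w) * z)) / Q powr (of_real \<alpha> + 1)"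
      unfolding q1 q2 r1 by (simp add: algebra_simps add_divide_distrib diff_divide_distrib)
    with dV show "(V has_vector_derivative of_real (\<alpha> * r powr (\<alpha> - 1)) * (1 - cnj w * z) /
        (1 - segment_point w \<zeta> r * z) powr (of_real \<alpha> + 1)) (at r)"
      unfolding Qeq unfolding Q_def by simp
  qed simp
  moreover have "V 1 - V 0 = cauchy_kernel \<alpha> z \<zeta>"
    by (simp add: V_def segment_point_def cauchy_kernel_def powr_minus_divide)
  ultimately show ?thesis by simp
qed

lemma moebius_density_kernel_measurable:
  assumes z: "cmod z < 1"
  shows "(\<lambda>(r, t). cauchy_kernel \<alpha> z (cnj (unit_exp t)) * moebius_density \<alpha> w \<zeta> r t)
    \<in> borel_measurable (unit_lborel \<Otimes>\<^sub>M unit_lborel)"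
proof -
  have [measurable]: "(\<lambda>t. cauchy_kernel \<alpha> z (cnj (unit_exp t))) \<in> borel_measurable borel"
    by (intro borel_measurable_continuous_onI continuous_on_compose2[OF cauchy_kernel_continuous[OF z]])
      (auto intro!: continuous_intros)
  have [measurable]: "segment_point w \<zeta> \<in> borel_measurable borel"
    unfolding segment_point_def by (intro borel_measurable_continuous_onI continuous_intros)
  have *: "(\<lambda>p. cauchy_kernel \<alpha> z (cnj (unit_exp (snd p))) * moebius_density \<alpha> w \<zeta> (fst p) (snd p))
    \<in> borel_measurable (borel \<Otimes>\<^sub>M borel)"
    unfolding moebius_density_def poisson_def by measurable
  have "(\<lambda>p. p) \<in> measurable (unit_lborel \<Otimes>\<^sub>M unit_lborel) (borel \<Otimes>\<^sub>M borel)"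
    by (subst prod.collapse[symmetric], intro measurable_Pair)
      (auto intro!: measurable_compose[OF measurable_fst] measurable_compose[OF measurable_snd] measurable_restrict_space1)
  from measurable_compose[OF this *] show ?thesis by (simp add: case_prod_unfold)
qed

text \<open>At \<open>z = 0\<close> the kernel is identically 1.\<close>

lemma moebius_density_measurable:
  "(\<lambda>(r, t). moebius_density \<alpha> w \<zeta> r t) \<in> borel_measurable (unit_lborel \<Otimes>\<^sub>M unit_lborel)"
  using moebius_density_kernel_measurable[of 0] by (simp add: cauchy_kernel_def)

lemma nn_integral_moebius_density2_le:
  "(\<integral>\<^sup>+p. ennreal (cmod (case_prod (moebius_density \<alpha> w \<zeta>) p)) \<partial>(unit_lborel \<Otimes>\<^sub>M unit_lborel))
    \<le> ennreal (2 * (\<alpha> + 1) / \<alpha>)"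
proof (rule integrable_iterated(3)[OF sigma_finite_unit_lborel sigma_finite_unit_lborel
      moebius_density_measurable])
  show "(\<integral>\<^sup>+r. ennreal (2 * (\<alpha> + 1) * r powr (\<alpha> - 1)) \<partial>unit_lborel) \<le> ennreal (2 * (\<alpha> + 1) / \<alpha>)"
    using \<alpha> by (subst nn_integral_powr) auto
qed (use nn_integral_moebius_density_le in \<open>auto simp: space_restrict_space\<close>)

text \<open>With \<open>A = 1 - cnj w * z\<close>, \<open>B = 1 - cnj \<zeta> * z\<close> and
  \<open>C = cnj w - cnj \<zeta>\<close> one has \<open>A + C * z = B\<close>, hence
  \<open>z / A = - 1 / C + (1 / C) * (B / A)\<close>. The first term keeps a point mass at \<zeta>;
  the second, multiplied by the kernel, is the double integral.\<close>

lemma cauchy_kernel_moebius: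
  assumes z: "cmod z < 1"
  shows "of_real (1 - (cmod w)\<^sup>2) * z / (1 - cnj w * z) * cauchy_kernel \<alpha> z \<zeta>
    = - (of_real (1 - (cmod w)\<^sup>2) / (cnj w - cnj \<zeta>)) * cauchy_kernel \<alpha> z \<zeta>
      + (\<integral>p. cauchy_kernel \<alpha> z (cnj (unit_exp (snd p))) * case_prod (moebius_density \<alpha> w \<zeta>) p
          \<partial>(unit_lborel \<Otimes>\<^sub>M unit_lborel))" (is "_ = _ + ?I")
proof -
  define K where "K = (1 - cmod z) powr (- \<alpha>)"
  have K: "cmod (cauchy_kernel \<alpha> z (cnj (unit_exp t))) \<le> K" "K \<ge> 0" for t
    unfolding K_def using \<alpha> z by (auto intro!: norm_cauchy_kernel_le)
  have "(\<integral>\<^sup>+t. ennreal (cmod (cauchy_kernel \<alpha> z (cnj (unit_exp t)) * moebius_density \<alpha> w \<zeta> r t)) \<partial>unit_lborel)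
    \<le> ennreal (K * (2 * (\<alpha> + 1)) * r powr (\<alpha> - 1))" if r: "r \<in> {0<..<1}" for r
  proof -
    have m: "(\<lambda>t. ennreal (cmod (moebius_density \<alpha> w \<zeta> r t))) \<in> borel_measurable unit_lborel"
      unfolding moebius_density_def poisson_def by (intro measurable_restrict_space1) simp
    have "(\<integral>\<^sup>+t. ennreal (cmod (cauchy_kernel \<alpha> z (cnj (unit_exp t)) * moebius_density \<alpha> w \<zeta> r t)) \<partial>unit_lborel)
      \<le> (\<integral>\<^sup>+t. ennreal K * ennreal (cmod (moebius_density \<alpha> w \<zeta> r t)) \<partial>unit_lborel)"
      using K by (intro nn_integral_mono) (auto simp: ennreal_mult[symmetric] norm_mult intro!: ennreal_leI mult_right_mono)
    also have "\<dots> = ennreal K * (\<integral>\<^sup>+t. ennreal (cmod (moebius_density \<alpha> w \<zeta> r t)) \<partial>unit_lborel)"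
      by (rule nn_integral_cmult[OF m])
    also have "\<dots> \<le> ennreal K * ennreal (2 * (\<alpha> + 1) * r powr (\<alpha> - 1))"
      using r by (intro mult_left_mono nn_integral_moebius_density_le) auto
    also have "\<dots> = ennreal (K * (2 * (\<alpha> + 1)) * r powr (\<alpha> - 1))"
      using K \<alpha> by (simp add: ennreal_mult[symmetric] mult.assoc)
    finally show ?thesis .
  qed
  moreover have "(\<integral>\<^sup>+r. ennreal (K * (2 * (\<alpha> + 1)) * r powr (\<alpha> - 1)) \<partial>unit_lborel) \<le> ennreal (K * (2 * (\<alpha> + 1)) / \<alpha>)"
    using K \<alpha> by (subst nn_integral_powr) auto
  ultimately have it: "?I = (\<integral>r. \<integral>t. cauchy_kernel \<alpha> z (cnj (unit_exp t)) * moebius_density \<alpha> w \<zeta> r t \<partial>unit_lborel \<partial>unit_lborel)"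
    and ir: "integrable unit_lborel (\<lambda>r. \<integral>t. cauchy_kernel \<alpha> z (cnj (unit_exp t)) * moebius_density \<alpha> w \<zeta> r t \<partial>unit_lborel)"
    using integrable_iterated(2,4)[OF sigma_finite_unit_lborel sigma_finite_unit_lborel moebius_density_kernel_measurable[OF z],
      of "\<lambda>r. ennreal (K * (2 * (\<alpha> + 1)) * r powr (\<alpha> - 1))" "K * (2 * (\<alpha> + 1)) / \<alpha>"]
    by (auto simp: space_restrict_space case_prod_unfold)
  define c where "c = of_real (1 - (cmod w)\<^sup>2) / (cnj w - cnj \<zeta>) * ((1 - cnj \<zeta> * z) / (1 - cnj w * z))"
  define v where "v r = of_real (\<alpha> * r powr (\<alpha> - 1)) * (1 - cnj w * z) / (1 - segment_point w \<zeta> r * z) powr (of_real \<alpha> + 1)" for r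
  have eq: "(\<integral>t. cauchy_kernel \<alpha> z (cnj (unit_exp t)) * moebius_density \<alpha> w \<zeta> r t \<partial>unit_lborel) = c * v r"
    if "r \<in> space unit_lborel" for r
    using that integral_moebius_density_kernel[OF _ _ z, of r] by (simp add: c_def v_def space_restrict_space)
  have "integrable unit_lborel (\<lambda>r. c * v r)"
    by (rule iffD1[OF Bochner_Integration.integrable_cong[OF refl eq] ir])
  moreover have "((\<lambda>r. c * v r) has_integral c * cauchy_kernel \<alpha> z \<zeta>) {0..1}"
    unfolding v_def by (intro has_integral_mult_right segment_antiderivative z)
  ultimately have "(\<integral>r. c * v r \<partial>unit_lborel) = c * cauchy_kernel \<alpha> z \<zeta>"
    by (rule unit_lborel_integral)
  then have I: "?I = c * cauchy_kernel \<alpha> z \<zeta>"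
    unfolding it by (subst Bochner_Integration.integral_cong[OF refl eq]) auto
  have "1 - cnj w * z \<noteq> 0" using one_minus_nonpos(2)[of "cnj w" z] w z by simp
  moreover have "cnj w - cnj \<zeta> \<noteq> 0" using w_neq by simp
  moreover have "D * z / A = - (D / C) + D / C * ((A + C * z) / A)" if "A \<noteq> 0" "C \<noteq> 0" for A C D :: complex
    using that by (simp add: field_simps)
  moreover have "1 - cnj w * z + (cnj w - cnj \<zeta>) * z = 1 - cnj \<zeta> * z" by (simp add: algebra_simps)
  ultimately have "of_real (1 - (cmod w)\<^sup>2) * z / (1 - cnj w * z) = - (of_real (1 - (cmod w)\<^sup>2) / (cnj w - cnj \<zeta>)) + c"
    unfolding c_def by metis
  then show ?thesis unfolding I by (simp only: distrib_right)
qed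

end

text \<open>Integrate \<open>cauchy_kernel_moebius\<close> over \<zeta>. The point masses become a
  density on \<open>P\<close> bounded by 2, and the double integrals become the image of a complex
  density on the product of \<open>P\<close> with the unit square, of mass at most
  \<open>2 * (\<alpha> + 1) / \<alpha>\<close> times that of \<open>P\<close>.\<close>

lemma moebius_part_multiplier:
  assumes \<alpha>: "\<alpha> > 0" and w: "cmod w < 1"
  shows "bounded_multiplier \<alpha> (4 * (2 + 2 * (\<alpha> + 1) / \<alpha>))
    (\<lambda>z. of_real (1 - (cmod w)\<^sup>2) * z / (1 - cnj w * z))"
proof (rule bounded_multiplierI_measure[OF \<alpha>])
  show "0 \<le> 2 + 2 * (\<alpha> + 1) / \<alpha>" using \<alpha> by simp
  fix P :: "complex measure" assume fin: "finite_measure P" and sets: "sets P = sets circle_borel"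
  interpret P: finite_measure P by fact
  have sp: "space P = sphere 0 1" using sets_eq_imp_space_eq[OF sets] by simp
  have idP: "(\<lambda>\<zeta>. \<zeta>) \<in> measurable P circle_borel" by (simp add: measurable_cong_sets[OF sets refl])
  have idB: "(\<lambda>\<zeta>. \<zeta>) \<in> measurable P borel"
    by (rule measurable_compose[OF idP]) (auto intro: measurable_restrict_space1)
  let ?V = "unit_lborel \<Otimes>\<^sub>M unit_lborel"
  define m where "m = measure P (space P)"
  have m: "m \<ge> 0" by (simp add: m_def)
  define c where "c \<zeta> = - (of_real (1 - (cmod w)\<^sup>2) / (cnj w - cnj \<zeta>))" for \<zeta>
  define q where "q \<zeta> = case_prod (moebius_density \<alpha> w \<zeta>)" for \<zeta>
  define e where "e p = cnj (unit_exp (snd (snd p)))" for p :: "complex \<times> real \<times> real"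
  have sfV: "sigma_finite_measure ?V"
  proof -
    interpret pair_sigma_finite unit_lborel unit_lborel
      unfolding pair_sigma_finite_def using sigma_finite_unit_lborel by auto
    show ?thesis ..
  qed
  have cM: "c \<in> borel_measurable P"
  proof -
    have "(\<lambda>\<zeta>. - (of_real (1 - (cmod w)\<^sup>2) / (cnj w - \<zeta>))) \<in> borel_measurable borel" by simp
    moreover have "cnj \<in> borel_measurable borel" by (intro borel_measurable_continuous_onI continuous_intros)
    ultimately show ?thesis unfolding c_def by (intro measurable_compose[OF measurable_compose[OF idB]])
  qed
  have cle: "cmod (c \<zeta>) \<le> 2" if "\<zeta> \<in> space P" for \<zeta>
    using norm_coefficient_le[OF \<alpha> w, of \<zeta>] that sp by (simp only: c_def norm_minus_cancel) simp
  have ci: "integrable P c" using cle cM by (intro P.integrable_const_bound[where B=2]) auto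
  \<comment> \<open>Joint measurability is checked on the plain Borel product and carried over along
    the identity.\<close>
  have idV: "(\<lambda>p. p) \<in> measurable (P \<Otimes>\<^sub>M ?V) (borel \<Otimes>\<^sub>M (borel \<Otimes>\<^sub>M borel))"
  proof -
    have "(\<lambda>p. (fst p, fst (snd p), snd (snd p))) \<in> measurable (P \<Otimes>\<^sub>M ?V) (borel \<Otimes>\<^sub>M (borel \<Otimes>\<^sub>M borel))"
      by (intro measurable_Pair measurable_compose[OF measurable_fst idB]
          measurable_compose[OF measurable_compose[OF measurable_snd measurable_fst]]
          measurable_compose[OF measurable_compose[OF measurable_snd measurable_snd]]
          measurable_restrict_space1) auto
    then show ?thesis by simp
  qed
  have eM: "e \<in> measurable (P \<Otimes>\<^sub>M ?V) circle_borel"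
  proof (rule measurable_restrict_space2)
    have "(\<lambda>p::complex \<times> real \<times> real. cnj (unit_exp (snd (snd p)))) \<in> borel_measurable (borel \<Otimes>\<^sub>M (borel \<Otimes>\<^sub>M borel))"
      by (intro measurable_compose[OF measurable_compose[OF measurable_snd measurable_snd]]
          borel_measurable_continuous_onI continuous_intros)
    from measurable_compose[OF idV this] show "e \<in> borel_measurable (P \<Otimes>\<^sub>M ?V)" by (simp add: e_def[abs_def])
  qed (simp add: e_def)
  have qM: "(\<lambda>p. q (fst p) (snd p)) \<in> borel_measurable (P \<Otimes>\<^sub>M ?V)"
  proof -
    have [measurable]: "cnj \<in> borel_measurable borel" by (intro borel_measurable_continuous_onI continuous_intros)
    have "(\<lambda>p. q (fst p) (snd p)) \<in> borel_measurable (borel \<Otimes>\<^sub>M (borel \<Otimes>\<^sub>M borel))"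
      unfolding q_def case_prod_unfold moebius_density_def poisson_def segment_point_def by measurable
    from measurable_compose[OF idV this] show ?thesis .
  qed
  have nnP: "(\<integral>\<^sup>+\<zeta>. ennreal B \<partial>P) = ennreal (B * m)" if "B \<ge> 0" for B
    using that m by (simp add: P.emeasure_eq_measure m_def ennreal_mult[symmetric])
  have qle: "(\<integral>\<^sup>+v. ennreal (cmod (q \<zeta> v)) \<partial>?V) \<le> ennreal (2 * (\<alpha> + 1) / \<alpha>)" if "\<zeta> \<in> space P" for \<zeta>
    unfolding q_def using that sp by (intro nn_integral_moebius_density2_le[OF \<alpha> w]) auto
  have qi: "integrable (P \<Otimes>\<^sub>M ?V) (\<lambda>p. q (fst p) (snd p))"
    and qn: "(\<integral>\<^sup>+p. ennreal (cmod (q (fst p) (snd p))) \<partial>(P \<Otimes>\<^sub>M ?V)) \<le> ennreal (2 * (\<alpha> + 1) / \<alpha> * m)"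
    using integrable_iterated(1,3)[OF P.sigma_finite_measure_axioms sfV qM, of "\<lambda>_. ennreal (2 * (\<alpha> + 1) / \<alpha>)" "2 * (\<alpha> + 1) / \<alpha> * m"]
      qle nnP[of "2 * (\<alpha> + 1) / \<alpha>"] \<alpha> by auto
  have F1: "F_bounded \<alpha> (2 * m) (\<lambda>z. \<integral>\<zeta>. cauchy_kernel \<alpha> z \<zeta> * c \<zeta> \<partial>P)"
  proof (rule F_bounded_pushforward[OF \<alpha> idP ci refl])
    have "(\<integral>\<zeta>. cmod (c \<zeta>) \<partial>P) \<le> (\<integral>\<zeta>. 2 \<partial>P)" using ci cle by (intro integral_mono) auto
    then show "(\<integral>\<zeta>. cmod (c \<zeta>) \<partial>P) \<le> 2 * m" by (simp add: m_def mult.commute)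
  qed
  have F2: "F_bounded \<alpha> (2 * (\<alpha> + 1) / \<alpha> * m) (\<lambda>z. \<integral>p. cauchy_kernel \<alpha> z (e p) * q (fst p) (snd p) \<partial>(P \<Otimes>\<^sub>M ?V))"
    by (rule F_bounded_pushforward[OF \<alpha> eM qi refl], rule integral_norm_le_of_nn_integral[OF qn]) (use \<alpha> m in simp)
  have "of_real (1 - (cmod w)\<^sup>2) * z / (1 - cnj w * z) * integral\<^sup>L P (cauchy_kernel \<alpha> z)
    = (\<integral>\<zeta>. cauchy_kernel \<alpha> z \<zeta> * c \<zeta> \<partial>P) + (\<integral>p. cauchy_kernel \<alpha> z (e p) * q (fst p) (snd p) \<partial>(P \<Otimes>\<^sub>M ?V))"
    if z: "z \<in> unit_disk" for z
  proof -
    have kM: "cauchy_kernel \<alpha> z \<in> borel_measurable P"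
      using cauchy_kernel_measurable[OF z] by (simp add: measurable_cong_sets[OF sets refl])
    define K where "K = (1 - cmod z) powr (- \<alpha>)"
    have K: "cmod (cauchy_kernel \<alpha> z \<zeta>) \<le> K" "K \<ge> 0" if "cmod \<zeta> \<le> 1" for \<zeta>
      unfolding K_def using norm_cauchy_kernel_le[OF \<alpha> _ that] z by auto
    define G where "G p = cauchy_kernel \<alpha> z (e p) * q (fst p) (snd p)" for p
    have GM: "G \<in> borel_measurable (P \<Otimes>\<^sub>M ?V)"
      unfolding G_def by (intro borel_measurable_times qM measurable_compose[OF eM cauchy_kernel_measurable[OF z]])
    have Gi: "integrable (P \<Otimes>\<^sub>M ?V) G"
    proof (rule Bochner_Integration.integrable_bound)
      show "integrable (P \<Otimes>\<^sub>M ?V) (\<lambda>p. of_real K * q (fst p) (snd p))" using qi by simp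
      show "AE p in P \<Otimes>\<^sub>M ?V. norm (G p) \<le> norm (of_real K * q (fst p) (snd p))"
        using K(1) by (intro AE_I2)
          (auto simp: G_def norm_mult e_def intro!: mult_right_mono order_trans[OF _ abs_ge_self])
    qed (rule GM)
    interpret pair_sigma_finite P ?V
      unfolding pair_sigma_finite_def using sfV P.sigma_finite_measure_axioms by auto
    have eq: "of_real (1 - (cmod w)\<^sup>2) * z / (1 - cnj w * z) * cauchy_kernel \<alpha> z \<zeta>
      = cauchy_kernel \<alpha> z \<zeta> * c \<zeta> + (\<integral>v. G (\<zeta>, v) \<partial>?V)" if "\<zeta> \<in> space P" for \<zeta>
      using cauchy_kernel_moebius[OF \<alpha> w, of \<zeta> z] that sp z
      by (simp only: G_def e_def q_def c_def fst_conv snd_conv mult.commute[of "cauchy_kernel \<alpha> z \<zeta>"]) simp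
    have i1: "integrable P (\<lambda>\<zeta>. cauchy_kernel \<alpha> z \<zeta> * c \<zeta>)"
    proof (rule P.integrable_const_bound[where B="K * 2"])
      show "AE \<zeta> in P. cmod (cauchy_kernel \<alpha> z \<zeta> * c \<zeta>) \<le> K * 2"
        using K(1) K(2)[of 0, simplified] cle sp by (intro AE_I2) (auto simp: norm_mult intro!: mult_mono)
    qed (intro borel_measurable_times kM cM)
    have i2: "integrable P (\<lambda>\<zeta>. \<integral>v. G (\<zeta>, v) \<partial>?V)" by (rule integrable_fst'[OF Gi])
    have "of_real (1 - (cmod w)\<^sup>2) * z / (1 - cnj w * z) * integral\<^sup>L P (cauchy_kernel \<alpha> z)
      = (\<integral>\<zeta>. of_real (1 - (cmod w)\<^sup>2) * z / (1 - cnj w * z) * cauchy_kernel \<alpha> z \<zeta> \<partial>P)" by simp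
    also have "\<dots> = (\<integral>\<zeta>. cauchy_kernel \<alpha> z \<zeta> * c \<zeta> + (\<integral>v. G (\<zeta>, v) \<partial>?V) \<partial>P)"
      by (rule Bochner_Integration.integral_cong[OF refl eq])
    also have "\<dots> = (\<integral>\<zeta>. cauchy_kernel \<alpha> z \<zeta> * c \<zeta> \<partial>P) + (\<integral>\<zeta>. \<integral>v. G (\<zeta>, v) \<partial>?V \<partial>P)"
      by (rule Bochner_Integration.integral_add[OF i1 i2])
    also have "(\<integral>\<zeta>. \<integral>v. G (\<zeta>, v) \<partial>?V \<partial>P) = integral\<^sup>L (P \<Otimes>\<^sub>M ?V) G" by (rule integral_fst'[OF Gi])
    finally show ?thesis by (simp add: G_def[abs_def])
  qed
  then show "F_bounded \<alpha> ((2 + 2 * (\<alpha> + 1) / \<alpha>) * measure P (space P))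
    (\<lambda>z. of_real (1 - (cmod w)\<^sup>2) * z / (1 - cnj w * z) * integral\<^sup>L P (cauchy_kernel \<alpha> z))"
    using F_bounded_cong[OF F_bounded_add[OF \<alpha> F1 F2]] by (simp add: m_def distrib_right)
qed

definition blaschke_factor :: "complex \<Rightarrow> complex \<Rightarrow> complex" where
  "blaschke_factor w z = (z - w) / (1 - cnj w * z)"

text \<open>The Blaschke factor is \<open>- w\<close> plus the function of
  \<open>moebius_part_multiplier\<close>; the constant \<open>- w\<close> contributes at most 1 to
  the bound.\<close>

lemma blaschke_factor_multiplier:
  assumes "\<alpha> > 0"
  obtains C where "C \<ge> 1" "\<And>w. cmod w < 1 \<Longrightarrow> bounded_multiplier \<alpha> C (blaschke_factor w)"
proof
  define C where "C = 1 + 4 * (2 + 2 * (\<alpha> + 1) / \<alpha>)"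
  show "C \<ge> 1" using assms by (simp add: C_def)
  fix w :: complex assume w: "cmod w < 1"
  have "bounded_multiplier \<alpha> 1 (\<lambda>_. - w)"
    using bounded_multiplier_mono[OF bounded_multiplier_const[OF assms, of "- w"]] w by simp
  from bounded_multiplier_add[OF assms this moebius_part_multiplier[OF assms w]]
  show "bounded_multiplier \<alpha> C (blaschke_factor w)" unfolding C_def
  proof (rule bounded_multiplier_cong)
    fix z :: complex assume "z \<in> unit_disk"
    then have "1 - cnj w * z \<noteq> 0" using one_minus_nonpos(2)[of "cnj w" z] w by simp
    moreover have "complex_of_real (1 - (cmod w)\<^sup>2) = 1 - cnj w * w"
      by (simp only: of_real_diff complex_norm_square of_real_1 mult.commute)
    ultimately show "- w + of_real (1 - (cmod w)\<^sup>2) * z / (1 - cnj w * z) = blaschke_factor w z"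
      unfolding blaschke_factor_def by (simp add: field_simps)
  qed
qed

section \<open>Derivatives of multipliers along the sequence\<close>

lemma blaschke_factor_norm_identity:
  assumes "cmod w < 1" "cmod z < 1"
  shows "1 - (cmod (blaschke_factor w z))\<^sup>2 = (1 - (cmod w)\<^sup>2) * (1 - (cmod z)\<^sup>2) / (cmod (1 - cnj w * z))\<^sup>2"
proof -
  have "1 - cnj w * z \<noteq> 0" using one_minus_nonpos(2)[of "cnj w" z] assms by simp
  moreover have "(cmod (1 - cnj w * z))\<^sup>2 - (cmod (z - w))\<^sup>2 = (1 - (cmod w)\<^sup>2) * (1 - (cmod z)\<^sup>2)"
    by (simp only: cmod_power2) (simp add: power2_eq_square algebra_simps)
  ultimately show ?thesis
    unfolding blaschke_factor_def by (simp add: norm_divide power_divide field_simps)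
qed

lemma norm_blaschke_factor_le_1:
  assumes "cmod w < 1" "cmod z < 1" shows "cmod (blaschke_factor w z) \<le> 1"
proof -
  have "0 \<le> 1 - (cmod (blaschke_factor w z))\<^sup>2"
    unfolding blaschke_factor_norm_identity[OF assms] using assms
    by (intro divide_nonneg_nonneg mult_nonneg_nonneg) (auto simp: power_le_one)
  then show ?thesis by (metis diff_ge_0_iff_ge norm_ge_zero power_le_one_iff zero_neq_numeral)
qed

definition depth_ratio :: "complex \<Rightarrow> complex \<Rightarrow> real" where
  "depth_ratio u v = min ((1 - cmod u) / (1 - cmod v)) ((1 - cmod v) / (1 - cmod u))"

lemma depth_ratio_bounds:
  assumes "cmod u < 1" "cmod v < 1"
  shows "0 < depth_ratio u v" "depth_ratio u v \<le> 1"
proof -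
  show "0 < depth_ratio u v" using assms by (simp add: depth_ratio_def)
  show "depth_ratio u v \<le> 1"
    using assms by (cases "cmod u \<le> cmod v") (auto simp: depth_ratio_def min_le_iff_disj)
qed

text \<open>This product form has the same shape as \<open>1 - \<rho>^2\<close> in
  \<open>blaschke_factor_norm_identity\<close>, with the larger depth in place of
  \<open>|1 - cnj u * v|\<close>.\<close>

lemma depth_ratio_eq:
  assumes "cmod u < 1" "cmod v < 1"
  shows "depth_ratio u v = (1 - cmod u) * (1 - cmod v) / (max (1 - cmod u) (1 - cmod v))\<^sup>2"
proof -
  have *: "min (x / y) (y / x) = x * y / (max x y)\<^sup>2" if "0 < x" "0 < y" for x y :: real
  proof (cases "x \<le> y")
    case True
    then have "x / y \<le> 1" "1 \<le> y / x" using that by auto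
    then have "min (x / y) (y / x) = x / y" by (intro min_absorb1) linarith
    then show ?thesis using True that by (simp add: max_absorb2 power2_eq_square)
  next
    case False
    then have "y / x \<le> 1" "1 \<le> x / y" using that by auto
    then have "min (x / y) (y / x) = y / x" by (intro min_absorb2) linarith
    then show ?thesis using False that by (simp add: max_absorb1 power2_eq_square)
  qed
  show ?thesis unfolding depth_ratio_def using assms by (intro *) auto
qed

lemma stoltz_bound:
  assumes "range a \<subseteq> unit_disk" "stoltz a"
  obtains C where "C \<ge> 1" "\<And>k. cmod (1 - a k) \<le> C * (1 - cmod (a k))"
proof -
  obtain B where B: "\<And>k. cmod (1 - a k) / (1 - cmod (a k)) \<le> B"
    using assms(2) unfolding stoltz_def bdd_above_def by auto
  have a: "cmod (a k) < 1" for k using assms(1) by (auto simp: image_subset_iff)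
  show thesis
  proof (rule that[of "max 1 B"])
    fix k
    have "cmod (1 - a k) \<le> B * (1 - cmod (a k))" using B[of k] a[of k] by (simp add: divide_le_eq)
    also have "\<dots> \<le> max 1 B * (1 - cmod (a k))" using a[of k] by (intro mult_right_mono) auto
    finally show "cmod (1 - a k) \<le> max 1 B * (1 - cmod (a k))" .
  qed simp
qed

text \<open>All factors are at most 1, so dropping factors can only increase the product. The
  partial products decrease and stay nonnegative; this makes the \<open>lim\<close> in
  \<open>separation_product\<close> an actual limit and the infimum a lower bound.\<close>

lemma newman_carleson_bound:
  assumes "range a \<subseteq> unit_disk" "newman_carleson a"
  obtains \<delta> where "\<delta> > 0" "\<And>n J. finite J \<Longrightarrow> n \<notin> J \<Longrightarrow> \<delta> \<le> (\<Prod>j\<in>J. cmod (blaschke_factor (a j) (a n)))"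
proof
  have a: "cmod (a k) < 1" for k using assms(1) by (auto simp: image_subset_iff)
  define \<rho> where "\<rho> n j = cmod (blaschke_factor (a j) (a n))" for n j
  have \<rho>: "0 \<le> \<rho> n j" "\<rho> n j \<le> 1" for n j
    using norm_blaschke_factor_le_1 a by (auto simp: \<rho>_def)
  have \<rho>_eq: "cmod ((a k - a n) / (1 - cnj (a k) * a n)) = \<rho> n k" for n k
    by (simp add: \<rho>_def blaschke_factor_def norm_divide norm_minus_commute)
  define P where "P n N = (\<Prod>k\<in>{..<N} - {n}. \<rho> n k)" for n N
  have sep: "separation_product a n = lim (P n)" for n
    unfolding separation_product_def P_def \<rho>_eq ..
  have sub: "(\<Prod>k\<in>B. \<rho> n k) \<le> (\<Prod>k\<in>A. \<rho> n k)" if "A \<subseteq> B" "finite B" for A B n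
  proof -
    have "(\<Prod>k\<in>B. \<rho> n k) = (\<Prod>k\<in>B - A. \<rho> n k) * (\<Prod>k\<in>A. \<rho> n k)"
      using that by (intro prod.subset_diff)
    also have "\<dots> \<le> 1 * (\<Prod>k\<in>A. \<rho> n k)"
      using \<rho> by (intro mult_right_mono prod_le_1 prod_nonneg) auto
    finally show ?thesis by simp
  qed
  have dec: "decseq (P n)" for n unfolding P_def by (intro decseq_SucI sub) auto
  have P0: "P n N \<ge> 0" for n N unfolding P_def by (intro prod_nonneg) (simp add: \<rho>)
  have conv: "P n \<longlonglongrightarrow> lim (P n)" for n
    using decseq_convergent[OF dec, of 0 n] P0 by (metis limI)
  have "lim (P n) \<ge> 0" for n by (rule LIMSEQ_le_const[OF conv]) (use P0 in auto)
  then have bdd: "bdd_below (range (separation_product a))" by (intro bdd_belowI[of _ 0]) (auto simp: sep)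
  show "(INF n. separation_product a n) > 0" using assms(2) by (simp add: newman_carleson_def)
  fix n and J :: "nat set" assume J: "finite J" "n \<notin> J"
  obtain N where N: "J \<subseteq> {..<N}" using J(1) finite_nat_iff_bounded by blast
  have "(INF n. separation_product a n) \<le> separation_product a n" by (rule cINF_lower[OF bdd]) simp
  also have "\<dots> \<le> P n N" unfolding sep by (rule decseq_ge[OF dec conv])
  also have "\<dots> \<le> (\<Prod>j\<in>J. \<rho> n j)" unfolding P_def by (rule sub) (use N J in auto)
  finally show "(INF n. separation_product a n) \<le> (\<Prod>j\<in>J. cmod (blaschke_factor (a j) (a n)))"
    by (simp add: \<rho>_def)
qed

text \<open>For two points of the Stoltz angle, \<open>|1 - cnj u * v|\<close> is at most
  \<open>|1 - u| + |1 - v|\<close>, hence at most \<open>2 * C\<close> times the larger depth.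
  Inserting this in the formula for \<open>1 - \<rho>^2\<close> gives the comparison.\<close>

lemma depth_ratio_le:
  assumes u: "cmod u < 1" "cmod (1 - u) \<le> C * (1 - cmod u)"
    and v: "cmod v < 1" "cmod (1 - v) \<le> C * (1 - cmod v)" and C: "C \<ge> 1"
  shows "depth_ratio u v \<le> 4 * C\<^sup>2 * (1 - (cmod (blaschke_factor u v))\<^sup>2)"
proof -
  define m where "m = max (1 - cmod u) (1 - cmod v)"
  have m: "m > 0" "1 - cmod u \<le> m" "1 - cmod v \<le> m" using u by (auto simp: m_def)
  have "1 - cnj u * v = (1 - cnj u) + cnj u * (1 - v)" by (simp add: algebra_simps)
  then have "cmod (1 - cnj u * v) \<le> cmod (1 - cnj u) + cmod (cnj u * (1 - v))" by (metis norm_triangle_ineq)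
  also have "cmod (1 - cnj u) = cmod (1 - u)" by (metis complex_cnj_diff complex_cnj_one complex_mod_cnj)
  also have "cmod (cnj u * (1 - v)) \<le> cmod (1 - v)" using u by (simp add: norm_mult mult_left_le_one_le)
  also have "cmod (1 - u) + cmod (1 - v) \<le> C * m + C * m"
    using u v m C by (intro add_mono) (meson order_trans mult_left_mono zero_le_one)+
  finally have den: "cmod (1 - cnj u * v) \<le> 2 * C * m" by simp
  have nz: "cmod (1 - cnj u * v) > 0" using one_minus_nonpos(2)[of "cnj u" v] u v by simp
  have sq: "1 - cmod x \<le> 1 - (cmod x)\<^sup>2" if "cmod x < 1" for x
    using that by (simp add: power2_eq_square mult_left_le)
  have "depth_ratio u v = 4 * C\<^sup>2 * ((1 - cmod u) * (1 - cmod v) / (2 * C * m)\<^sup>2)"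
    using m C by (simp add: depth_ratio_eq[OF u(1) v(1)] m_def[symmetric] power2_eq_square)
  also have "\<dots> \<le> 4 * C\<^sup>2 * ((1 - (cmod u)\<^sup>2) * (1 - (cmod v)\<^sup>2) / (cmod (1 - cnj u * v))\<^sup>2)"
    using u v nz den C sq[OF u(1)] sq[OF v(1)]
    by (intro mult_left_mono frac_le mult_mono power_mono mult_nonneg_nonneg) (auto simp: power_le_one)
  finally show ?thesis by (simp add: blaschke_factor_norm_identity[OF u(1) v(1)])
qed

text \<open>Taking logarithms in the Newman--Carleson product bounds \<open>\<Sum>j. 1 - \<rho>\<^sub>j\<^sup>2\<close>,
  and in a Stoltz angle \<open>1 - \<rho>\<^sup>2\<close> is comparable to the ratio of the distances to the circle.\<close>
lemma depth_ratio_sum_bound: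
  assumes "range a \<subseteq> unit_disk" "newman_carleson a" "stoltz a"
  obtains L where "L \<ge> 1" "\<And>n J. finite J \<Longrightarrow> (\<Sum>j\<in>J. depth_ratio (a j) (a n)) \<le> L"
proof -
  have a: "cmod (a k) < 1" for k using assms(1) by (auto simp: image_subset_iff)
  obtain C where C: "C \<ge> 1" "\<And>k. cmod (1 - a k) \<le> C * (1 - cmod (a k))"
    using stoltz_bound[OF assms(1,3)] by metis
  obtain \<delta> where \<delta>: "\<delta> > 0" "\<And>n J. finite J \<Longrightarrow> n \<notin> J \<Longrightarrow> \<delta> \<le> (\<Prod>j\<in>J. cmod (blaschke_factor (a j) (a n)))"
    using newman_carleson_bound[OF assms(1,2)] by metis
  \<comment> \<open>The summand 1 accounts for the term \<open>j = n\<close>, which the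
    Newman-Carleson product omits.\<close>
  define L where "L = 4 * C\<^sup>2 * (2 * \<bar>ln \<delta>\<bar>) + 1"
  have *: "(\<Sum>j\<in>J. depth_ratio (a j) (a n)) \<le> 4 * C\<^sup>2 * (2 * \<bar>ln \<delta>\<bar>)" if J: "finite J" "n \<notin> J" for J n
  proof -
    define \<rho> where "\<rho> j = cmod (blaschke_factor (a j) (a n))" for j
    have pos: "\<rho> j > 0" if "j \<in> J" for j
      using \<delta>(1) \<delta>(2)[of "{j}" n] that J(2) by (cases "n = j") (auto simp: \<rho>_def)
    have "(\<Sum>j\<in>J. depth_ratio (a j) (a n)) \<le> (\<Sum>j\<in>J. 4 * C\<^sup>2 * (- (2 * ln (\<rho> j))))"
    proof (rule sum_mono)
      fix j assume j: "j \<in> J"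
      have "ln ((\<rho> j)\<^sup>2) \<le> (\<rho> j)\<^sup>2 - 1" using pos[OF j] by (intro ln_le_minus_one) simp
      moreover have "ln ((\<rho> j)\<^sup>2) = 2 * ln (\<rho> j)" using pos[OF j] by (simp add: ln_realpow)
      ultimately have "1 - (\<rho> j)\<^sup>2 \<le> - (2 * ln (\<rho> j))" by simp
      then have "4 * C\<^sup>2 * (1 - (\<rho> j)\<^sup>2) \<le> 4 * C\<^sup>2 * (- (2 * ln (\<rho> j)))" by (intro mult_left_mono) auto
      with depth_ratio_le[OF a C(2) a C(2) C(1), of j n]
      show "depth_ratio (a j) (a n) \<le> 4 * C\<^sup>2 * (- (2 * ln (\<rho> j)))" by (simp add: \<rho>_def)
    qed
    also have "\<dots> = 4 * C\<^sup>2 * (- (2 * ln (\<Prod>j\<in>J. \<rho> j)))"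
    proof -
      have "ln (\<Prod>j\<in>J. \<rho> j) = (\<Sum>j\<in>J. ln (\<rho> j))" by (rule ln_prod) (use pos J(1) in force)+
      then show ?thesis by (simp add: sum_distrib_left sum_negf)
    qed
    also have "\<dots> \<le> 4 * C\<^sup>2 * (2 * \<bar>ln \<delta>\<bar>)"
    proof -
      have "ln \<delta> \<le> ln (\<Prod>j\<in>J. \<rho> j)" using \<delta>(1) \<delta>(2)[OF J] by (simp add: \<rho>_def)
      then show ?thesis by (intro mult_left_mono) auto
    qed
    finally show ?thesis .
  qed
  show thesis
  proof (rule that[of L])
    show "L \<ge> 1" by (simp add: L_def)
    fix n and J :: "nat set" assume "finite J"
    have "(\<Sum>j\<in>J. depth_ratio (a j) (a n)) \<le> (\<Sum>j\<in>insert n (J - {n}). depth_ratio (a j) (a n))"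
      by (rule sum_mono2) (use \<open>finite J\<close> depth_ratio_bounds(1)[OF a a] in \<open>auto intro: less_imp_le\<close>)
    also have "\<dots> = depth_ratio (a n) (a n) + (\<Sum>j\<in>J - {n}. depth_ratio (a j) (a n))"
      using \<open>finite J\<close> by (subst sum.insert) auto
    also have "\<dots> \<le> L"
      using *[of "J - {n}" n] \<open>finite J\<close> depth_ratio_bounds(2)[OF a a, of n n] by (simp add: L_def)
    finally show "(\<Sum>j\<in>J. depth_ratio (a j) (a n)) \<le> L" .
  qed
qed

lemma sum_int_power_bound:
  fixes q :: real
  assumes q: "0 < q" "q < 1" and S: "finite S"
  shows "(\<Sum>l\<in>S. q ^ nat \<bar>l\<bar>) \<le> 2 / (1 - q)"
proof -
  obtain N where N: "\<And>l. l \<in> S \<Longrightarrow> nat \<bar>l\<bar> < N"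
    using finite_nat_set_iff_bounded[of "(\<lambda>l. nat \<bar>l\<bar>) ` S"] S by auto
  have sub: "S \<subseteq> int ` {..<N} \<union> (\<lambda>n. - int n) ` {..<N}"
  proof
    fix l assume l: "l \<in> S"
    show "l \<in> int ` {..<N} \<union> (\<lambda>n. - int n) ` {..<N}"
    proof (cases "l \<ge> 0")
      case True then have "l = int (nat \<bar>l\<bar>)" by simp
      then show ?thesis using N[OF l] by blast
    next
      case False then have "l = - int (nat \<bar>l\<bar>)" by simp
      then show ?thesis using N[OF l] by blast
    qed
  qed
  have geo: "(\<Sum>n<N. q ^ n) \<le> 1 / (1 - q)"
    using q sum_le_suminf[OF summable_geometric, of q "{..<N}"] by (simp add: suminf_geometric)
  have "(\<Sum>l\<in>S. q ^ nat \<bar>l\<bar>) \<le> (\<Sum>l\<in>int ` {..<N} \<union> (\<lambda>n. - int n) ` {..<N}. q ^ nat \<bar>l\<bar>)"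
    by (rule sum_mono2) (use sub q in auto)
  also have "\<dots> \<le> (\<Sum>l\<in>int ` {..<N}. q ^ nat \<bar>l\<bar>) + (\<Sum>l\<in>(\<lambda>n. - int n) ` {..<N}. q ^ nat \<bar>l\<bar>)"
    using q by (subst sum.union_inter[symmetric]) (auto intro!: sum_nonneg)
  also have "\<dots> = (\<Sum>n<N. q ^ n) + (\<Sum>n<N. q ^ n)"
    by (subst (1 2) sum.reindex) (auto simp: inj_on_def)
  finally show ?thesis using geo by simp
qed

text \<open>Sort the points by the dyadic size of \<open>(1 - |a\<^sub>j|) / t\<close>: each level contains
  boundedly many points, and the terms decay geometrically in the level.\<close>
lemma depth_sum_bound:
  assumes "range a \<subseteq> unit_disk" "newman_carleson a" "stoltz a" and \<beta>: "\<beta> > 0"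
  obtains B where "\<And>t J. t > 0 \<Longrightarrow> finite J \<Longrightarrow>
    (\<Sum>j\<in>J. min ((1 - cmod (a j)) / t) (t / (1 - cmod (a j))) powr \<beta>) \<le> B"
proof -
  have a: "cmod (a k) < 1" for k using assms(1) by (auto simp: image_subset_iff)
  obtain L where L: "L \<ge> 1" "\<And>n J. finite J \<Longrightarrow> (\<Sum>j\<in>J. depth_ratio (a j) (a n)) \<le> L"
    using depth_ratio_sum_bound[OF assms(1-3)] by metis
  define q where "q = 2 powr (- \<beta>)"
  have q: "0 < q" "q < 1" using \<beta> by (auto simp: q_def powr_less_one)
  show thesis
  proof (rule that[of "2 * L * 2 powr \<beta> * (2 / (1 - q))"])
    fix t :: real and J :: "nat set" assume t: "t > 0" and J: "finite J"
    define x where "x j = (1 - cmod (a j)) / t" for j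
    have x: "x j > 0" for j using a t by (simp add: x_def)
    define l where "l j = \<lfloor>log 2 (x j)\<rfloor>" for j
    have lx: "2 powr (of_int (l j)) \<le> x j" "x j < 2 powr (of_int (l j) + 1)" for j
      using x[of j] floor_correct[of "log 2 (x j)"] unfolding l_def
      by (auto simp: le_log_iff[symmetric] log_less_iff[symmetric] powr_le_iff less_powr_iff)
    define T where "T j = min ((1 - cmod (a j)) / t) (t / (1 - cmod (a j))) powr \<beta>" for j
    have T: "T j \<le> 2 powr \<beta> * q ^ nat \<bar>l j\<bar>" for j
    proof -
      \<comment> \<open>The extra factor 2 is lost at negative levels, where \<open>x j\<close> is
        only known to be below \<open>2 powr (l j + 1)\<close>.\<close>
      have "min (x j) (1 / x j) \<le> 2 powr (1 - of_int \<bar>l j\<bar>)"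
      proof (cases "l j \<ge> 0")
        case True
        have "1 / x j \<le> 1 / 2 powr (of_int (l j))" using lx(1)[of j] x[of j] by (intro divide_left_mono) auto
        also have "\<dots> = 2 powr (- of_int (l j))" by (simp add: powr_minus_divide)
        also have "\<dots> \<le> 2 powr (1 - of_int \<bar>l j\<bar>)" using True by (intro powr_mono) auto
        finally show ?thesis by simp
      next
        case False
        then have "2 powr (of_int (l j) + 1) \<le> (2::real) powr (1 - of_int \<bar>l j\<bar>)" by (intro powr_mono) auto
        moreover have "min (x j) (1 / x j) \<le> 2 powr (of_int (l j) + 1)"
          using lx(2)[of j] by (simp add: min_le_iff_disj)
        ultimately show ?thesis by (rule order_trans[rotated])
      qed
      then have "min (x j) (1 / x j) powr \<beta> \<le> (2 powr (1 - of_int \<bar>l j\<bar>)) powr \<beta>"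
        using x[of j] \<beta> by (intro powr_mono2) auto
      also have "\<dots> = 2 powr \<beta> * (2 powr (- \<beta>)) powr (of_nat (nat \<bar>l j\<bar>))"
        by (simp add: powr_powr powr_add[symmetric] algebra_simps)
      also have "(2 powr (- \<beta>)) powr (of_nat (nat \<bar>l j\<bar>)) = q ^ nat \<bar>l j\<bar>"
        unfolding q_def by (rule powr_realpow) simp
      finally show ?thesis by (simp add: T_def x_def)
    qed
    \<comment> \<open>Points on one level have depths within a factor 2 of each other, so their
      depth ratios are at least 1/2, and the sum of these ratios is at most
      \<open>L\<close>.\<close>
    have card: "real (card {j \<in> J. l j = i}) \<le> 2 * L" for i
    proof (cases "{j \<in> J. l j = i} = {}")
      case False
      then obtain n where n: "l n = i" by blast
      have half: "1 / 2 \<le> depth_ratio (a j) (a n)" if "l j = i" for j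
      proof -
        have "x j < 2 * x n" "x n < 2 * x j"
          using lx(1)[of j] lx(1)[of n] lx(2)[of j] lx(2)[of n] that n by (auto simp: powr_add)
        then have "1 - cmod (a j) < 2 * (1 - cmod (a n))" "1 - cmod (a n) < 2 * (1 - cmod (a j))"
          using mult_strict_right_mono[of "x j" "2 * x n" t] mult_strict_right_mono[of "x n" "2 * x j" t] t
          by (simp_all add: x_def)
        then show ?thesis using a[of j] a[of n] by (auto simp: depth_ratio_def le_divide_eq)
      qed
      have "real (card {j \<in> J. l j = i}) * (1 / 2) \<le> (\<Sum>j\<in>{j \<in> J. l j = i}. depth_ratio (a j) (a n))"
        by (rule sum_bounded_below[where 'a=real, simplified of_nat_mult]) (use half in auto)
      also have "\<dots> \<le> L" using J by (intro L) auto
      finally show ?thesis by simp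
    next
      case True
      then show ?thesis using L(1) by (simp only: card.empty)
    qed
    have "(\<Sum>j\<in>J. T j) \<le> (\<Sum>j\<in>J. 2 powr \<beta> * q ^ nat \<bar>l j\<bar>)" by (intro sum_mono T)
    also have "\<dots> = (\<Sum>i\<in>l ` J. \<Sum>j\<in>{j \<in> J. l j = i}. 2 powr \<beta> * q ^ nat \<bar>l j\<bar>)"
      by (rule sum.image_gen[OF J])
    also have "\<dots> = (\<Sum>i\<in>l ` J. real (card {j \<in> J. l j = i}) * (2 powr \<beta> * q ^ nat \<bar>i\<bar>))"
      by (intro sum.cong refl) simp
    also have "\<dots> \<le> (\<Sum>i\<in>l ` J. 2 * L * (2 powr \<beta> * q ^ nat \<bar>i\<bar>))"
      using q by (intro sum_mono mult_right_mono card) auto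
    also have "\<dots> = 2 * L * 2 powr \<beta> * (\<Sum>i\<in>l ` J. q ^ nat \<bar>i\<bar>)"
      by (simp add: sum_distrib_left mult.assoc)
    also have "\<dots> \<le> 2 * L * 2 powr \<beta> * (2 / (1 - q))"
      using J L by (intro mult_left_mono sum_int_power_bound q) auto
    finally show "(\<Sum>j\<in>J. min ((1 - cmod (a j)) / t) (t / (1 - cmod (a j))) powr \<beta>)
      \<le> 2 * L * 2 powr \<beta> * (2 / (1 - q))" by (simp add: T_def)
  qed
qed

section \<open>Differentiation of fractional Cauchy transforms and the summability estimate\<close>

lemma cauchy_kernel_has_derivative:
  assumes "cmod z < 1" "cmod \<zeta> = 1"
  shows "((\<lambda>z. cauchy_kernel \<alpha> z \<zeta>) has_field_derivative
    of_real \<alpha> * cnj \<zeta> / (1 - cnj \<zeta> * z) powr (of_real \<alpha> + 1)) (at z within S)"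
proof -
  have nz: "1 - cnj \<zeta> * z \<notin> \<real>\<^sub>\<le>\<^sub>0" using one_minus_nonpos(1)[of "cnj \<zeta>" z] assms by simp
  have eq: "cauchy_kernel \<alpha> z \<zeta> = (1 - cnj \<zeta> * z) powr (- of_real \<alpha>)" for z
    by (simp add: cauchy_kernel_def powr_minus_divide)
  have "((\<lambda>z. (1 - cnj \<zeta> * z) powr (- of_real \<alpha>)) has_field_derivative
      (- cnj \<zeta>) * (- of_real \<alpha>) * (1 - cnj \<zeta> * z) powr (- of_real \<alpha> - 1)) (at z within S)"
    using nz by (auto intro!: derivative_eq_intros simp: mult_ac)
  moreover have "(1 - cnj \<zeta> * z) powr (- of_real \<alpha> - 1) = 1 / (1 - cnj \<zeta> * z) powr (of_real \<alpha> + 1)"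
    by (simp add: powr_minus_divide[symmetric])
  ultimately show ?thesis unfolding eq by (simp add: mult_ac)
qed

text \<open>Dominated convergence of difference quotients: on the disk around \<open>z\<close> of
  half the distance to the circle, the derivative of the kernel is bounded uniformly in \<zeta>,
  which makes the quotients uniformly bounded. Measurability of the derivative in \<zeta> comes from
  its being a pointwise limit of them.\<close>

lemma cauchy_transform_has_derivative:
  assumes \<alpha>: "\<alpha> > 0" and z: "cmod z < 1" and P: "finite_measure P" "sets P = sets circle_borel"
  shows "integrable P (\<lambda>\<zeta>. of_real \<alpha> * cnj \<zeta> / (1 - cnj \<zeta> * z) powr (of_real \<alpha> + 1))"
    "((\<lambda>z. integral\<^sup>L P (cauchy_kernel \<alpha> z)) has_field_derivative
      (\<integral>\<zeta>. of_real \<alpha> * cnj \<zeta> / (1 - cnj \<zeta> * z) powr (of_real \<alpha> + 1) \<partial>P)) (at z)"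
proof -
  interpret finite_measure P by fact
  have sp: "space P = sphere 0 1" using sets_eq_imp_space_eq[OF P(2)] by simp
  have meas: "f \<in> borel_measurable P" if "f \<in> borel_measurable circle_borel" for f :: "complex \<Rightarrow> complex"
    using that by (simp add: measurable_cong_sets[OF P(2) refl])
  define D where "D z \<zeta> = of_real \<alpha> * cnj \<zeta> / (1 - cnj \<zeta> * z) powr (of_real \<alpha> + 1)" for z \<zeta>
  define r where "r = (1 - cmod z) / 2"
  have r: "r > 0" using z by (simp add: r_def)
  define B where "B = \<alpha> * r powr (- (\<alpha> + 1))"
  have ball: "cmod y < 1" "r \<le> 1 - cmod y" if "y \<in> ball z r" for y
    using that z norm_triangle_ineq2[of y z] by (auto simp: r_def dist_norm norm_minus_commute)
  have DB: "cmod (D y \<zeta>) \<le> B" if "y \<in> ball z r" "cmod \<zeta> = 1" for y \<zeta>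
  proof -
    have "r \<le> cmod (1 - cnj \<zeta> * y)"
      using norm_one_minus_ge[of "cnj \<zeta>" y] ball[OF that(1)] that(2) by simp
    then have "cmod (1 - cnj \<zeta> * y) powr (- (\<alpha> + 1)) \<le> r powr (- (\<alpha> + 1))"
      using \<alpha> r by (intro powr_mono2') auto
    moreover have "cmod (D y \<zeta>) = \<alpha> * cmod (1 - cnj \<zeta> * y) powr (- (\<alpha> + 1))"
      using \<alpha> that norm_powr_of_real[of "1 - cnj \<zeta> * y" "\<alpha> + 1"]
      by (simp only: D_def norm_divide norm_mult powr_minus_divide) simp
    ultimately show ?thesis using \<alpha> by (simp add: B_def mult_left_mono)
  qed
  have lip: "cmod (cauchy_kernel \<alpha> y \<zeta> - cauchy_kernel \<alpha> z \<zeta>) \<le> B * cmod (y - z)"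
    if "y \<in> ball z r" "cmod \<zeta> = 1" for y \<zeta>
  proof (rule field_differentiable_bound[of "ball z r"])
    show "((\<lambda>z. cauchy_kernel \<alpha> z \<zeta>) has_field_derivative D x \<zeta>) (at x within ball z r)" if "x \<in> ball z r" for x
      unfolding D_def using ball(1)[OF that] \<open>cmod \<zeta> = 1\<close> by (rule cauchy_kernel_has_derivative)
  qed (use DB that r in auto)
  have KM: "cauchy_kernel \<alpha> y \<in> borel_measurable P" if "cmod y < 1" for y
    by (rule meas[OF cauchy_kernel_measurable]) (use that in simp)
  have Ki: "integrable P (cauchy_kernel \<alpha> y)" if y: "cmod y < 1" for y
    using norm_cauchy_kernel_le[OF \<alpha> y] sp KM[OF y]
    by (intro integrable_const_bound[where B="(1 - cmod y) powr (- \<alpha>)"]) auto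
  have lim: "(\<lambda>n. \<integral>\<zeta>. (cauchy_kernel \<alpha> (X n) \<zeta> - cauchy_kernel \<alpha> z \<zeta>) / (X n - z) \<partial>P) \<longlonglongrightarrow> (\<integral>\<zeta>. D z \<zeta> \<partial>P) \<and> D z \<in> borel_measurable P"
    if X: "\<And>n. X n \<in> ball z r - {z}" "X \<longlonglongrightarrow> z" for X
  proof -
    have pt: "(\<lambda>n. (cauchy_kernel \<alpha> (X n) \<zeta> - cauchy_kernel \<alpha> z \<zeta>) / (X n - z)) \<longlonglongrightarrow> D z \<zeta>" if "cmod \<zeta> = 1" for \<zeta>
    proof -
      have "((\<lambda>y. (cauchy_kernel \<alpha> y \<zeta> - cauchy_kernel \<alpha> z \<zeta>) / (y - z)) \<longlongrightarrow> D z \<zeta>) (at z)"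
        using cauchy_kernel_has_derivative[OF z that, of \<alpha> UNIV] by (simp add: has_field_derivative_iff D_def)
      then show ?thesis
        using X unfolding tendsto_at_iff_sequentially by (auto simp: o_def)
    qed
    have m: "(\<lambda>\<zeta>. (cauchy_kernel \<alpha> (X n) \<zeta> - cauchy_kernel \<alpha> z \<zeta>) / (X n - z)) \<in> borel_measurable P" for n
      using KM[OF z] KM[OF ball(1)[of "X n"]] X(1)[of n] by (intro borel_measurable_divide borel_measurable_diff) auto
    have Dm: "D z \<in> borel_measurable P"
      by (rule borel_measurable_LIMSEQ_metric[OF m]) (use pt sp in auto)
    moreover have "(\<lambda>n. \<integral>\<zeta>. (cauchy_kernel \<alpha> (X n) \<zeta> - cauchy_kernel \<alpha> z \<zeta>) / (X n - z) \<partial>P) \<longlonglongrightarrow> (\<integral>\<zeta>. D z \<zeta> \<partial>P)"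
    proof (rule integral_dominated_convergence[where w="\<lambda>_. B"])
      show "AE \<zeta> in P. cmod ((cauchy_kernel \<alpha> (X n) \<zeta> - cauchy_kernel \<alpha> z \<zeta>) / (X n - z)) \<le> B" for n
      proof (rule AE_I2)
        fix \<zeta> assume "\<zeta> \<in> space P"
        then show "cmod ((cauchy_kernel \<alpha> (X n) \<zeta> - cauchy_kernel \<alpha> z \<zeta>) / (X n - z)) \<le> B"
          using lip[of "X n" \<zeta>] X(1)[of n] sp by (simp add: norm_divide divide_le_eq)
      qed
    qed (use pt sp m Dm in auto)
    ultimately show ?thesis by simp
  qed
  have "D z \<in> borel_measurable P"
  proof -
    \<comment> \<open>Any sequence in the punctured disk tending to \<open>z\<close> would do; the
      shift by 2 keeps already the term \<open>n = 0\<close> strictly inside radius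
      \<open>r\<close>.\<close>
    have "(\<lambda>n. z + of_real (r / real (n + 2))) \<longlonglongrightarrow> z + of_real 0"
      by (intro tendsto_intros LIMSEQ_ignore_initial_segment[of "\<lambda>n. r / real n"] lim_const_over_n)
    moreover have "z + of_real (r / real (n + 2)) \<in> ball z r - {z}" for n
    proof -
      have "0 < r / real (n + 2)" "r / real (n + 2) < r" using r by (auto simp: divide_less_eq)
      then show ?thesis by (simp add: dist_norm del: of_real_divide of_nat_add)
    qed
    ultimately show ?thesis using lim[of "\<lambda>n. z + of_real (r / real (n + 2))"] by simp
  qed
  then show "integrable P (\<lambda>\<zeta>. of_real \<alpha> * cnj \<zeta> / (1 - cnj \<zeta> * z) powr (of_real \<alpha> + 1))"
    unfolding D_def[symmetric] using DB[of z] sp r by (intro integrable_const_bound[where B=B]) auto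
  show "((\<lambda>z. integral\<^sup>L P (cauchy_kernel \<alpha> z)) has_field_derivative
      (\<integral>\<zeta>. of_real \<alpha> * cnj \<zeta> / (1 - cnj \<zeta> * z) powr (of_real \<alpha> + 1) \<partial>P)) (at z)"
    unfolding has_field_derivative_iff D_def[symmetric] tendsto_at_iff_sequentially
  proof (intro allI impI)
    fix X :: "nat \<Rightarrow> complex" assume X: "\<forall>i. X i \<in> UNIV - {z}" "X \<longlonglongrightarrow> z"
    obtain N where N: "\<And>n. n \<ge> N \<Longrightarrow> X n \<in> ball z r"
      using X(2) r unfolding lim_sequentially by (auto simp: dist_commute)
    define Y where "Y n = X (n + N)" for n
    have Y: "Y n \<in> ball z r - {z}" "Y \<longlonglongrightarrow> z" for n
      using X N LIMSEQ_ignore_initial_segment[OF X(2), of N] by (auto simp: Y_def[abs_def])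
    have "(\<integral>\<zeta>. (cauchy_kernel \<alpha> (Y n) \<zeta> - cauchy_kernel \<alpha> z \<zeta>) / (Y n - z) \<partial>P)
      = (integral\<^sup>L P (cauchy_kernel \<alpha> (Y n)) - integral\<^sup>L P (cauchy_kernel \<alpha> z)) / (Y n - z)" for n
      using Ki[OF ball(1)[of "Y n"]] Ki[OF z] Y(1)[of n] by (simp add: Bochner_Integration.integral_diff)
    then have "(\<lambda>n. (integral\<^sup>L P (cauchy_kernel \<alpha> (Y n)) - integral\<^sup>L P (cauchy_kernel \<alpha> z)) / (Y n - z))
      \<longlonglongrightarrow> integral\<^sup>L P (D z)"
      using conjunct1[OF lim[OF Y]] by (simp only:)
    then show "((\<lambda>y. (integral\<^sup>L P (cauchy_kernel \<alpha> y) - integral\<^sup>L P (cauchy_kernel \<alpha> z)) / (y - z)) \<circ> X)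
      \<longlonglongrightarrow> integral\<^sup>L P (D z)"
      unfolding Y_def o_def by (rule LIMSEQ_offset)
  qed
qed

text \<open>Represented by the unit point mass at 1, the vertex of the Stoltz angle.\<close>

lemma cauchy_kernel_F_bounded:
  assumes "\<alpha> > 0" shows "F_bounded \<alpha> 1 (\<lambda>z. cauchy_kernel \<alpha> z 1)"
  by (rule F_bounded_pushforward[OF assms, of "\<lambda>_. 1" "count_space {()}" "\<lambda>_. 1"])
    (auto simp: integrable_count_space lebesgue_integral_count_space_finite)

text \<open>Put \<open>d = 1 - |a|\<close> and \<open>t = |1 - \<zeta>|\<close>. The Stoltz
  condition gives \<open>|1 - cnj \<zeta> * a|\<close> at least \<open>max d t / (1 + C)\<close>, so
  the left side is at most a constant times
  \<open>d powr \<alpha> * t / max d t powr (\<alpha> + 1)\<close>. This is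
  \<open>(d / t) powr \<alpha>\<close> when \<open>d\<close> is the smaller number and
  \<open>t / d\<close> otherwise, whence the exponent \<open>min \<alpha> 1\<close>.\<close>

lemma multiplier_deriv_bound:
  assumes a: "cmod a < 1" "cmod (1 - a) \<le> C * (1 - cmod a)" and C: "C \<ge> 1"
    and \<alpha>: "\<alpha> > 0" and \<zeta>: "cmod \<zeta> = 1" "\<zeta> \<noteq> 1"
  shows "cmod (of_real \<alpha> * (1 - a) powr (of_real \<alpha> - 1) * (cnj \<zeta> - 1) / (1 - cnj \<zeta> * a) powr (of_real \<alpha> + 1))
      * (1 - (cmod a)\<^sup>2) \<le> 2 * \<alpha> * C powr \<alpha> * (1 + C) powr (\<alpha> + 1) *
      min ((1 - cmod a) / cmod (1 - \<zeta>)) (cmod (1 - \<zeta>) / (1 - cmod a)) powr (min \<alpha> 1)"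
proof -
  define d where "d = 1 - cmod a"
  define t where "t = cmod (1 - \<zeta>)"
  define R where "R = cmod (1 - cnj \<zeta> * a)"
  have d: "d > 0" and t: "t > 0" using a \<zeta> by (auto simp: d_def t_def)
  have dR: "d \<le> R" using norm_one_minus_ge[of "cnj \<zeta>" a] a \<zeta> by (simp add: d_def R_def)
  have "R = cmod (\<zeta> - a)"
  proof -
    have "cnj \<zeta> * \<zeta> = 1" using \<zeta> by (metis complex_norm_square mult.commute of_real_1 one_power2)
    then have "1 - cnj \<zeta> * a = cnj \<zeta> * (\<zeta> - a)" by (simp add: algebra_simps)
    then show ?thesis using \<zeta> by (simp add: R_def norm_mult)
  qed
  moreover have "t \<le> cmod (1 - a) + cmod (\<zeta> - a)"
    unfolding t_def by (metis norm_minus_commute norm_diff_triangle_ineq norm_triangle_ineq diff_add_cancel add_diff_eq)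
  ultimately have "t \<le> C * R + R"
    using a(2)[folded d_def] mult_left_mono[OF dR, of C] C by linarith
  then have tR: "t \<le> (1 + C) * R" by (simp add: algebra_simps)
  have "1 * d \<le> (1 + C) * R" using dR C d by (intro mult_mono) auto
  then have mR: "max d t / (1 + C) \<le> R" using tR C by (simp add: divide_le_eq mult.commute)
  define m where "m = max d t"
  have m: "m > 0" using d by (simp add: m_def)
  \<comment> \<open>The sign of the exponent decides which estimate of \<open>|1 - a|\<close> is
    used: the Stoltz bound from above for \<open>\<alpha> \<ge> 1\<close>, and the trivial bound
    \<open>d\<close> from below for \<open>\<alpha> < 1\<close>.\<close>
  have p1: "cmod (1 - a) powr (\<alpha> - 1) \<le> C powr \<alpha> * d powr (\<alpha> - 1)"
  proof (cases "\<alpha> \<ge> 1")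
    case True
    have "cmod (1 - a) powr (\<alpha> - 1) \<le> (C * d) powr (\<alpha> - 1)"
      using True a by (intro powr_mono2) (auto simp: d_def)
    also have "\<dots> = C powr (\<alpha> - 1) * d powr (\<alpha> - 1)" using C d by (simp add: powr_mult)
    also have "\<dots> \<le> C powr \<alpha> * d powr (\<alpha> - 1)" using C by (intro mult_right_mono powr_mono) auto
    finally show ?thesis .
  next
    case False
    have "d \<le> cmod (1 - a)" unfolding d_def using norm_triangle_ineq2[of 1 a] by simp
    then have "cmod (1 - a) powr (\<alpha> - 1) \<le> 1 * d powr (\<alpha> - 1)" using False d by (simp add: powr_mono2')
    also have "\<dots> \<le> C powr \<alpha> * d powr (\<alpha> - 1)"
      using C \<alpha> by (intro mult_right_mono) (auto simp: ge_one_powr_ge_zero)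
    finally show ?thesis .
  qed
  have p2: "R powr (- (\<alpha> + 1)) \<le> (1 + C) powr (\<alpha> + 1) * m powr (- (\<alpha> + 1))"
  proof -
    have "R powr (- (\<alpha> + 1)) \<le> (m / (1 + C)) powr (- (\<alpha> + 1))"
      using mR m C \<alpha> by (intro powr_mono2') (auto simp: m_def)
    also have "\<dots> = (1 + C) powr (\<alpha> + 1) * m powr (- (\<alpha> + 1))"
      using m C by (simp only: powr_divide powr_minus) (simp add: field_simps)
    finally show ?thesis .
  qed
  have sq: "1 - (cmod a)\<^sup>2 \<le> 2 * d"
  proof -
    have "1 - (cmod a)\<^sup>2 = (1 + cmod a) * d" by (simp add: d_def power2_eq_square algebra_simps)
    also have "\<dots> \<le> 2 * d" using d a by (intro mult_right_mono) auto
    finally show ?thesis .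
  qed
  have tc: "cmod (cnj \<zeta> - 1) = t"
    unfolding t_def by (metis complex_cnj_diff complex_cnj_one complex_mod_cnj norm_minus_commute)
  have "cmod (of_real \<alpha> * (1 - a) powr (of_real \<alpha> - 1) * (cnj \<zeta> - 1) / (1 - cnj \<zeta> * a) powr (of_real \<alpha> + 1))
    = \<alpha> * cmod (1 - a) powr (\<alpha> - 1) * t * R powr (- (\<alpha> + 1))"
    using \<alpha> norm_powr_of_real[of "1 - a" "\<alpha> - 1"] norm_powr_of_real[of "1 - cnj \<zeta> * a" "\<alpha> + 1"]
    by (simp only: norm_mult norm_divide tc R_def powr_minus_divide) simp
  also have "\<dots> * (1 - (cmod a)\<^sup>2) \<le> (\<alpha> * (C powr \<alpha> * d powr (\<alpha> - 1)) * t * ((1 + C) powr (\<alpha> + 1) * m powr (- (\<alpha> + 1)))) * (2 * d)"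
    using \<alpha> t p1 p2 sq d a(1) by (intro mult_mono mult_nonneg_nonneg) (auto simp: power_le_one)
  also have "\<dots> = 2 * \<alpha> * C powr \<alpha> * (1 + C) powr (\<alpha> + 1) * (d powr \<alpha> * t * m powr (- (\<alpha> + 1)))"
    using d by (simp add: powr_diff)
  also have "d powr \<alpha> * t * m powr (- (\<alpha> + 1)) \<le> min (d / t) (t / d) powr (min \<alpha> 1)"
  proof (cases "d \<le> t")
    case True
    have "d powr \<alpha> * t * m powr (- (\<alpha> + 1)) = (d / t) powr \<alpha>"
    proof -
      have "t powr (- (\<alpha> + 1)) = 1 / (t powr \<alpha> * t)"
        using t by (simp only: powr_minus_divide powr_add) simp
      moreover have "m = t" using True by (simp add: m_def)
      ultimately show ?thesis using d t by (simp add: powr_divide)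
    qed
    also have "\<dots> \<le> (d / t) powr (min \<alpha> 1)" using True d t by (intro powr_mono') auto
    also have "d / t = min (d / t) (t / d)"
    proof -
      have "d / t \<le> 1" "1 \<le> t / d" using True d t by auto
      then show ?thesis by simp
    qed
    finally show ?thesis .
  next
    case False
    have "d powr \<alpha> * t * m powr (- (\<alpha> + 1)) = (t / d) powr 1"
    proof -
      have "d powr (- (\<alpha> + 1)) = 1 / (d powr \<alpha> * d)"
        using d by (simp only: powr_minus_divide powr_add) simp
      moreover have "m = d" using False by (simp add: m_def)
      ultimately show ?thesis using d t by simp
    qed
    also have "\<dots> \<le> (t / d) powr (min \<alpha> 1)" using False d t by (intro powr_mono') auto
    also have "t / d = min (d / t) (t / d)"
    proof -
      have "t / d \<le> 1" "1 \<le> d / t" using False d t by auto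
      then show ?thesis by simp
    qed
    finally show ?thesis .
  qed
  finally show ?thesis
    using \<alpha> C by (simp add: d_def t_def mult_left_mono)
qed

text \<open>Testing the multiplier on the kernel at the point 1 gives
  \<open>f z = (1 - z)\<^sup>\<alpha> \<integral> (1 - cnj \<zeta> * z)\<^sup>-\<^sup>\<alpha> d\<mu>(\<zeta>)\<close>.\<close>
lemma multiplier_deriv_summable:
  assumes \<alpha>: "\<alpha> > 0" and "range a \<subseteq> unit_disk" "newman_carleson a" "stoltz a" and f: "f \<in> multipliers \<alpha>"
  shows "summable (\<lambda>k. cmod (deriv f (a k) * (1 - complex_of_real ((cmod (a k))\<^sup>2))))"
proof -
  have a: "cmod (a k) < 1" for k using assms(2) by (auto simp: image_subset_iff)
  obtain C where C: "C \<ge> 1" "\<And>k. cmod (1 - a k) \<le> C * (1 - cmod (a k))"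
    using stoltz_bound[OF assms(2,4)] by metis
  define \<beta> where "\<beta> = min \<alpha> 1"
  have \<beta>: "\<beta> > 0" using \<alpha> by (simp add: \<beta>_def)
  obtain B where B: "\<And>t J. t > 0 \<Longrightarrow> finite J \<Longrightarrow>
    (\<Sum>j\<in>J. min ((1 - cmod (a j)) / t) (t / (1 - cmod (a j))) powr \<beta>) \<le> B"
    by (rule depth_sum_bound[OF assms(2-4) \<beta>]) (rule that)
  have "(\<lambda>z. f z * cauchy_kernel \<alpha> z 1) \<in> F_family \<alpha>"
    using f cauchy_kernel_F_bounded[OF \<alpha>] by (auto simp: multipliers_def F_family_iff)
  then obtain D where "F_bounded \<alpha> D (\<lambda>z. f z * cauchy_kernel \<alpha> z 1)" by (auto simp: F_family_iff)
  then obtain \<mu> where \<mu>: "complex_measure_on circle_borel \<mu>"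
    and f\<mu>: "\<And>z. cmod z < 1 \<Longrightarrow> f z * cauchy_kernel \<alpha> z 1 = complex_measure_integral circle_borel \<mu> (cauchy_kernel \<alpha> z)"
    unfolding F_bounded_def by auto
  define P where "P = Jordan_part circle_borel \<mu>"
  have P: "finite_measure (P j)" "sets (P j) = sets circle_borel" "space (P j) = sphere 0 1" for j
    using finite_measure_Jordan_part[OF \<mu>] by (auto simp: P_def)
  have nz1: "1 - z \<notin> \<real>\<^sub>\<le>\<^sub>0" "1 - z \<noteq> 0" if "cmod z < 1" for z
    using one_minus_nonpos[of 1 z] that by auto
  have fz: "f z = (1 - z) powr of_real \<alpha> * (\<Sum>j<4. \<i> ^ j * integral\<^sup>L (P j) (cauchy_kernel \<alpha> z))" if "cmod z < 1" for z
    using f\<mu>[OF that] nz1[OF that]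
    by (simp add: complex_measure_integral_Jordan P_def cauchy_kernel_def powr_eq_0_iff divide_eq_eq mult.commute)
  \<comment> \<open>The derivative in \<open>z\<close> of
    \<open>((1 - z) / (1 - cnj \<zeta> * z)) powr \<alpha>\<close>, understood as a quotient of
    powers. The two terms of the product rule combine through \<open>cnj \<zeta> * (1 - z) - (1 -
    cnj \<zeta> * z) = cnj \<zeta> - 1\<close>. The cancellation is essential: at
    \<open>\<zeta> = 1\<close> each term alone, times \<open>1 - |a k|^2\<close>, stays bounded away
    from 0 along the sequence.\<close>
  define E where "E z \<zeta> = of_real \<alpha> * (1 - z) powr (of_real \<alpha> - 1) * (cnj \<zeta> - 1) / (1 - cnj \<zeta> * z) powr (of_real \<alpha> + 1)" for z \<zeta>
  have df: "integrable (P j) (E z) \<and> deriv f z = (\<Sum>j<4. \<i> ^ j * (\<integral>\<zeta>. E z \<zeta> \<partial>P j))" if z: "cmod z < 1" for z j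
  proof -
    define D where "D \<zeta> = of_real \<alpha> * cnj \<zeta> / (1 - cnj \<zeta> * z) powr (of_real \<alpha> + 1)" for \<zeta>
    have Di: "integrable (P j) D" and
      dG: "((\<lambda>z. integral\<^sup>L (P j) (cauchy_kernel \<alpha> z)) has_field_derivative (\<integral>\<zeta>. D \<zeta> \<partial>P j)) (at z)" for j
      unfolding D_def using cauchy_transform_has_derivative[OF \<alpha> z P(1,2)] by auto
    have Ki: "integrable (P j) (cauchy_kernel \<alpha> z)" for j
    proof -
      interpret finite_measure "P j" by (rule P(1))
      have "cauchy_kernel \<alpha> z \<in> borel_measurable (P j)"
        using cauchy_kernel_measurable[of z \<alpha>] z by (simp add: measurable_cong_sets[OF P(2) refl])
      then show ?thesis using norm_cauchy_kernel_le[OF \<alpha> z] P(3)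
        by (intro integrable_const_bound[where B="(1 - cmod z) powr (- \<alpha>)"]) auto
    qed
    have dp: "((\<lambda>z. (1 - z) powr of_real \<alpha>) has_field_derivative - (of_real \<alpha> * (1 - z) powr (of_real \<alpha> - 1))) (at z)"
      using nz1[OF z] by (auto intro!: derivative_eq_intros)
    have p: "(1 - z) powr of_real \<alpha> = (1 - z) powr (of_real \<alpha> - 1) * (1 - z)"
      using nz1[OF z] by (simp add: powr_diff)
    have E_eq: "E z \<zeta> = (1 - z) powr of_real \<alpha> * D \<zeta> - of_real \<alpha> * (1 - z) powr (of_real \<alpha> - 1) * cauchy_kernel \<alpha> z \<zeta>"
      if "\<zeta> \<in> space (P j)" for \<zeta> j
    proof -
      have nz: "1 - cnj \<zeta> * z \<noteq> 0" using one_minus_nonpos(2)[of "cnj \<zeta>" z] that z P(3) by simp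
      then have "cauchy_kernel \<alpha> z \<zeta> = (1 - cnj \<zeta> * z) / (1 - cnj \<zeta> * z) powr (of_real \<alpha> + 1)"
        by (simp add: cauchy_kernel_def powr_add)
      then show ?thesis unfolding E_def D_def p by (simp add: algebra_simps diff_divide_distrib[symmetric] add_divide_distrib[symmetric])
    qed
    have Ei: "integrable (P j) (E z)" for j
      by (rule iffD2[OF Bochner_Integration.integrable_cong[OF refl E_eq[of _ j]]])
        (assumption, intro Bochner_Integration.integrable_diff integrable_mult_right Di Ki)
    have EI: "(\<integral>\<zeta>. E z \<zeta> \<partial>P j) = (1 - z) powr of_real \<alpha> * (\<integral>\<zeta>. D \<zeta> \<partial>P j)
        - of_real \<alpha> * (1 - z) powr (of_real \<alpha> - 1) * integral\<^sup>L (P j) (cauchy_kernel \<alpha> z)" for j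
      by (subst Bochner_Integration.integral_cong[OF refl E_eq[of _ j]], assumption,
          subst Bochner_Integration.integral_diff) (auto intro!: Di Ki)
    have "((\<lambda>z. (1 - z) powr of_real \<alpha> * (\<Sum>j<4. \<i> ^ j * integral\<^sup>L (P j) (cauchy_kernel \<alpha> z))) has_field_derivative
       (1 - z) powr of_real \<alpha> * (\<Sum>j<4. \<i> ^ j * (\<integral>\<zeta>. D \<zeta> \<partial>P j)) +
       - (of_real \<alpha> * (1 - z) powr (of_real \<alpha> - 1)) * (\<Sum>j<4. \<i> ^ j * integral\<^sup>L (P j) (cauchy_kernel \<alpha> z))) (at z)"
      using DERIV_mult'[OF dp DERIV_sum[OF DERIV_cmult[OF dG]]] by simp
    then have "(f has_field_derivative
       (1 - z) powr of_real \<alpha> * (\<Sum>j<4. \<i> ^ j * (\<integral>\<zeta>. D \<zeta> \<partial>P j)) +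
       - (of_real \<alpha> * (1 - z) powr (of_real \<alpha> - 1)) * (\<Sum>j<4. \<i> ^ j * integral\<^sup>L (P j) (cauchy_kernel \<alpha> z))) (at z)"
      by (rule has_field_derivative_transform_within_open[of _ _ _ "ball 0 1"]) (use z fz in auto)
    from DERIV_imp_deriv[OF this] have "deriv f z = (\<Sum>j<4. \<i> ^ j * (\<integral>\<zeta>. E z \<zeta> \<partial>P j))"
      unfolding EI by (simp add: sum_distrib_left sum_subtractf sum_negf right_diff_distrib mult_ac)
    with Ei show ?thesis by blast
  qed
  define M where "M = 2 * \<alpha> * C powr \<alpha> * (1 + C) powr (\<alpha> + 1)"
  have M: "M \<ge> 0" using \<alpha> by (simp add: M_def)
  define s where "s k = 1 - (cmod (a k))\<^sup>2" for k
  have s: "s k \<ge> 0" for k using a[of k] by (simp add: s_def power_le_one)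
  have B0: "B \<ge> 0" using B[of 1 "{}"] by simp
  \<comment> \<open>\<open>depth_sum_bound\<close> is applied with \<open>t = |1 - \<zeta>|\<close>,
    so the bound does not depend on \<zeta>; at \<open>\<zeta> = 1\<close>, where no such
    \<open>t\<close> is available, the factor \<open>cnj \<zeta> - 1\<close> makes all terms
    vanish.\<close>
  have pt: "(\<Sum>k\<in>J. cmod (E (a k) \<zeta>) * s k) \<le> M * B" if "finite J" "cmod \<zeta> = 1" for J \<zeta>
  proof (cases "\<zeta> = 1")
    case True then show ?thesis using M B0 by (simp add: E_def)
  next
    case False
    have "(\<Sum>k\<in>J. cmod (E (a k) \<zeta>) * s k)
      \<le> (\<Sum>k\<in>J. M * min ((1 - cmod (a k)) / cmod (1 - \<zeta>)) (cmod (1 - \<zeta>) / (1 - cmod (a k))) powr \<beta>)"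
      unfolding E_def s_def M_def \<beta>_def
      by (intro sum_mono multiplier_deriv_bound a C \<alpha> that False)
    also have "\<dots> \<le> M * B"
      unfolding sum_distrib_left[symmetric] using False that M by (intro mult_left_mono B) auto
    finally show ?thesis .
  qed
  show ?thesis
  proof (rule summableI_nonneg_bounded)
    fix n
    have "(\<Sum>k<n. cmod (deriv f (a k) * (1 - complex_of_real ((cmod (a k))\<^sup>2)))) = (\<Sum>k<n. cmod (deriv f (a k)) * s k)"
    proof (intro sum.cong refl)
      fix k
      have "1 - complex_of_real ((cmod (a k))\<^sup>2) = of_real (s k)" by (simp add: s_def)
      then show "cmod (deriv f (a k) * (1 - complex_of_real ((cmod (a k))\<^sup>2))) = cmod (deriv f (a k)) * s k"
        using s[of k] by (simp only: norm_mult norm_of_real abs_of_nonneg)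
    qed
    also have "\<dots> \<le> (\<Sum>k<n. (\<Sum>j<4::nat. \<integral>\<zeta>. cmod (E (a k) \<zeta>) \<partial>P j) * s k)"
    proof (intro sum_mono mult_right_mono s)
      fix k
      have "cmod (\<i> ^ j * (\<integral>\<zeta>. E (a k) \<zeta> \<partial>P j)) \<le> (\<integral>\<zeta>. cmod (E (a k) \<zeta>) \<partial>P j)" for j
        using integral_norm_bound[of "P j" "E (a k)"] by (simp add: norm_mult norm_power)
      then show "cmod (deriv f (a k)) \<le> (\<Sum>j<4::nat. \<integral>\<zeta>. cmod (E (a k) \<zeta>) \<partial>P j)"
        unfolding conjunct2[OF df[OF a]] by (intro sum_norm_le)
    qed
    also have "\<dots> = (\<Sum>j<4::nat. \<integral>\<zeta>. (\<Sum>k<n. cmod (E (a k) \<zeta>) * s k) \<partial>P j)"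
      using conjunct1[OF df[OF a]]
      by (subst Bochner_Integration.integral_sum) (auto simp: sum_distrib_right intro: sum.swap)
    \<comment> \<open>Summing before integrating is what gives a bound independent of
      \<open>n\<close>: the pointwise bound is integrated against four finite measures.\<close>
    also have "\<dots> \<le> (\<Sum>j<4::nat. \<integral>\<zeta>. M * B \<partial>P j)"
    proof (intro sum_mono integral_mono)
      fix j
      interpret finite_measure "P j" by (rule P(1))
      show "integrable (P j) (\<lambda>\<zeta>. M * B)" by simp
    qed (use conjunct1[OF df[OF a]] pt P(3) in \<open>auto intro!: Bochner_Integration.integrable_sum integrable_mult_left\<close>)
    finally show "(\<Sum>k<n. cmod (deriv f (a k) * (1 - complex_of_real ((cmod (a k))\<^sup>2)))) \<le> (\<Sum>j<4::nat. \<integral>\<zeta>. M * B \<partial>P j)" .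
  qed simp
qed

section \<open>Interpolation\<close>

text \<open>Cauchy's estimate on the disk of radius \<open>r = (1 - |z|) / 2\<close>, combined with
  \<open>1 - |z|^2 \<le> 4 * r\<close>.\<close>

lemma norm_deriv_unit_disk_le:
  assumes f: "f holomorphic_on unit_disk" and M: "\<And>z. cmod z < 1 \<Longrightarrow> cmod (f z) \<le> M" and z: "cmod z < 1"
  shows "cmod (deriv f z) * (1 - (cmod z)\<^sup>2) \<le> 4 * M"
proof -
  define r where "r = (1 - cmod z) / 2"
  have r: "r > 0" using z by (simp add: r_def)
  have sub: "cball z r \<subseteq> unit_disk"
  proof
    fix y assume "y \<in> cball z r"
    then have "cmod y \<le> cmod z + r" using norm_triangle_ineq2[of y z] by (simp add: dist_norm norm_minus_commute)
    also have "cmod z + r < 1" using z by (simp add: r_def field_simps)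
    finally have "cmod y < 1" .
    then show "y \<in> unit_disk" by simp
  qed
  have "cmod ((deriv ^^ 1) f z) \<le> fact 1 * M / r ^ 1"
  proof (rule Cauchy_inequality[OF _ _ r])
    show "f holomorphic_on ball z r" by (rule holomorphic_on_subset[OF f]) (use sub ball_subset_cball in blast)
    show "continuous_on (cball z r) f"
      by (rule continuous_on_subset[OF holomorphic_on_imp_continuous_on[OF f] sub])
    fix x assume "cmod (z - x) = r"
    then have "x \<in> unit_disk" using sub by (auto simp: dist_norm subset_eq)
    then show "cmod (f x) \<le> M" by (intro M) simp
  qed
  then have "cmod (deriv f z) * r \<le> M" using r by (simp add: le_divide_eq)
  moreover have "1 - (cmod z)\<^sup>2 = (1 + cmod z) * (2 * r)" by (simp add: r_def power2_eq_square algebra_simps)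
  then have "1 - (cmod z)\<^sup>2 \<le> 2 * (2 * r)" using z r by (simp add: mult_right_mono)
  then have "cmod (deriv f z) * (1 - (cmod z)\<^sup>2) \<le> cmod (deriv f z) * (2 * (2 * r))"
    by (intro mult_left_mono) auto
  ultimately show ?thesis by simp
qed

text \<open>Two kinds of bounds are summed side by side: the \<open>c k\<close> yield the multiplier
  bound by adding representing measures, the \<open>s k\<close> yield uniform convergence on the
  disk and hence termwise differentiation.\<close>

lemma multiplier_series:
  assumes \<alpha>: "\<alpha> > 0" and mult: "\<And>k. bounded_multiplier \<alpha> (c k) (\<phi> k)" and hol: "\<And>k. \<phi> k holomorphic_on unit_disk"
    and bound: "\<forall>k. \<forall>z\<in>unit_disk. cmod (\<phi> k z) \<le> s k" and c: "summable c" and s: "summable s"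
  shows "bounded_multiplier \<alpha> (suminf c) (\<lambda>z. \<Sum>k. \<phi> k z)"
    "(\<lambda>z. \<Sum>k. \<phi> k z) holomorphic_on unit_disk"
    "\<And>z. cmod z < 1 \<Longrightarrow> cmod (\<Sum>k. \<phi> k z) \<le> suminf s"
    "\<And>z. cmod z < 1 \<Longrightarrow> (\<lambda>k. deriv (\<phi> k) z) sums deriv (\<lambda>z. \<Sum>k. \<phi> k z) z"
proof -
  have bd: "cmod (\<phi> k z) \<le> s k" if "cmod z < 1" for k z using bound that by simp
  have sm: "summable (\<lambda>k. \<phi> k z)" "summable (\<lambda>k. cmod (\<phi> k z))" if "cmod z < 1" for z
    by (rule summable_comparison_test'[OF s], use bd[OF that] in simp)+
  have hd: "(\<phi> k has_field_derivative deriv (\<phi> k) z) (at z)" if "z \<in> unit_disk" for k z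
    by (rule holomorphic_derivI[OF hol open_ball that])
  have ev: "\<forall>\<^sub>F k in sequentially. \<forall>z\<in>unit_disk. norm (\<phi> k z) \<le> s k" using bd by simp
  obtain g g' where g: "\<forall>z\<in>unit_disk. (\<lambda>k. \<phi> k z) sums g z \<and> (\<lambda>k. deriv (\<phi> k) z) sums g' z \<and> (g has_field_derivative g' z) (at z)"
    by (rule series_and_derivative_comparison[OF open_ball s hd ev]) (assumption, rule that)
  have gd: "((\<lambda>z. \<Sum>k. \<phi> k z) has_field_derivative g' z) (at z)" if "z \<in> unit_disk" for z
    by (rule has_field_derivative_transform_within_open[of g _ _ unit_disk]) (use g that in \<open>auto simp: sums_iff\<close>)
  show "(\<lambda>z. \<Sum>k. \<phi> k z) holomorphic_on unit_disk"
    unfolding holomorphic_on_open[OF open_ball] using gd by blast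
  show "(\<lambda>k. deriv (\<phi> k) z) sums deriv (\<lambda>z. \<Sum>k. \<phi> k z) z" if "cmod z < 1" for z
    using bspec[OF g, of z] DERIV_imp_deriv[OF gd[of z]] that by simp
  show "cmod (\<Sum>k. \<phi> k z) \<le> suminf s" if "cmod z < 1" for z
    using suminf_le[OF bd[OF that] sm(2)[OF that] s] summable_norm[OF sm(2)[OF that]] by linarith
  show "bounded_multiplier \<alpha> (suminf c) (\<lambda>z. \<Sum>k. \<phi> k z)"
    unfolding bounded_multiplier_def
  proof (intro conjI allI impI)
    show "0 \<le> suminf c" using mult by (intro suminf_nonneg c) (auto simp: bounded_multiplier_def)
    fix D h assume h: "F_bounded \<alpha> D h"
    have "F_bounded \<alpha> (\<Sum>k. c k * D) (\<lambda>z. \<Sum>k. \<phi> k z * h z)"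
      by (intro F_bounded_suminf \<alpha> bounded_multiplierD[OF mult h] summable_mult2 c)
    then have "F_bounded \<alpha> (suminf c * D) (\<lambda>z. \<Sum>k. \<phi> k z * h z)" by (simp add: suminf_mult2[OF c])
    then show "F_bounded \<alpha> (suminf c * D) (\<lambda>z. (\<Sum>k. \<phi> k z) * h z)"
      by (rule F_bounded_cong) (simp add: suminf_mult2[OF sm(1)])
  qed
qed

text \<open>In a Stoltz angle this peaks at the points of depth comparable to that of
  \<open>w\<close>: the factor \<open>1 - z\<close> makes it small at points much closer to the
  vertex 1, and \<open>1 - |w|^2\<close> over the square makes it small at points much farther from
  it.\<close>

definition localizer :: "complex \<Rightarrow> complex \<Rightarrow> complex" where
  "localizer w z = (1 - z) * (1 - of_real ((cmod w)\<^sup>2)) / (1 - cnj w * z)\<^sup>2"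

lemma blaschke_factor_holomorphic: "cmod w < 1 \<Longrightarrow> blaschke_factor w holomorphic_on unit_disk"
  unfolding blaschke_factor_def using one_minus_nonpos(2)[of "cnj w"]
  by (intro holomorphic_intros) auto

text \<open>Both \<open>(1 - |w|^2) / (1 - cnj w * z)\<close> and
  \<open>(1 - z) / (1 - cnj w * z)\<close> are affine in the Blaschke factor. The localizer is
  therefore a quadratic polynomial in it, with coefficients bounded by the Stoltz constant, and
  inherits bounds uniform in \<open>w\<close>. The number \<open>A\<close> is its value at
  \<open>w\<close>.\<close>

lemma localizer_eq:
  assumes w: "cmod w < 1" and z: "cmod z < 1"
  defines "A \<equiv> (1 - w) / (1 - of_real ((cmod w)\<^sup>2))"
  shows "localizer w z = (1 + cnj w * blaschke_factor w z) * (A + (A * cnj w - 1) * blaschke_factor w z)"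
proof -
  define d where "d = 1 - complex_of_real ((cmod w)\<^sup>2)"
  have q: "1 - cnj w * z \<noteq> 0" using one_minus_nonpos(2)[of "cnj w" z] w z by simp
  have d: "d = 1 - cnj w * w" by (simp only: d_def complex_norm_square mult.commute)
  have "(cmod w)\<^sup>2 < 1" using w by (simp add: power_less_one_iff)
  then have "1 - (cmod w)\<^sup>2 \<noteq> 0" by simp
  then have d0: "d \<noteq> 0" unfolding d_def by (metis of_real_1 of_real_diff of_real_eq_0_iff)
  have 1: "1 + cnj w * blaschke_factor w z = d / (1 - cnj w * z)"
    using q unfolding d blaschke_factor_def by (simp add: field_simps)
  have Ad: "A * d = 1 - w" unfolding A_def d_def[symmetric] using d0 by simp
  have "(A + (A * cnj w - 1) * blaschke_factor w z) * (1 - cnj w * z)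
    = A * (1 - cnj w * z) + (A * cnj w - 1) * (z - w)"
    using q unfolding blaschke_factor_def by (simp add: distrib_right)
  also have "\<dots> = A * d - z + w" unfolding d by (simp add: algebra_simps)
  also have "\<dots> = 1 - z" using Ad by simp
  finally have 2: "A + (A * cnj w - 1) * blaschke_factor w z = (1 - z) / (1 - cnj w * z)"
    using q by (simp add: eq_divide_eq)
  show ?thesis unfolding 1 2 localizer_def d_def[symmetric] by (simp add: power2_eq_square)
qed

lemma localizer_coefficient_le:
  assumes "cmod w < 1" "cmod (1 - w) \<le> C * (1 - cmod w)" "C \<ge> 1"
  shows "cmod ((1 - w) / (1 - of_real ((cmod w)\<^sup>2))) \<le> C"
    "cmod ((1 - w) / (1 - of_real ((cmod w)\<^sup>2)) * cnj w - 1) \<le> C + 1"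
    "1 / 2 \<le> cmod ((1 - w) / (1 - of_real ((cmod w)\<^sup>2)))"
proof -
  define d where "d = 1 - (cmod w)\<^sup>2"
  have d: "1 - cmod w \<le> d" "d \<le> 2 * (1 - cmod w)" "d > 0"
  proof -
    have e: "d = (1 + cmod w) * (1 - cmod w)" by (simp add: d_def power2_eq_square algebra_simps)
    show "d \<le> 2 * (1 - cmod w)" unfolding e using assms by (intro mult_right_mono) auto
    have "1 * (1 - cmod w) \<le> d" unfolding e using assms by (intro mult_right_mono) auto
    then show "1 - cmod w \<le> d" by simp
    then show "d > 0" using assms by simp
  qed
  have n: "cmod ((1 - w) / (1 - of_real ((cmod w)\<^sup>2))) = cmod (1 - w) / d"
  proof -
    have "1 - complex_of_real ((cmod w)\<^sup>2) = of_real d" by (simp add: d_def)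
    then show ?thesis using d(3) by (simp only: norm_divide norm_of_real abs_of_pos)
  qed
  have "cmod (1 - w) \<le> C * d" using assms d(1) mult_left_mono[OF d(1), of C] by linarith
  then show le: "cmod ((1 - w) / (1 - of_real ((cmod w)\<^sup>2))) \<le> C" unfolding n using d(3) by (simp add: divide_le_eq)
  have "1 - cmod w \<le> cmod (1 - w)" using norm_triangle_ineq2[of 1 w] by simp
  then show "1 / 2 \<le> cmod ((1 - w) / (1 - of_real ((cmod w)\<^sup>2)))" unfolding n using d by (simp add: le_divide_eq)
  let ?A = "(1 - w) / (1 - of_real ((cmod w)\<^sup>2))"
  have "cmod (?A * cnj w - 1) \<le> cmod (?A * cnj w) + cmod 1" by (rule norm_triangle_ineq4)
  also have "cmod (?A * cnj w) \<le> cmod ?A"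
    unfolding norm_mult using assms(1) by (intro mult_left_le) auto
  finally show "cmod (?A * cnj w - 1) \<le> C + 1" using le by simp
qed

lemma localizer_holomorphic: "cmod w < 1 \<Longrightarrow> localizer w holomorphic_on unit_disk"
  unfolding localizer_def using one_minus_nonpos(2)[of "cnj w"]
  by (intro holomorphic_intros) auto

lemma norm_localizer_le:
  assumes w: "cmod w < 1" "cmod (1 - w) \<le> C * (1 - cmod w)" and C: "C \<ge> 1" and z: "cmod z < 1"
  shows "cmod (localizer w z) \<le> 2 * (2 * C + 1)"
proof -
  let ?A = "(1 - w) / (1 - of_real ((cmod w)\<^sup>2))" and ?b = "blaschke_factor w z"
  note l = localizer_coefficient_le[OF w C] and b = norm_blaschke_factor_le_1[OF w(1) z]
  have "cmod (1 + cnj w * ?b) \<le> 1 + cmod w * cmod ?b"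
    by (rule order_trans[OF norm_triangle_ineq]) (simp add: norm_mult)
  also have "cmod w * cmod ?b \<le> 1" using w(1) b by (simp add: mult_le_one)
  finally have 1: "cmod (1 + cnj w * ?b) \<le> 2" by simp
  have "cmod (?A + (?A * cnj w - 1) * ?b) \<le> cmod ?A + cmod (?A * cnj w - 1) * cmod ?b"
    by (rule order_trans[OF norm_triangle_ineq]) (simp only: norm_mult order_refl)
  also have "\<dots> \<le> C + (C + 1) * 1" using l b C by (intro add_mono mult_mono) auto
  finally have 2: "cmod (?A + (?A * cnj w - 1) * ?b) \<le> 2 * C + 1" by simp
  show ?thesis unfolding localizer_eq[OF w(1) z] norm_mult by (intro mult_mono 1 2) auto
qed

lemma norm_localizer_self_ge:
  assumes w: "cmod w < 1" "cmod (1 - w) \<le> C * (1 - cmod w)" and C: "C \<ge> 1"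
  shows "1 / 2 \<le> cmod (localizer w w)"
proof -
  have "blaschke_factor w w = 0" by (simp add: blaschke_factor_def)
  then show ?thesis unfolding localizer_eq[OF w(1) w(1)] using localizer_coefficient_le(3)[OF w C] by simp
qed

lemma norm_localizer_le_depth_ratio:
  assumes w: "cmod w < 1" and C: "C \<ge> 1" and u: "cmod u < 1" "cmod (1 - u) \<le> C * (1 - cmod u)"
  shows "cmod (localizer w u) \<le> 2 * C * depth_ratio u w"
proof -
  have "1 - cmod u \<le> cmod (1 - cnj w * u)" using norm_one_minus_ge[of "cnj w" u] w u by simp
  moreover have "1 - cmod w \<le> cmod (1 - cnj w * u)"
    using norm_one_minus_ge[of u "cnj w"] w u by (simp add: mult.commute)
  ultimately have m: "max (1 - cmod u) (1 - cmod w) \<le> cmod (1 - cnj w * u)" by simp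
  have "1 - (cmod w)\<^sup>2 = (1 + cmod w) * (1 - cmod w)" by (simp add: power2_eq_square algebra_simps)
  also have "\<dots> \<le> 2 * (1 - cmod w)" using w by (intro mult_right_mono) auto
  finally have d: "1 - (cmod w)\<^sup>2 \<le> 2 * (1 - cmod w)" .
  have d0: "0 \<le> 1 - (cmod w)\<^sup>2" using w by (simp add: power_le_one)
  have "cmod (1 - complex_of_real ((cmod w)\<^sup>2)) = 1 - (cmod w)\<^sup>2"
    using d0 by (metis abs_of_nonneg norm_of_real of_real_1 of_real_diff)
  then have "cmod (localizer w u) = cmod (1 - u) * (1 - (cmod w)\<^sup>2) / (cmod (1 - cnj w * u))\<^sup>2"
    unfolding localizer_def by (simp only: norm_mult norm_divide norm_power)
  also have "\<dots> \<le> (C * (1 - cmod u)) * (2 * (1 - cmod w)) / (max (1 - cmod u) (1 - cmod w))\<^sup>2"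
    using u d d0 m C by (intro frac_le mult_mono power_mono mult_nonneg_nonneg) auto
  finally show ?thesis by (simp add: depth_ratio_eq[OF u(1) w] mult_ac)
qed

lemma localizer_multiplier:
  assumes \<alpha>: "\<alpha> > 0" and K: "bounded_multiplier \<alpha> K (blaschke_factor w)"
    and w: "cmod w < 1" "cmod (1 - w) \<le> C * (1 - cmod w)" and C: "C \<ge> 1"
  shows "bounded_multiplier \<alpha> ((1 + K) * (C + (C + 1) * K)) (localizer w)"
proof (rule bounded_multiplier_cong)
  have K0: "K \<ge> 0" using K by (simp add: bounded_multiplier_def)
  have c: "bounded_multiplier \<alpha> D (\<lambda>_. c)" if "cmod c \<le> D" for c D
    by (rule bounded_multiplier_mono[OF bounded_multiplier_const[OF \<alpha>] that])
  let ?A = "(1 - w) / (1 - of_real ((cmod w)\<^sup>2))"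
  have "bounded_multiplier \<alpha> ((1 + 1 * K) * (C + (C + 1) * K))
     (\<lambda>z. (1 + cnj w * blaschke_factor w z) * (?A + (?A * cnj w - 1) * blaschke_factor w z))"
    by (intro bounded_multiplier_mult bounded_multiplier_add \<alpha> c K localizer_coefficient_le[OF w C])
      (use w in auto)
  then show "bounded_multiplier \<alpha> ((1 + K) * (C + (C + 1) * K))
     (\<lambda>z. (1 + cnj w * blaschke_factor w z) * (?A + (?A * cnj w - 1) * blaschke_factor w z))" by simp
  show "(1 + cnj w * blaschke_factor w z) * (?A + (?A * cnj w - 1) * blaschke_factor w z) = localizer w z"
    if "z \<in> unit_disk" for z using localizer_eq[OF w(1)] that by simp
qed

lemma blaschke_factor_has_derivative_self:
  assumes "cmod w < 1"
  shows "(blaschke_factor w has_field_derivative 1 / (1 - of_real ((cmod w)\<^sup>2))) (at w)"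
proof -
  have q: "1 - cnj w * w \<noteq> 0" using one_minus_nonpos(2)[of "cnj w" w] assms by simp
  have d: "1 - complex_of_real ((cmod w)\<^sup>2) = 1 - cnj w * w" by (simp only: complex_norm_square mult.commute)
  have "((\<lambda>z. (z - w) / (1 - cnj w * z)) has_field_derivative
    (1 * (1 - cnj w * w) - (w - w) * (- cnj w)) / ((1 - cnj w * w) * (1 - cnj w * w))) (at w)"
    using q by (intro DERIV_divide) (auto intro!: derivative_eq_intros)
  then show ?thesis unfolding d blaschke_factor_def[abs_def] using q by simp
qed

text \<open>The functions \<open>\<phi> k\<close> are \<open>c * b\<^sub>k * h\<^sub>k\<^sup>3 * (\<Prod>j. b\<^sub>j\<^sup>2)\<close> with \<open>j\<close> ranging over the boundedly many
  points whose depth is comparable to that of \<open>a k\<close>; the localizer \<open>h\<^sub>k\<close> takes care of the remaining points.\<close>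
lemma peak_functions:
  assumes \<alpha>: "\<alpha> > 0" and "range a \<subseteq> unit_disk" "newman_carleson a" "stoltz a"
  obtains M S :: real and \<phi> :: "nat \<Rightarrow> complex \<Rightarrow> complex"
  where "\<And>k. bounded_multiplier \<alpha> M (\<phi> k)" "\<And>k. \<phi> k holomorphic_on unit_disk"
    "\<And>k z. cmod z < 1 \<Longrightarrow> cmod (\<phi> k z) \<le> S"
    "\<And>k. deriv (\<phi> k) (a k) * (1 - of_real ((cmod (a k))\<^sup>2)) = 1"
    "\<And>k J. finite J \<Longrightarrow> k \<notin> J \<Longrightarrow> (\<Sum>j\<in>J. cmod (deriv (\<phi> k) (a j)) * (1 - (cmod (a j))\<^sup>2)) \<le> 1 / 2"
proof -
  have a: "cmod (a k) < 1" for k using assms(2) by (auto simp: image_subset_iff)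
  obtain C where C: "C \<ge> 1" "\<And>k. cmod (1 - a k) \<le> C * (1 - cmod (a k))"
    using stoltz_bound[OF assms(2,4)] by metis
  obtain \<delta> where \<delta>: "\<delta> > 0" "\<And>n J. finite J \<Longrightarrow> n \<notin> J \<Longrightarrow> \<delta> \<le> (\<Prod>j\<in>J. cmod (blaschke_factor (a j) (a n)))"
    using newman_carleson_bound[OF assms(2,3)] by metis
  obtain L where L: "L \<ge> 1" "\<And>n J. finite J \<Longrightarrow> (\<Sum>j\<in>J. depth_ratio (a j) (a n)) \<le> L"
    using depth_ratio_sum_bound[OF assms(2-4)] by metis
  obtain K where K: "K \<ge> 1" "\<And>w. cmod w < 1 \<Longrightarrow> bounded_multiplier \<alpha> K (blaschke_factor w)"
    using blaschke_factor_multiplier[OF \<alpha>] by metis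
  define b where "b k = blaschke_factor (a k)" for k
  define h where "h k = localizer (a k)" for k
  define H where "H = 2 * (2 * C + 1)"
  \<comment> \<open>Bounds the normalising constants \<open>c k\<close>: at \<open>a k\<close> the
    cube of the localizer is at least 1/8 and the product of squares at least
    \<open>\<delta>\<^sup>2\<close> in modulus.\<close>
  define S where "S = 8 / \<delta>\<^sup>2"
  \<comment> \<open>Chosen so that the total \<open>64 * H * S * C\<^sup>2 * \<epsilon> * L\<close>
    of the contributions of the far points is exactly 1/2.\<close>
  define \<epsilon> where "\<epsilon> = 1 / (128 * H * S * C\<^sup>2 * L)"
  have H: "H > 0" and S: "S > 0" using C \<delta> by (auto simp: H_def S_def)
  have \<epsilon>: "\<epsilon> > 0" using H S C L by (simp add: \<epsilon>_def)
  define N where "N k = {j. j \<noteq> k \<and> \<epsilon> \<le> depth_ratio (a j) (a k)}" for k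
  define m where "m = nat \<lfloor>L / \<epsilon>\<rfloor>"
  have N: "finite (N k) \<and> card (N k) \<le> m" for k
  \<comment> \<open>Each near point contributes at least \<epsilon> to a sum of depth ratios bounded
    by \<open>L\<close>, so their number is at most \<open>m\<close>, independently of
    \<open>k\<close>.\<close>
  proof (rule finite_if_finite_subsets_card_bdd)
    fix G assume G: "G \<subseteq> N k" "finite G"
    have "real (card G) * \<epsilon> = (\<Sum>j\<in>G. \<epsilon>)" by simp
    also have "\<dots> \<le> (\<Sum>j\<in>G. depth_ratio (a j) (a k))" using G by (intro sum_mono) (auto simp: N_def)
    also have "\<dots> \<le> L" by (rule L) fact
    finally have "real (card G) \<le> L / \<epsilon>" using \<epsilon> by (simp add: le_divide_eq)
    then show "card G \<le> m" unfolding m_def by (metis le_nat_floor)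
  qed
  \<comment> \<open>The squares give double zeros, so that both the value and the derivative vanish
    at the near points.\<close>
  define R where "R k z = (\<Prod>j\<in>N k. (b j z)\<^sup>2)" for k z
  define c where "c k = 1 / (h k (a k) ^ 3 * R k (a k))" for k
  define Q where "Q k z = c k * (b k z * R k z)" for k z
  \<comment> \<open>Differentiating the cube leaves at least two factors \<open>h k\<close>, each at
    most \<open>2 * C\<close> times the depth ratio at a point of the sequence. At far points one
    ratio is below \<epsilon>, and the other remains for the summation over
    \<open>j\<close>.\<close>
  define \<phi> where "\<phi> k z = h k z ^ 3 * Q k z" for k z
  have b_hol: "b k holomorphic_on unit_disk" for k
    unfolding b_def by (rule blaschke_factor_holomorphic[OF a])
  have h_hol: "h k holomorphic_on unit_disk" for k
    unfolding h_def by (rule localizer_holomorphic[OF a])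
  have R_hol: "R k holomorphic_on unit_disk" for k
    unfolding R_def by (intro holomorphic_intros b_hol)
  have Q_hol: "Q k holomorphic_on unit_disk" for k
    unfolding Q_def by (intro holomorphic_intros b_hol R_hol)
  have \<phi>_hol: "\<phi> k holomorphic_on unit_disk" for k
    unfolding \<phi>_def by (intro holomorphic_intros h_hol Q_hol)
  have b_le: "cmod (b k z) \<le> 1" if "cmod z < 1" for k z
    unfolding b_def by (rule norm_blaschke_factor_le_1[OF a that])
  have R_le: "cmod (R k z) \<le> 1" if "cmod z < 1" for k z
    unfolding R_def prod_norm[symmetric] norm_power using b_le[OF that]
    by (intro prod_le_1) (auto simp: power_le_one)
  have h_le: "cmod (h k z) \<le> H" if "cmod z < 1" for k z
    unfolding h_def H_def by (rule norm_localizer_le[OF a C(2) C(1) that])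
  have h_self: "1 / 2 \<le> cmod (h k (a k))" for k
    unfolding h_def by (rule norm_localizer_self_ge[OF a C(2) C(1)])
  have R_self: "\<delta>\<^sup>2 \<le> cmod (R k (a k))" for k
  proof -
    have "\<delta> \<le> (\<Prod>j\<in>N k. cmod (b j (a k)))" unfolding b_def using N by (intro \<delta>) (auto simp: N_def)
    then have "\<delta>\<^sup>2 \<le> (\<Prod>j\<in>N k. cmod (b j (a k)))\<^sup>2" using \<delta>(1) by (intro power_mono) auto
    then show ?thesis by (simp add: R_def prod_norm[symmetric] norm_power prod_power_distrib)
  qed
  have c_nz: "h k (a k) ^ 3 * R k (a k) \<noteq> 0" for k
    using h_self[of k] R_self[of k] \<delta>(1) by auto
  have c_le: "cmod (c k) \<le> S" for k
  proof -
    have "(1 / 2) ^ 3 * \<delta>\<^sup>2 \<le> cmod (h k (a k)) ^ 3 * cmod (R k (a k))"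
      using h_self R_self \<delta>(1) by (intro mult_mono power_mono) auto
    then have "1 / (cmod (h k (a k)) ^ 3 * cmod (R k (a k))) \<le> 1 / ((1 / 2) ^ 3 * \<delta>\<^sup>2)"
      by (rule frac_le[rotated 3]) (use \<delta>(1) in auto)
    also have "1 / ((1 / 2) ^ 3 * \<delta>\<^sup>2) = S" by (simp add: S_def power3_eq_cube)
    finally show ?thesis by (simp add: c_def norm_divide norm_mult norm_power)
  qed
  have Q_le: "cmod (Q k z) \<le> S" if "cmod z < 1" for k z
  proof -
    have "cmod (Q k z) \<le> S * (1 * 1)"
      unfolding Q_def norm_mult using c_le S by (intro mult_mono b_le R_le that) auto
    then show ?thesis by simp
  qed
  have hd: "(f has_field_derivative deriv f z) (at z)" if "f holomorphic_on unit_disk" "cmod z < 1" for f z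
    using holomorphic_derivI[OF that(1) open_ball, of z] that(2) by simp
  have d\<phi>: "deriv (\<phi> k) z = 3 * (h k z)\<^sup>2 * deriv (h k) z * Q k z + h k z ^ 3 * deriv (Q k) z" if z: "cmod z < 1" for k z
    unfolding \<phi>_def
    by (rule DERIV_imp_deriv)
      (use hd[OF h_hol z, of k] hd[OF Q_hol z, of k] in
        \<open>auto intro!: derivative_eq_intros simp: power2_eq_square power3_eq_cube algebra_simps\<close>)
  show thesis
  \<comment> \<open>The factors of the multiplier bound belong to the cube of the localizer, to
    \<open>c k\<close>, to \<open>b k\<close>, and to the at most \<open>m\<close> squares in
    \<open>R k\<close>.\<close>
  proof (rule that[of "((1 + K) * (C + (C + 1) * K)) ^ 3 * (S * (K * (K ^ 2) ^ m))" \<phi> "H ^ 3 * S"])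
    fix k
    show "\<phi> k holomorphic_on unit_disk" by (rule \<phi>_hol)
    show "cmod (\<phi> k z) \<le> H ^ 3 * S" if "cmod z < 1" for z
      unfolding \<phi>_def norm_mult norm_power
      using H h_le[OF that] Q_le[OF that] by (intro mult_mono power_mono) auto
    have "bounded_multiplier \<alpha> ((K ^ 2) ^ m) (R k)"
      unfolding R_def
    proof (rule bounded_multiplier_mono[OF bounded_multiplier_prod[OF \<alpha>]])
      show "(K ^ 2) ^ card (N k) \<le> (K ^ 2) ^ m" using K N[of k] by (intro power_increasing) auto
      show "bounded_multiplier \<alpha> (K ^ 2) (\<lambda>z. (b j z)\<^sup>2)" for j
        unfolding b_def by (intro bounded_multiplier_power \<alpha> K a)
    qed (use N in simp)
    then have "bounded_multiplier \<alpha> (S * (K * (K ^ 2) ^ m)) (Q k)"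
      unfolding Q_def b_def
      by (intro bounded_multiplier_mult K a bounded_multiplier_mono[OF bounded_multiplier_const[OF \<alpha>] c_le])
    then show "bounded_multiplier \<alpha> (((1 + K) * (C + (C + 1) * K)) ^ 3 * (S * (K * (K ^ 2) ^ m))) (\<phi> k)"
      unfolding \<phi>_def h_def
      by (intro bounded_multiplier_mult bounded_multiplier_power \<alpha> localizer_multiplier K a C)
    have bk: "b k (a k) = 0" by (simp add: b_def blaschke_factor_def)
    have db: "(b k has_field_derivative 1 / (1 - of_real ((cmod (a k))\<^sup>2))) (at (a k))"
      unfolding b_def by (rule blaschke_factor_has_derivative_self[OF a])
    \<comment> \<open>Since \<open>b k\<close> vanishes at \<open>a k\<close>, only the term with
      its derivative survives, and \<open>c k\<close> normalises the result.\<close>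
    have "((\<lambda>z. c k * (b k z * R k z)) has_field_derivative c k * (R k (a k) / (1 - of_real ((cmod (a k))\<^sup>2)))) (at (a k))"
      using db hd[OF R_hol a, of k k] bk by (auto intro!: derivative_eq_intros)
    then have "deriv (Q k) (a k) = c k * (R k (a k) / (1 - of_real ((cmod (a k))\<^sup>2)))"
      unfolding Q_def by (rule DERIV_imp_deriv)
    then have "deriv (\<phi> k) (a k) = c k * (h k (a k) ^ 3 * R k (a k)) / (1 - of_real ((cmod (a k))\<^sup>2))"
      by (simp add: d\<phi>[OF a] Q_def bk)
    also have "c k * (h k (a k) ^ 3 * R k (a k)) = 1" using c_nz[of k] by (simp add: c_def)
    finally have "deriv (\<phi> k) (a k) = 1 / (1 - of_real ((cmod (a k))\<^sup>2))" .
    moreover have "1 - complex_of_real ((cmod (a k))\<^sup>2) \<noteq> 0"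
    proof -
      have "(cmod (a k))\<^sup>2 < 1" using a[of k] by (simp add: power_less_one_iff)
      then have "1 - (cmod (a k))\<^sup>2 \<noteq> 0" by simp
      then show ?thesis by (metis of_real_1 of_real_diff of_real_eq_0_iff)
    qed
    ultimately show "deriv (\<phi> k) (a k) * (1 - of_real ((cmod (a k))\<^sup>2)) = 1" by simp
    have near: "deriv (\<phi> k) (a j) = 0" if j: "j \<in> N k" for j
    proof -
      define T where "T z = c k * (b k z * (\<Prod>i\<in>N k - {j}. (b i z)\<^sup>2))" for z
      have T_hol: "T holomorphic_on unit_disk"
        unfolding T_def by (intro holomorphic_intros b_hol)
      have bj: "b j (a j) = 0" by (simp add: b_def blaschke_factor_def)
      have QT: "Q k z = (b j z)\<^sup>2 * T z" for z
        unfolding Q_def T_def R_def using N[of k] j by (subst prod.remove[of _ j]) auto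
      have "deriv (Q k) (a j) = 0"
        unfolding QT[abs_def] by (rule DERIV_imp_deriv)
          (use hd[OF T_hol a, of j] hd[OF b_hol a, of j j] bj in \<open>auto intro!: derivative_eq_intros\<close>)
      then show ?thesis by (simp add: d\<phi>[OF a] QT bj)
    qed
    have far: "cmod (deriv (\<phi> k) (a j)) * (1 - (cmod (a j))\<^sup>2) \<le> 64 * H * S * C\<^sup>2 * \<epsilon> * depth_ratio (a j) (a k)"
      if j: "j \<noteq> k" "j \<notin> N k" for j
    proof -
      define s where "s = 1 - (cmod (a j))\<^sup>2"
      define p where "p = cmod (h k (a j))"
      have s: "s \<ge> 0" using a[of j] by (simp add: s_def power_le_one)
      have "cmod (deriv (\<phi> k) (a j)) * s
        \<le> (3 * p\<^sup>2 * cmod (deriv (h k) (a j)) * cmod (Q k (a j)) + p ^ 3 * cmod (deriv (Q k) (a j))) * s"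
        unfolding d\<phi>[OF a] p_def
        by (intro mult_right_mono s order_trans[OF norm_triangle_ineq]) (simp add: norm_mult norm_power)
      also have "\<dots> = 3 * p\<^sup>2 * (cmod (deriv (h k) (a j)) * s) * cmod (Q k (a j)) + p\<^sup>2 * p * (cmod (deriv (Q k) (a j)) * s)"
        by (simp add: power2_eq_square power3_eq_cube algebra_simps)
      also have "\<dots> \<le> 3 * p\<^sup>2 * (4 * H) * S + p\<^sup>2 * H * (4 * S)"
      proof (rule add_mono)
        have "cmod (deriv (h k) (a j)) * s \<le> 4 * H"
          unfolding s_def by (rule norm_deriv_unit_disk_le[OF h_hol h_le a])
        then show "3 * p\<^sup>2 * (cmod (deriv (h k) (a j)) * s) * cmod (Q k (a j)) \<le> 3 * p\<^sup>2 * (4 * H) * S"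
          by (intro mult_mono[OF mult_left_mono Q_le[OF a]]) (use H in auto)
        have "cmod (deriv (Q k) (a j)) * s \<le> 4 * S"
          unfolding s_def by (rule norm_deriv_unit_disk_le[OF Q_hol Q_le a])
        moreover have "p \<le> H" unfolding p_def by (rule h_le[OF a])
        ultimately show "p\<^sup>2 * p * (cmod (deriv (Q k) (a j)) * s) \<le> p\<^sup>2 * H * (4 * S)"
          by (intro mult_mono[OF mult_left_mono]) (use H s in auto)
      qed
      also have "\<dots> = 16 * H * S * p\<^sup>2" by simp
      also have "\<dots> \<le> 16 * H * S * (2 * C * depth_ratio (a j) (a k))\<^sup>2"
        using H S by (intro mult_left_mono power_mono)
          (auto simp: p_def h_def intro!: norm_localizer_le_depth_ratio a C)
      also have "\<dots> = 64 * H * S * C\<^sup>2 * (depth_ratio (a j) (a k) * depth_ratio (a j) (a k))"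
        by (simp add: power2_eq_square)
      also have "\<dots> \<le> 64 * H * S * C\<^sup>2 * (\<epsilon> * depth_ratio (a j) (a k))"
        using H S C j depth_ratio_bounds(1)[OF a a, of j k]
        by (intro mult_left_mono mult_right_mono) (auto simp: N_def)
      finally show ?thesis by (simp add: s_def mult.assoc)
    qed
    fix J assume J: "finite J" "k \<notin> J"
    have "(\<Sum>j\<in>J. cmod (deriv (\<phi> k) (a j)) * (1 - (cmod (a j))\<^sup>2))
      \<le> (\<Sum>j\<in>J. 64 * H * S * C\<^sup>2 * \<epsilon> * depth_ratio (a j) (a k))"
    proof (rule sum_mono)
      fix j assume "j \<in> J"
      then have "j \<noteq> k" using J by auto
      then show "cmod (deriv (\<phi> k) (a j)) * (1 - (cmod (a j))\<^sup>2) \<le> 64 * H * S * C\<^sup>2 * \<epsilon> * depth_ratio (a j) (a k)"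
        using near[of j] far[of j] H S C \<epsilon> depth_ratio_bounds(1)[OF a a, of j k]
        by (cases "j \<in> N k") auto
    qed
    also have "\<dots> = 64 * H * S * C\<^sup>2 * \<epsilon> * (\<Sum>j\<in>J. depth_ratio (a j) (a k))" by (simp add: sum_distrib_left)
    also have "\<dots> \<le> 64 * H * S * C\<^sup>2 * \<epsilon> * L"
      using H S C \<epsilon> by (intro mult_left_mono L J) auto
    also have "\<dots> = 1 / 2" using H S C L by (simp add: \<epsilon>_def field_simps)
    finally show "(\<Sum>j\<in>J. cmod (deriv (\<phi> k) (a j)) * (1 - (cmod (a j))\<^sup>2)) \<le> 1 / 2" .
  qed
qed

text \<open>Up to an error of half the norm, \<open>\<Sum>k. v\<^sub>k * \<phi>\<^sub>k\<close> interpolates \<open>v\<close>; summing the functions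
  obtained by iterating on the error gives exact interpolation, by telescoping.\<close>
lemma multiplier_interpolation:
  assumes \<alpha>: "\<alpha> > 0" and "range a \<subseteq> unit_disk" "newman_carleson a" "stoltz a"
    and x: "summable (\<lambda>k. cmod (x k))"
  obtains f C where "f holomorphic_on unit_disk" "bounded_multiplier \<alpha> C f"
    "\<And>k. deriv f (a k) * (1 - of_real ((cmod (a k))\<^sup>2)) = x k"
proof -
  have a: "cmod (a k) < 1" for k using assms(2) by (auto simp: image_subset_iff)
  obtain M S :: real and \<phi> :: "nat \<Rightarrow> complex \<Rightarrow> complex"
    where M: "\<And>k. bounded_multiplier \<alpha> M (\<phi> k)" and hol: "\<And>k. \<phi> k holomorphic_on unit_disk"
    and S: "\<And>k z. cmod z < 1 \<Longrightarrow> cmod (\<phi> k z) \<le> S"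
    and self: "\<And>k. deriv (\<phi> k) (a k) * (1 - of_real ((cmod (a k))\<^sup>2)) = 1"
    and off: "\<And>k J. finite J \<Longrightarrow> k \<notin> J \<Longrightarrow> (\<Sum>j\<in>J. cmod (deriv (\<phi> k) (a j)) * (1 - (cmod (a j))\<^sup>2)) \<le> 1 / 2"
    by (rule peak_functions[OF assms(1-4)]) (rule that)
  have M0: "M \<ge> 0" using M[of 0] by (simp add: bounded_multiplier_def)
  have S0: "S \<ge> 0" using S[of 0 0] norm_ge_zero[of "\<phi> 0 0"] by (simp del: norm_ge_zero)
  define s where "s j = 1 - complex_of_real ((cmod (a j))\<^sup>2)" for j
  have ns: "cmod (s j) = 1 - (cmod (a j))\<^sup>2" for j
  proof -
    have "0 \<le> 1 - (cmod (a j))\<^sup>2" using a[of j] by (simp add: power_le_one)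
    then show ?thesis unfolding s_def by (metis abs_of_nonneg norm_of_real of_real_1 of_real_diff)
  qed
  define g where "g v z = (\<Sum>k. v k * \<phi> k z)" for v z
  \<comment> \<open>The error left when \<open>g v\<close> is used to interpolate \<open>v\<close>;
    it is linear in \<open>v\<close> up to convergence, and \<open>half\<close> shows that it halves
    the norm.\<close>
  define r where "r v j = v j - deriv (g v) (a j) * s j" for v j
  define X where "X = (\<Sum>k. cmod (x k))"
  have X: "X \<ge> 0" unfolding X_def by (intro suminf_nonneg x) simp
  have g: "bounded_multiplier \<alpha> (B * M) (g v)" "g v holomorphic_on unit_disk"
    "\<And>z. cmod z < 1 \<Longrightarrow> cmod (g v z) \<le> B * S"
    "\<And>z. cmod z < 1 \<Longrightarrow> (\<lambda>k. v k * deriv (\<phi> k) z) sums deriv (g v) z"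
    if v: "summable (\<lambda>k. cmod (v k))" and B: "(\<Sum>k. cmod (v k)) \<le> B" for v B
  proof -
    have m: "bounded_multiplier \<alpha> (cmod (v k) * M) (\<lambda>z. v k * \<phi> k z)" for k
      by (rule bounded_multiplier_mult[OF bounded_multiplier_const[OF \<alpha>] M])
    have h: "(\<lambda>z. v k * \<phi> k z) holomorphic_on unit_disk" for k by (intro holomorphic_intros hol)
    have n: "\<forall>k. \<forall>z\<in>unit_disk. cmod (v k * \<phi> k z) \<le> cmod (v k) * S"
      using S by (simp add: norm_mult mult_left_mono)
    note ms = multiplier_series[OF \<alpha> m h n summable_mult2[OF v] summable_mult2[OF v], folded g_def]
    show "bounded_multiplier \<alpha> (B * M) (g v)"
      using bounded_multiplier_mono[OF ms(1), of "B * M"] mult_right_mono[OF B M0]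
      by (simp add: suminf_mult2[OF v] g_def[abs_def])
    show "g v holomorphic_on unit_disk" using ms(2) by (simp add: g_def[abs_def])
    show "cmod (g v z) \<le> B * S" if "cmod z < 1" for z
      using ms(3)[OF that] mult_right_mono[OF B S0] by (simp add: suminf_mult2[OF v] g_def)
    show "(\<lambda>k. v k * deriv (\<phi> k) z) sums deriv (g v) z" if z: "cmod z < 1" for z
    proof -
      have "deriv (\<lambda>z. v k * \<phi> k z) z = v k * deriv (\<phi> k) z" for k
        using holomorphic_on_imp_differentiable_at[OF hol open_ball, of z k] z by (intro deriv_cmult) simp
      then show ?thesis using ms(4)[OF z] by (simp add: g_def[abs_def])
    qed
  qed
  have half: "summable (\<lambda>j. cmod (r v j)) \<and> (\<Sum>j. cmod (r v j)) \<le> (\<Sum>k. cmod (v k)) / 2"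
    if v: "summable (\<lambda>k. cmod (v k))" for v
  proof -
    \<comment> \<open>The matrix of the error without its diagonal, where \<open>\<phi> k\<close>
      takes exactly the required value. The peak functions bound its sums over \<open>j\<close> for
      fixed \<open>k\<close>, which after exchanging the summations is what the \<open>l^1\<close>
      norm of the error needs.\<close>
    define E where "E k j = (if k = j then 0 else cmod (deriv (\<phi> k) (a j)) * (1 - (cmod (a j))\<^sup>2))" for k j
    have E0: "E k j \<ge> 0" for k j using a[of j] by (auto simp: E_def power_le_one)
    have EJ: "(\<Sum>j\<in>J. E k j) \<le> 1 / 2" if "finite J" for k J
    proof -
      have "(\<Sum>j\<in>J. E k j) = (\<Sum>j\<in>J - {k}. E k j)"
        using that by (intro sum.mono_neutral_right) (auto simp: E_def)
      also have "\<dots> = (\<Sum>j\<in>J - {k}. cmod (deriv (\<phi> k) (a j)) * (1 - (cmod (a j))\<^sup>2))"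
        by (intro sum.cong refl) (auto simp: E_def)
      finally show ?thesis using off[of "J - {k}" k] that by simp
    qed
    have E1: "E k j \<le> 1 / 2" for k j using EJ[of "{j}" k] by simp
    have sE: "summable (\<lambda>k. cmod (v k) * E k j)" for j
    proof (rule summable_comparison_test'[OF summable_mult2[OF v, of "1 / 2"]])
      show "norm (cmod (v k) * E k j) \<le> cmod (v k) * (1 / 2)" for k
        using mult_left_mono[OF E1[of k j], of "cmod (v k)"] E0[of k j] by (simp only: norm_mult) simp
    qed
    have rj: "cmod (r v j) \<le> (\<Sum>k. cmod (v k) * E k j)" for j
    proof -
      have "(\<lambda>k. if k = j then v k else 0) sums v j" by (rule sums_single)
      moreover have "(\<lambda>k. v k * deriv (\<phi> k) (a j) * s j) sums (deriv (g v) (a j) * s j)"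
        by (intro sums_mult2 g(4)[OF v order_refl a])
      ultimately have d: "(\<lambda>k. (if k = j then v k else 0) - v k * deriv (\<phi> k) (a j) * s j) sums r v j"
        unfolding r_def by (rule sums_diff)
      have n: "cmod ((if k = j then v k else 0) - v k * deriv (\<phi> k) (a j) * s j) = cmod (v k) * E k j" for k
      proof (cases "k = j")
        case True
        then have "deriv (\<phi> k) (a j) * s j = 1" using self[of j] by (simp add: s_def)
        then have "v k * deriv (\<phi> k) (a j) * s j = v k" by (simp add: mult.assoc)
        then show ?thesis using True by (simp add: E_def)
      next
        case False then show ?thesis by (simp add: E_def norm_mult ns)
      qed
      have "cmod (\<Sum>k. (if k = j then v k else 0) - v k * deriv (\<phi> k) (a j) * s j)
        \<le> (\<Sum>k. cmod ((if k = j then v k else 0) - v k * deriv (\<phi> k) (a j) * s j))"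
        by (rule summable_norm) (simp only: n sE)
      then show ?thesis unfolding n sums_unique[OF d, symmetric] .
    qed
    have fin: "(\<Sum>j\<in>J. cmod (r v j)) \<le> (\<Sum>k. cmod (v k)) / 2" if J: "finite J" for J
    proof -
      have "(\<Sum>j\<in>J. cmod (r v j)) \<le> (\<Sum>j\<in>J. \<Sum>k. cmod (v k) * E k j)" by (intro sum_mono rj)
      also have "\<dots> = (\<Sum>k. \<Sum>j\<in>J. cmod (v k) * E k j)" by (rule suminf_sum[symmetric]) (rule sE)
      also have "\<dots> \<le> (\<Sum>k. cmod (v k) * (1 / 2))"
      proof (intro suminf_le summable_sum sE summable_mult2 v)
        show "(\<Sum>j\<in>J. cmod (v k) * E k j) \<le> cmod (v k) * (1 / 2)" for k
          unfolding sum_distrib_left[symmetric] by (intro mult_left_mono EJ J) simp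
      qed
      also have "\<dots> = (\<Sum>k. cmod (v k)) / 2" by (subst suminf_mult2[OF v, symmetric]) simp
      finally show ?thesis .
    qed
    have "summable (\<lambda>j. cmod (r v j))" by (rule summableI_nonneg_bounded[OF _ fin]) auto
    then show ?thesis using suminf_le_const[OF _ fin[OF finite_lessThan]] by blast
  qed
  \<comment> \<open>The error still to be corrected after \<open>n\<close> rounds. Its norm is at
    most \<open>(1 / 2) ^ n * X\<close>, so both the multiplier bounds and the supremum bounds of
    \<open>g (V n)\<close> are summable.\<close>
  define V where "V n = (r ^^ n) x" for n
  have V: "summable (\<lambda>k. cmod (V n k)) \<and> (\<Sum>k. cmod (V n k)) \<le> (1 / 2) ^ n * X" for n
  proof (induction n)
    case 0 show ?case using x by (simp add: V_def X_def)
  next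
    case (Suc n)
    have "V (Suc n) = r (V n)" by (simp add: V_def)
    then show ?case using half[of "V n"] Suc by simp
  qed
  have geo: "summable (\<lambda>n. (1 / 2) ^ n * X * y)" for y :: real
    by (intro summable_mult2 summable_geometric) simp
  have gbd: "\<forall>n. \<forall>z\<in>unit_disk. cmod (g (V n) z) \<le> (1 / 2) ^ n * X * S"
    using g(3)[OF conjunct1[OF V] conjunct2[OF V]] by simp
  note ms = multiplier_series[OF \<alpha> g(1)[OF conjunct1[OF V] conjunct2[OF V]]
      g(2)[OF conjunct1[OF V] conjunct2[OF V]] gbd geo geo]
  show thesis
  proof (rule that[OF ms(2) ms(1)])
    fix j
    have "(\<lambda>n. deriv (g (V n)) (a j) * s j) sums (deriv (\<lambda>z. \<Sum>n. g (V n) z) (a j) * s j)"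
      by (intro sums_mult2 ms(4) a)
    moreover have d: "deriv (g (V n)) (a j) * s j = V n j - V (Suc n) j" for n
    proof -
      have "V (Suc n) = r (V n)" by (simp add: V_def)
      then show ?thesis by (simp only: r_def) simp
    qed
    have "(\<lambda>n. V n j - V (Suc n) j) sums (V 0 j - 0)"
    proof (rule telescope_sums')
      have "cmod (V n j) \<le> (1 / 2) ^ n * X" for n
        using sum_le_suminf[OF conjunct1[OF V[of n]], of "{j}"] conjunct2[OF V[of n]] by simp
      then have le: "\<forall>\<^sub>F n in sequentially. cmod (V n j) \<le> (1 / 2) ^ n * X"
        by (rule always_eventually[OF allI])
      have "(\<lambda>n. (1 / 2) ^ n * X) \<longlonglongrightarrow> 0"
        using summable_LIMSEQ_zero[OF geo[of 1]] by simp
      from Lim_null_comparison[OF le this] show "(\<lambda>n. V n j) \<longlonglongrightarrow> 0" .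
    qed
    then have "(\<lambda>n. deriv (g (V n)) (a j) * s j) sums V 0 j" by (simp only: d diff_zero)
    ultimately have "deriv (\<lambda>z. \<Sum>n. g (V n) z) (a j) * s j = V 0 j" by (rule sums_unique2)
    then show "deriv (\<lambda>z. \<Sum>n. g (V n) z) (a j) * (1 - of_real ((cmod (a j))\<^sup>2)) = x j"
      by (simp add: s_def V_def)
  qed
qed

theorem theorem3:
  fixes \<alpha> :: real and a :: "nat \<Rightarrow> complex"
  assumes "\<alpha> > 0"
    and "range a \<subseteq> unit_disk"
    and "newman_carleson a"
    and "stoltz a"
  shows "(\<forall>f\<in>multipliers \<alpha>.
            (\<lambda>k. deriv f (a k) * (1 - complex_of_real ((cmod (a k))\<^sup>2))) \<in> l1) \<and>
         (\<forall>x\<in>l1. \<exists>f\<in>multipliers \<alpha>.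
            \<forall>k. deriv f (a k) * (1 - complex_of_real ((cmod (a k))\<^sup>2)) = x k)"
proof (intro conjI ballI)
  fix f assume "f \<in> multipliers \<alpha>"
  from multiplier_deriv_summable[OF assms this]
  show "(\<lambda>k. deriv f (a k) * (1 - complex_of_real ((cmod (a k))\<^sup>2))) \<in> l1" by (simp only: l1_def mem_Collect_eq)
next
  fix x assume "x \<in> l1"
  then have "summable (\<lambda>k. cmod (x k))" by (simp add: l1_def)
  then obtain f C where f: "f holomorphic_on unit_disk" "bounded_multiplier \<alpha> C f"
    "\<And>k. deriv f (a k) * (1 - of_real ((cmod (a k))\<^sup>2)) = x k"
    using multiplier_interpolation[OF assms] by metis
  have "f \<in> multipliers \<alpha>"
    unfolding multipliers_def
  proof (intro CollectI conjI f(1) ballI)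
    fix g assume "g \<in> F_family \<alpha>"
    then obtain D where "F_bounded \<alpha> D g" by (auto simp: F_family_iff)
    from bounded_multiplierD[OF f(2) this] show "(\<lambda>z. f z * g z) \<in> F_family \<alpha>"
      by (auto simp only: F_family_iff)
  qed
  with f(3) show "\<exists>f\<in>multipliers \<alpha>. \<forall>k. deriv f (a k) * (1 - complex_of_real ((cmod (a k))\<^sup>2)) = x k" by blast
qed

end
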